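(* Let $\varphi_1,\varphi_2\in L^2(\mathbb{R}^d)$. The range $\{A_a^{\varphi_1,\varphi_2}:a\in L^2(\mathbb{R}^{2d})\}$ is norm-dense in the Hilbert-Schmidt class $\mathscr{S}^2$ if and only if $\langle\varphi_2,\pi(z)\varphi_1\rangle\neq0$ for almost all $z\in\mathbb{R}^{2d}$.
   Context: For $z=(x,\xi)\in\mathbb{R}^{2d}$ the time-frequency shift is $\pi(z)f(t)=e^{2\pi i\xi\cdot t}f(t-x)$. The short-time Fourier transform is $V_gf(z)=\langle f,\pi(z)g\rangle$ (inner product of $L^2(\mathbb{R}^d)$, linear in the first argument). For windows $\varphi_1,\varphi_2\in L^2(\mathbb{R}^d)$ and a symbol $a\in L^{2}(\mathbb{R}^{2d})$, the localization operator $A_a^{\varphi_1,\varphi_2}$ on $L^2(\mathbb{R}^d)$ is defined weakly by $\langle A_a^{\varphi_1,\varphi_2}f,g\rangle=\int_{\mathbb{R}^{2d}}a(z)\,V_{\varphi_1}f(z)\,\overline{V_{\varphi_2}g(z)}\,dz$; it is a Hilbert-Schmidt operator (a known fact). $\mathscr{S}^2$ is the space of Hilbert-Schmidt operators on $L^2(\mathbb{R}^d)$ with the Hilbert-Schmidt norm. *)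

theory Defs
  imports "HOL-Analysis.Analysis"
begin

section \<open>The Hilbert space of square-integrable functions\<close>

definition square_integrable :: "('a::euclidean_space \<Rightarrow> complex) \<Rightarrow> bool" where
  "square_integrable f \<longleftrightarrow>
     f \<in> borel_measurable lborel \<and> integrable lborel (\<lambda>x. (cmod (f x))\<^sup>2)"

definition l2_eq :: "('a::euclidean_space \<Rightarrow> complex) \<Rightarrow> ('a \<Rightarrow> complex) \<Rightarrow> bool" where
  "l2_eq f g \<longleftrightarrow> square_integrable f \<and> square_integrable g \<and> (AE x in lborel. f x = g x)"

lemma square_integrable_zero: "square_integrable (\<lambda>x. 0)"
  by (simp add: square_integrable_def)

lemma square_integrable_cmult:
  assumes "square_integrable f"
  shows "square_integrable (\<lambda>x. c * f x)"
  using assms by (auto simp: square_integrable_def norm_mult power_mult_distrib)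

lemma square_integrable_add:
  assumes "square_integrable f" "square_integrable g"
  shows "square_integrable (\<lambda>x. f x + g x)"
proof -
  have [measurable]: "f \<in> borel_measurable borel" "g \<in> borel_measurable borel"
    using assms by (auto simp: square_integrable_def)
  have "(cmod (f x + g x))\<^sup>2 \<le> 2 * (cmod (f x))\<^sup>2 + 2 * (cmod (g x))\<^sup>2" for x
  proof -
    have "(cmod (f x + g x))\<^sup>2 \<le> (cmod (f x) + cmod (g x))\<^sup>2"
      by (intro power_mono norm_triangle_ineq norm_ge_zero)
    also have "\<dots> \<le> 2 * (cmod (f x))\<^sup>2 + 2 * (cmod (g x))\<^sup>2"
      using sum_squares_bound[of "cmod (f x)" "cmod (g x)"] by (simp add: power2_sum)
    finally show ?thesis .
  qed
  moreover have "integrable lborel (\<lambda>x. 2 * (cmod (f x))\<^sup>2 + 2 * (cmod (g x))\<^sup>2)"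
    using assms by (auto simp: square_integrable_def)
  ultimately have "integrable lborel (\<lambda>x. (cmod (f x + g x))\<^sup>2)"
    by (intro Bochner_Integration.integrable_bound[OF \<open>integrable lborel (\<lambda>x. 2 * (cmod (f x))\<^sup>2 + 2 * (cmod (g x))\<^sup>2)\<close>])
       (auto intro!: AE_I2)
  then show ?thesis
    by (auto simp: square_integrable_def)
qed

lemma square_integrable_mult_cnj:
  assumes "square_integrable f" "square_integrable g"
  shows "integrable lborel (\<lambda>x. f x * cnj (g x))"
proof -
  have [measurable]: "f \<in> borel_measurable borel" "g \<in> borel_measurable borel"
    using assms by (auto simp: square_integrable_def)
  have [measurable]: "cnj \<in> borel_measurable borel"
    by (rule borel_measurable_continuous_onI[OF continuous_on_cnj[OF continuous_on_id]])
  have "integrable lborel (\<lambda>x. (cmod (f x))\<^sup>2 + (cmod (g x))\<^sup>2)"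
    using assms by (auto simp: square_integrable_def)
  then show ?thesis
  proof (rule Bochner_Integration.integrable_bound)
    show "(\<lambda>x. f x * cnj (g x)) \<in> borel_measurable lborel"
      unfolding measurable_lborel1 by measurable
    have "cmod (f x * cnj (g x)) \<le> norm ((cmod (f x))\<^sup>2 + (cmod (g x))\<^sup>2)" for x
    proof -
      have "0 \<le> cmod (f x) * cmod (g x)" by simp
      moreover have "2 * (cmod (f x) * cmod (g x)) \<le> (cmod (f x))\<^sup>2 + (cmod (g x))\<^sup>2"
        using sum_squares_bound[of "cmod (f x)" "cmod (g x)"] by (simp only: mult.assoc)
      ultimately have "cmod (f x) * cmod (g x) \<le> (cmod (f x))\<^sup>2 + (cmod (g x))\<^sup>2"
        by linarith
      then show ?thesis
        unfolding norm_mult complex_mod_cnj real_norm_def by linarith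
    qed
    then show "AE x in lborel. cmod (f x * cnj (g x)) \<le> norm ((cmod (f x))\<^sup>2 + (cmod (g x))\<^sup>2)"
      by (rule AE_I2)
  qed
qed

lemma l2_eq_part_equivp: "part_equivp l2_eq"
proof (rule part_equivpI)
  show "\<exists>f. l2_eq f f"
    using square_integrable_zero by (auto simp: l2_eq_def)
  show "symp l2_eq"
    by (auto simp: symp_def l2_eq_def)
  show "transp l2_eq"
    by (auto simp: transp_def l2_eq_def)
qed

quotient_type (overloaded) 'a l2 = "'a::euclidean_space \<Rightarrow> complex" / partial: l2_eq
  morphisms rep_l2 abs_l2
  by (rule l2_eq_part_equivp)

lift_definition scaleC :: "complex \<Rightarrow> 'a::euclidean_space l2 \<Rightarrow> 'a l2"
  is "\<lambda>c f x. c * f x"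
  by (auto simp: l2_eq_def intro: square_integrable_cmult)

lift_definition cinner :: "'a::euclidean_space l2 \<Rightarrow> 'a l2 \<Rightarrow> complex"
  is "\<lambda>f g. LINT x|lborel. f x * cnj (g x)"
proof -
  fix f1 f2 g1 g2 :: "'a \<Rightarrow> complex"
  assume f: "l2_eq f1 f2" and g: "l2_eq g1 g2"
  then have "integrable lborel (\<lambda>x. f1 x * cnj (g1 x))" "integrable lborel (\<lambda>x. f2 x * cnj (g2 x))"
    by (auto simp: l2_eq_def intro: square_integrable_mult_cnj)
  then show "(LINT x|lborel. f1 x * cnj (g1 x)) = (LINT x|lborel. f2 x * cnj (g2 x))"
    using f g by (intro integral_cong_AE) (auto simp: l2_eq_def)
qed

instantiation l2 :: (euclidean_space) ab_group_add
begin

lift_definition zero_l2 :: "'a l2" is "\<lambda>x. 0"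
  by (simp add: l2_eq_def square_integrable_zero)

lift_definition plus_l2 :: "'a l2 \<Rightarrow> 'a l2 \<Rightarrow> 'a l2" is "\<lambda>f g x. f x + g x"
  by (auto simp: l2_eq_def intro: square_integrable_add)

definition uminus_l2 :: "'a l2 \<Rightarrow> 'a l2" where
  "uminus_l2 f = scaleC (- 1) f"

definition minus_l2 :: "'a l2 \<Rightarrow> 'a l2 \<Rightarrow> 'a l2" where
  "minus_l2 f g = f + scaleC (- 1) g"

instance
proof
  fix a b c :: "'a l2"
  show "a + b + c = a + (b + c)"
    by transfer (auto simp: l2_eq_def add.assoc intro!: square_integrable_add)
  show "a + b = b + a"
    by transfer (auto simp: l2_eq_def add.commute intro!: square_integrable_add)
  show "0 + a = a"
    by transfer (auto simp: l2_eq_def)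
  show "- a + a = 0"
    unfolding uminus_l2_def
    by transfer (auto simp: l2_eq_def square_integrable_zero)
  show "a - b = a + - b"
    by (simp add: minus_l2_def uminus_l2_def)
qed

end

lemma cinner_add_left: "cinner (f + g) h = cinner f h + cinner g h"
  by transfer
     (auto simp: l2_eq_def distrib_right
       intro!: Bochner_Integration.integral_add square_integrable_mult_cnj)

lemma cinner_scaleC_left: "cinner (scaleC c f) h = c * cinner f h"
  by transfer (simp add: mult.assoc)

lemma cinner_commute: "cinner g f = cnj (cinner f g)"
proof transfer
  fix f g :: "'a \<Rightarrow> complex"
  have "(LINT x|lborel. g x * cnj (f x)) = (LINT x|lborel. cnj (f x * cnj (g x)))"
    by (simp add: mult.commute)
  also have "\<dots> = cnj (LINT x|lborel. f x * cnj (g x))"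
    by (rule Bochner_Integration.integral_cnj)
  finally show "(LINT x|lborel. g x * cnj (f x)) = cnj (LINT x|lborel. f x * cnj (g x))" .
qed

lemma cinner_self: "cinner f f = of_real (Re (cinner f f))" "0 \<le> Re (cinner f f)"
  by (transfer, simp flip: complex_norm_square of_real_power)+

lemma cinner_self_eq_0: "cinner f f = 0 \<longleftrightarrow> f = 0"
proof
  assume "cinner f f = 0"
  then show "f = 0"
  proof transfer
    fix f :: "'a \<Rightarrow> complex"
    assume f: "l2_eq f f" and "(LINT x|lborel. f x * cnj (f x)) = 0"
    then have "complex_of_real (LINT x|lborel. (cmod (f x))\<^sup>2) = 0"
      by (simp flip: complex_norm_square of_real_power)
    then have "(LINT x|lborel. (cmod (f x))\<^sup>2) = 0"
      by simp
    then have "AE x in lborel. (cmod (f x))\<^sup>2 = 0"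
      using f by (subst (asm) integral_nonneg_eq_0_iff_AE) (auto simp: l2_eq_def square_integrable_def)
    then show "l2_eq f (\<lambda>x. 0)"
      using f by (auto simp: l2_eq_def square_integrable_zero)
  qed
next
  assume "f = 0"
  then show "cinner f f = 0"
    by simp (transfer, simp)
qed

text \<open>The real Hilbert space structure underlying the complex one supplies the norm and
  the topology.\<close>

instantiation l2 :: (euclidean_space) real_inner
begin

definition scaleR_l2 :: "real \<Rightarrow> 'a l2 \<Rightarrow> 'a l2" where
  "scaleR_l2 r f = scaleC (of_real r) f"

definition inner_l2 :: "'a l2 \<Rightarrow> 'a l2 \<Rightarrow> real" where
  "inner_l2 f g = Re (cinner f g)"

definition norm_l2 :: "'a l2 \<Rightarrow> real" where
  "norm_l2 f = sqrt (Re (cinner f f))"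

definition sgn_l2 :: "'a l2 \<Rightarrow> 'a l2" where
  "sgn_l2 f = inverse (norm f) *\<^sub>R f"

definition dist_l2 :: "'a l2 \<Rightarrow> 'a l2 \<Rightarrow> real" where
  "dist_l2 f g = norm (f - g)"

definition uniformity_l2 :: "('a l2 \<times> 'a l2) filter" where
  "uniformity_l2 = (INF e\<in>{0<..}. principal {(f, g). dist f g < e})"

definition open_l2 :: "'a l2 set \<Rightarrow> bool" where
  "open_l2 U \<longleftrightarrow> (\<forall>f\<in>U. \<forall>\<^sub>F (f', g) in uniformity. f' = f \<longrightarrow> g \<in> U)"

instance
proof
  fix f g h :: "'a l2" and r s :: real and U :: "'a l2 set"
  show "dist f g = norm (f - g)" by (rule dist_l2_def)
  show "sgn f = inverse (norm f) *\<^sub>R f" by (rule sgn_l2_def)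
  show "(uniformity :: ('a l2 \<times> 'a l2) filter) =
      (INF e\<in>{0<..}. principal {(f, g). dist f g < e})"
    by (rule uniformity_l2_def)
  show "open U \<longleftrightarrow> (\<forall>f\<in>U. \<forall>\<^sub>F (f', g) in uniformity. f' = f \<longrightarrow> g \<in> U)"
    by (rule open_l2_def)
  show "r *\<^sub>R (f + g) = r *\<^sub>R f + r *\<^sub>R g"
    unfolding scaleR_l2_def
    by transfer (auto simp: l2_eq_def distrib_left intro!: square_integrable_add square_integrable_cmult)
  show "(r + s) *\<^sub>R f = r *\<^sub>R f + s *\<^sub>R f"
    unfolding scaleR_l2_def
    by transfer (auto simp: l2_eq_def distrib_right intro!: square_integrable_add square_integrable_cmult)
  show "r *\<^sub>R s *\<^sub>R f = (r * s) *\<^sub>R f"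
    unfolding scaleR_l2_def
    by transfer (auto simp: l2_eq_def mult.assoc intro!: square_integrable_cmult)
  show "1 *\<^sub>R f = f"
    unfolding scaleR_l2_def by transfer (auto simp: l2_eq_def)
  show "f \<bullet> g = g \<bullet> f"
    by (simp add: inner_l2_def cinner_commute[of g f])
  show "(f + g) \<bullet> h = f \<bullet> h + g \<bullet> h"
    by (simp add: inner_l2_def cinner_add_left)
  show "r *\<^sub>R f \<bullet> g = r * (f \<bullet> g)"
    by (simp add: inner_l2_def scaleR_l2_def cinner_scaleC_left)
  show "0 \<le> f \<bullet> f"
    unfolding inner_l2_def by (rule cinner_self(2))
  show "f \<bullet> f = 0 \<longleftrightarrow> f = 0"
  proof -
    have "Re (cinner f f) = 0 \<longleftrightarrow> cinner f f = 0"
    proof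
      assume "Re (cinner f f) = 0"
      then show "cinner f f = 0"
        using cinner_self(1)[of f] by (metis of_real_0)
    qed simp
    then show ?thesis
      by (simp only: inner_l2_def cinner_self_eq_0)
  qed
  show "norm f = sqrt (f \<bullet> f)"
    by (simp add: norm_l2_def inner_l2_def)
qed

end

section \<open>Hilbert--Schmidt operators\<close>

definition bounded_clinear :: "('a::euclidean_space l2 \<Rightarrow> 'a l2) \<Rightarrow> bool" where
  "bounded_clinear T \<longleftrightarrow> bounded_linear T \<and> (\<forall>c f. T (scaleC c f) = scaleC c (T f))"

definition orthonormal_basis :: "'a::euclidean_space l2 set \<Rightarrow> bool" where
  "orthonormal_basis E \<longleftrightarrow>
     (\<forall>e\<in>E. \<forall>e'\<in>E. cinner e e' = (if e = e' then 1 else 0)) \<and>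
     (\<forall>f. (\<forall>e\<in>E. cinner f e = 0) \<longrightarrow> f = 0)"

definition hilbert_schmidt :: "('a::euclidean_space l2 \<Rightarrow> 'a l2) set" where
  "hilbert_schmidt = {T. bounded_clinear T \<and>
     (\<exists>E. orthonormal_basis E \<and> (\<lambda>e. (norm (T e))\<^sup>2) summable_on E)}"

text \<open>Summability and the value of the sum do not depend on the orthonormal basis, so the norm is
  computed in an arbitrary one. On operators outside \<^const>\<open>hilbert_schmidt\<close> the value is
  meaningless.\<close>

definition hs_norm :: "('a::euclidean_space l2 \<Rightarrow> 'a l2) \<Rightarrow> real" where
  "hs_norm T = sqrt (\<Sum>\<^sub>\<infinity>e\<in>(SOME E. orthonormal_basis E). (norm (T e))\<^sup>2)"

definition hs_dense :: "('a::euclidean_space l2 \<Rightarrow> 'a l2) set \<Rightarrow> bool" where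
  "hs_dense R \<longleftrightarrow> R \<subseteq> hilbert_schmidt \<and>
     (\<forall>S\<in>hilbert_schmidt. \<forall>\<epsilon>>0. \<exists>T\<in>R. hs_norm (\<lambda>f. S f - T f) < \<epsilon>)"

section \<open>Time-frequency analysis\<close>

lemma square_integrable_shift:
  fixes f :: "'a::euclidean_space \<Rightarrow> complex"
  assumes "square_integrable f"
  shows "square_integrable (\<lambda>t. cis (2 * pi * (\<xi> \<bullet> t)) * f (t - x))"
proof -
  have [measurable]: "f \<in> borel_measurable borel"
    using assms by (auto simp: square_integrable_def)
  have "integrable (distr lborel borel ((+) (- x))) (\<lambda>t. (cmod (f t))\<^sup>2)"
    using assms by (simp add: lborel_distr_plus square_integrable_def)
  then have "integrable lborel (\<lambda>t. (cmod (f (t - x)))\<^sup>2)"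
    by (subst (asm) integrable_distr_eq) auto
  moreover have "(\<lambda>t. cis (2 * pi * (\<xi> \<bullet> t))) \<in> borel_measurable borel"
    by (intro borel_measurable_continuous_onI continuous_intros)
  then have "(\<lambda>t. cis (2 * pi * (\<xi> \<bullet> t)) * f (t - x)) \<in> borel_measurable lborel"
    by simp
  ultimately show ?thesis
    by (simp add: square_integrable_def norm_mult)
qed

lemma AE_lborel_shift:
  fixes x :: "'a::euclidean_space"
  assumes "AE t in lborel. P t"
  shows "AE t in lborel. P (t - x)"
proof -
  have "AE t in distr lborel borel ((+) (- x)). P t"
    using assms by (subst lborel_distr_plus)
  then have "AE t in lborel. P (- x + t)"
    by (rule AE_distrD[rotated]) simp
  then show ?thesis
    by (simp add: add.commute[of "- x"])
qed

lemma l2_eq_shift: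
  assumes "l2_eq f g"
  shows "l2_eq (\<lambda>t. cis (2 * pi * (\<xi> \<bullet> t)) * f (t - x)) (\<lambda>t. cis (2 * pi * (\<xi> \<bullet> t)) * g (t - x))"
proof -
  have "AE t in lborel. f (t - x) = g (t - x)"
    using assms by (intro AE_lborel_shift) (simp add: l2_eq_def)
  then have "AE t in lborel. cis (2 * pi * (\<xi> \<bullet> t)) * f (t - x) = cis (2 * pi * (\<xi> \<bullet> t)) * g (t - x)"
    by (rule AE_mp) (simp add: AE_I2)
  then show ?thesis
    using assms by (simp add: l2_eq_def square_integrable_shift del: mult_cancel_left)
qed

text \<open>Points of phase space are pairs \<open>z = (x, \<xi>)\<close>, and \<open>cis \<theta> = exp (\<i> * \<theta>)\<close>.\<close>

lift_definition tf_shift :: "'a \<times> 'a \<Rightarrow> 'a::euclidean_space l2 \<Rightarrow> 'a l2"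
  is "\<lambda>(x, \<xi>) f t. cis (2 * pi * (\<xi> \<bullet> t)) * f (t - x)"
  by (clarsimp simp only: prod.case l2_eq_shift split: prod.split)

definition stft :: "'a::euclidean_space l2 \<Rightarrow> 'a l2 \<Rightarrow> 'a \<times> 'a \<Rightarrow> complex" where
  "stft g f z = cinner f (tf_shift z g)"

text \<open>The weak definition: by the Riesz representation theorem exactly one map satisfies the
  identity, whose right-hand side is a bounded sesquilinear form in \<open>f\<close> and \<open>g\<close>. The symbol enters
  through a representative \<^term>\<open>rep_l2 a\<close>; the integral does not depend on its choice.\<close>

definition localization_op ::
  "'a::euclidean_space l2 \<Rightarrow> 'a l2 \<Rightarrow> ('a \<times> 'a) l2 \<Rightarrow> 'a l2 \<Rightarrow> 'a l2" where
  "localization_op \<phi>\<^sub>1 \<phi>\<^sub>2 a = (THE T. \<forall>f g. cinner (T f) g =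
     (LINT z|lborel. rep_l2 a z * stft \<phi>\<^sub>1 f z * cnj (stft \<phi>\<^sub>2 g z)))"

end

theory Submission
  imports Defs "HOL-Probability.Characteristic_Functions"
begin

text \<open>A Hilbert--Schmidt operator is determined by its integral kernel \<open>K\<close>, and the Hilbert--Schmidt norm is
  the \<open>L\<^sup>2\<close> norm of \<open>K\<close>. The orthogonality relations for the short-time Fourier transform show that
  \<open>g \<otimes> cnj f \<mapsto> stft f g\<close> extends to a unitary map (the Fourier--Wigner transform) of the kernels onto
  \<open>L\<^sup>2\<close> of phase space. Since the symplectic Fourier transform of \<open>stft \<phi>\<^sub>2 g * cnj (stft \<phi>\<^sub>1 f)\<close> is
  \<open>stft f g * cnj (stft \<phi>\<^sub>1 \<phi>\<^sub>2)\<close>, the localization operator with symbol \<open>a\<close> is transformed into the product of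
  \<open>stft \<phi>\<^sub>1 \<phi>\<^sub>2\<close> with the symplectic Fourier transform of \<open>a\<close>. So the range corresponds to the range of a bounded
  multiplication operator, which is dense exactly when the multiplier vanishes almost nowhere.

  Plancherel's theorem is obtained from the Gaussian wave packets, which form a total family that the
  Fourier transform permutes up to unimodular factors.\<close>

subsection \<open>The Hilbert space of square-integrable functions\<close>

text \<open>A symbol is only square-integrable, so its Fourier transform is not given by an integral
  and the factorization cannot be computed on it directly. It is tested instead against the products
  \<open>stft \<phi>\<^sub>2 g z * cnj (stft \<phi>\<^sub>1 f z)\<close>. These are integrable as
  products of square-integrable functions and bounded by Cauchy-Schwarz, hence also
  square-integrable, and on such functions the unitary extension agrees with the integral
  \<open>fourier\<close>. Unitarity then moves the transform onto the symbol. Both unitaries come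
  from one principle: two total families with equal Gram matrices are carried onto each other by a
  surjective isometry. Surjectivity is essential, because density quantifies over all kernels and
  the range over all symbols. Totality on the Fourier side is reduced to injectivity of the Fourier
  transform on integrable functions, followed by division by a Gaussian quantity that vanishes
  nowhere.\<close>

lemma l2_eq_refl_iff: "l2_eq f f \<longleftrightarrow> square_integrable f"
  by (auto simp: l2_eq_def)

lemma square_integrable_measurable:
  "square_integrable f \<Longrightarrow> f \<in> borel_measurable borel"
  by (simp add: square_integrable_def)

lemma square_integrable_rep_l2: "square_integrable (rep_l2 f)"
  using Quotient3_rep_reflp[OF Quotient3_l2, of f] by (simp add: l2_eq_refl_iff)

lemma rep_l2_measurable [measurable]: "rep_l2 f \<in> borel_measurable borel"
  by (rule square_integrable_measurable[OF square_integrable_rep_l2])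

lemma abs_rep_l2 [simp]: "abs_l2 (rep_l2 f) = f"
  by (rule Quotient3_abs_rep[OF Quotient3_l2])

lemma abs_l2_eq_iff:
  assumes "square_integrable f" "square_integrable g"
  shows "abs_l2 f = abs_l2 g \<longleftrightarrow> (AE x in lborel. f x = g x)"
  using Quotient3_rel[OF Quotient3_l2, of f g] assms by (auto simp: l2_eq_def)

lemma rep_abs_l2: "square_integrable f \<Longrightarrow> AE x in lborel. rep_l2 (abs_l2 f) x = f x"
  using abs_l2_eq_iff[OF square_integrable_rep_l2, of f "abs_l2 f"] by simp

lemma l2_eqI: "(AE x in lborel. rep_l2 f x = rep_l2 g x) \<Longrightarrow> f = g"
  using abs_l2_eq_iff[OF square_integrable_rep_l2 square_integrable_rep_l2, of f g] by simp

lemma l2_eq_zeroI: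
  assumes "AE x in lborel. rep_l2 f x = 0"
  shows "f = 0"
  using abs_l2_eq_iff[OF square_integrable_rep_l2 square_integrable_zero, of f] assms
  by (simp add: zero_l2_def)

lemma square_integrable_cong_AE:
  assumes "square_integrable f" "g \<in> borel_measurable borel" "AE x in lborel. f x = g x"
  shows "square_integrable g"
  unfolding square_integrable_def
proof (intro conjI)
  have [measurable]: "f \<in> borel_measurable borel" "g \<in> borel_measurable borel"
    using assms by (auto simp: square_integrable_def)
  show "integrable lborel (\<lambda>x. (cmod (g x))\<^sup>2)"
    using assms(1,3)
    by (subst integrable_cong_AE[of _ _ "\<lambda>x. (cmod (f x))\<^sup>2"]) (auto simp: square_integrable_def)
qed (use assms in auto)

lemma abs_l2_plus:
  "square_integrable f \<Longrightarrow> square_integrable g \<Longrightarrow> abs_l2 f + abs_l2 g = abs_l2 (\<lambda>x. f x + g x)"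
  by (simp add: plus_l2.abs_eq l2_eq_refl_iff)

lemma abs_l2_scaleC: "square_integrable f \<Longrightarrow> scaleC c (abs_l2 f) = abs_l2 (\<lambda>x. c * f x)"
  by (simp add: scaleC.abs_eq l2_eq_refl_iff)

lemma cinner_abs_l2:
  "square_integrable f \<Longrightarrow> square_integrable g \<Longrightarrow>
    cinner (abs_l2 f) (abs_l2 g) = (LINT x|lborel. f x * cnj (g x))"
  by (simp add: cinner.abs_eq l2_eq_refl_iff)

lemma cinner_rep_l2: "cinner f g = (LINT x|lborel. rep_l2 f x * cnj (rep_l2 g x))"
  using cinner_abs_l2[OF square_integrable_rep_l2 square_integrable_rep_l2, of f g] by simp

lemma cinner_abs_l2_right:
  "square_integrable g \<Longrightarrow> cinner f (abs_l2 g) = (LINT x|lborel. rep_l2 f x * cnj (g x))"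
  using cinner_abs_l2[OF square_integrable_rep_l2, of g f] by simp

lemma rep_l2_plus: "AE x in lborel. rep_l2 (f + g) x = rep_l2 f x + rep_l2 g x"
  using rep_abs_l2[OF square_integrable_add[OF square_integrable_rep_l2 square_integrable_rep_l2]]
    abs_l2_plus[OF square_integrable_rep_l2 square_integrable_rep_l2, of f g] by simp

lemma rep_l2_scaleC: "AE x in lborel. rep_l2 (scaleC c f) x = c * rep_l2 f x"
  using rep_abs_l2[OF square_integrable_cmult[OF square_integrable_rep_l2]]
    abs_l2_scaleC[OF square_integrable_rep_l2, of c f] by simp

lemma rep_l2_diff: "AE x in lborel. rep_l2 (f - g) x = rep_l2 f x - rep_l2 g x"
  using rep_l2_plus[of f "scaleC (-1) g"] rep_l2_scaleC[of "-1" g]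
  by eventually_elim (simp add: minus_l2_def)

lemma square_integrable_diff:
  assumes "square_integrable f" "square_integrable g"
  shows "square_integrable (\<lambda>x. f x - g x)"
  using square_integrable_add[OF assms(1) square_integrable_cmult[OF assms(2), of "-1"]] by simp

lemma norm_l2_power2: "(norm f)\<^sup>2 = Re (cinner f f)"
  by (simp add: norm_l2_def cinner_self(2))

lemma norm_l2_integral: "(norm f)\<^sup>2 = (LINT x|lborel. (cmod (rep_l2 f x))\<^sup>2)"
  unfolding norm_l2_power2 cinner_rep_l2
  by (simp flip: complex_norm_square of_real_power)

lemma norm_abs_l2:
  "square_integrable f \<Longrightarrow> (norm (abs_l2 f))\<^sup>2 = (LINT x|lborel. (cmod (f x))\<^sup>2)"
  unfolding norm_l2_power2 by (simp add: cinner_abs_l2 flip: complex_norm_square of_real_power)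

lemma nn_integral_norm_l2:
  "(\<integral>\<^sup>+x. ennreal ((cmod (rep_l2 f x))\<^sup>2) \<partial>lborel) = ennreal ((norm f)\<^sup>2)"
  using square_integrable_rep_l2[of f]
  by (simp add: norm_l2_integral square_integrable_def nn_integral_eq_integral)

lemma nn_integral_norm_l2_diff:
  "(\<integral>\<^sup>+x. ennreal ((cmod (rep_l2 f x - rep_l2 g x))\<^sup>2) \<partial>lborel) = ennreal ((norm (f - g))\<^sup>2)"
proof -
  have "AE x in lborel. ennreal ((cmod (rep_l2 f x - rep_l2 g x))\<^sup>2) =
      ennreal ((cmod (rep_l2 (f - g) x))\<^sup>2)"
    using rep_l2_diff[of f g] by eventually_elim simp
  then show ?thesis
    unfolding nn_integral_norm_l2[symmetric] by (rule nn_integral_cong_AE)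
qed

lemma cinner_add_right: "cinner h (f + g) = cinner h f + cinner h g"
  by (metis cinner_add_left cinner_commute complex_cnj_add)

lemma cinner_scaleC_right: "cinner h (scaleC c f) = cnj c * cinner h f"
  by (metis cinner_scaleC_left cinner_commute complex_cnj_mult)

lemma cinner_diff_left: "cinner (f - g) h = cinner f h - cinner g h"
  by (simp add: minus_l2_def cinner_add_left cinner_scaleC_left)

lemma cinner_diff_right: "cinner h (f - g) = cinner h f - cinner h g"
  by (simp add: minus_l2_def cinner_add_right cinner_scaleC_right)

lemma cinner_zero [simp]: "cinner 0 f = 0" "cinner f 0 = 0"
  using cinner_diff_left[of 0 0 f] cinner_diff_right[of f 0 0] by auto

lemma cinner_sum_left: "cinner (\<Sum>i\<in>A. f i) h = (\<Sum>i\<in>A. cinner (f i) h)"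
  by (induction A rule: infinite_finite_induct) (auto simp: cinner_add_left)

lemma cinner_sum_right: "cinner h (\<Sum>i\<in>A. f i) = (\<Sum>i\<in>A. cinner h (f i))"
  by (induction A rule: infinite_finite_induct) (auto simp: cinner_add_right)

lemma cinner_scaleR: "cinner (r *\<^sub>R f) g = of_real r * cinner f g"
    "cinner f (r *\<^sub>R g) = of_real r * cinner f g"
  by (simp_all add: scaleR_l2_def cinner_scaleC_left cinner_scaleC_right)

lemma cinner_eqI: "(\<And>h. cinner f h = cinner g h) \<Longrightarrow> f = g"
  using cinner_self_eq_0[of "f - g"] by (simp add: cinner_diff_left)

lemma cinner_self_norm: "cinner f f = of_real ((norm f)\<^sup>2)"
  using cinner_self(1)[of f] by (simp add: norm_l2_power2)

lemma scaleC_add_right: "scaleC c (f + g) = scaleC c f + scaleC c g"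
  by (rule cinner_eqI) (simp add: cinner_scaleC_left cinner_add_left distrib_left)

lemma scaleC_scaleC: "scaleC c (scaleC d f) = scaleC (c * d) f"
  by (rule cinner_eqI) (simp add: cinner_scaleC_left)

lemma scaleC_one [simp]: "scaleC 1 f = f"
  by (rule cinner_eqI) (simp add: cinner_scaleC_left)

lemma scaleC_zero [simp]: "scaleC 0 f = 0" "scaleC c 0 = 0"
  by (rule cinner_eqI, simp add: cinner_scaleC_left)+

lemma scaleC_scaleR: "scaleC c (r *\<^sub>R f) = r *\<^sub>R scaleC c f"
  by (simp add: scaleR_l2_def scaleC_scaleC mult.commute)

lemma norm_scaleC: "norm (scaleC c f) = cmod c * norm f"
proof -
  have "complex_of_real ((norm (scaleC c f))\<^sup>2) = (c * cnj c) * cinner f f"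
    by (simp only: cinner_self_norm[symmetric] cinner_scaleC_left cinner_scaleC_right mult_ac)
  also have "\<dots> = complex_of_real ((cmod c * norm f)\<^sup>2)"
    by (simp only: complex_norm_square[symmetric] cinner_self_norm power_mult_distrib of_real_mult of_real_power)
  finally have "(norm (scaleC c f))\<^sup>2 = (cmod c * norm f)\<^sup>2"
    by (simp only: of_real_eq_iff)
  then show ?thesis
    by (simp add: power2_eq_iff_nonneg)
qed

lemma bounded_linear_scaleC: "bounded_linear (scaleC c)"
  by (rule bounded_linear_intro[of _ "cmod c"])
    (auto simp: scaleC_add_right scaleC_scaleR norm_scaleC)

text \<open>The real Cauchy-Schwarz inequality controls real parts only. Scaling \<open>f\<close> by
  the conjugate of the inner product makes the inner product real, equal to its squared modulus, and
  one factor cancels.\<close>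

lemma cmod_cinner_le: "cmod (cinner f g) \<le> norm f * norm g"
proof (cases "cinner f g = 0")
  case False
  let ?c = "cinner f g"
  have "(cmod ?c)\<^sup>2 = scaleC (cnj ?c) f \<bullet> g"
    unfolding inner_l2_def cinner_scaleC_left cmod_power2 by (simp add: power2_eq_square)
  also have "\<dots> \<le> norm (scaleC (cnj ?c) f) * norm g"
    by (rule norm_cauchy_schwarz)
  also have "\<dots> = cmod ?c * (norm f * norm g)"
    by (simp add: norm_scaleC)
  finally show ?thesis
    using False by (simp add: power2_eq_square)
qed simp

lemma bounded_bilinear_cinner: "bounded_bilinear cinner"
proof
  show "\<exists>K. \<forall>a b. cmod (cinner a b) \<le> norm a * norm b * K"
    by (intro exI[of _ 1]) (simp add: cmod_cinner_le)
qed (simp_all add: cinner_add_left cinner_add_right cinner_scaleR scaleR_conv_of_real)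

lemmas tendsto_cinner = bounded_bilinear.tendsto[OF bounded_bilinear_cinner]

text \<open>Riesz--Fischer: a rapidly converging subsequence converges almost everywhere, and Fatou's lemma
  shows that the whole sequence converges in norm to the pointwise limit.\<close>

lemma Cauchy_l2_convergent:
  fixes X :: "nat \<Rightarrow> 'a::euclidean_space l2"
  assumes "Cauchy X"
  shows "convergent X"
proof -
  have "\<exists>r::nat\<Rightarrow>nat. \<forall>n. (\<forall>m\<ge>r n. dist (X m) (X (r n)) < (1/4)^n) \<and> r n < r (Suc n)"
  proof (rule dependent_nat_choice[where
        P = "\<lambda>n x. \<forall>m\<ge>x. dist (X m) (X x) < (1/4)^n" and Q = "\<lambda>n x y. x < y"])
    have C: "\<exists>M. \<forall>m\<ge>M. \<forall>n\<ge>M. dist (X m) (X n) < (1/4)^k" for k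
      by (rule metric_CauchyD[OF assms]) simp
    show "\<exists>x. \<forall>m\<ge>x. dist (X m) (X x) < (1/4)^0"
      using C[of 0] by blast
    fix x n
    obtain M where M: "\<forall>m\<ge>M. \<forall>n'\<ge>M. dist (X m) (X n') < (1/4)^(Suc n)"
      using C[of "Suc n"] by blast
    then show "\<exists>y. (\<forall>m\<ge>y. dist (X m) (X y) < (1/4)^(Suc n)) \<and> x < y"
      by (intro exI[of _ "max M (Suc x)"]) auto
  qed
  then obtain r where r: "\<And>n m. m \<ge> r n \<Longrightarrow> dist (X m) (X (r n)) < (1/4)^n" "\<And>n. r n < r (Suc n)"
    by blast
  have mono: "strict_mono r"
    using r(2) by (simp add: strict_mono_Suc_iff)
  define d where "d k x = rep_l2 (X (r (Suc k))) x - rep_l2 (X (r k)) x" for k x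
  have d_meas [measurable]: "d k \<in> borel_measurable borel" for k
    unfolding d_def by measurable
  \<comment> \<open>The rate \<open>(1/4)^k\<close> of the subsequence leaves room for the weight:
    squared norms of increments are at most \<open>(1/16)^k\<close>, so the weighted sum has a
    finite integral. Almost everywhere the weighted terms tend to 0, which puts the increments below
    \<open>(1/2)^k\<close> eventually.\<close>
  have "(\<integral>\<^sup>+x. (\<Sum>k. ennreal (4^k * (cmod (d k x))\<^sup>2)) \<partial>lborel)
      = (\<Sum>k. \<integral>\<^sup>+x. ennreal (4^k * (cmod (d k x))\<^sup>2) \<partial>lborel)"
    by (rule nn_integral_suminf) measurable
  also have "\<dots> \<le> (\<Sum>k. ennreal ((1/4)^k))"
  proof (intro suminf_le allI)
    fix k
    have "(\<integral>\<^sup>+x. ennreal (4^k * (cmod (d k x))\<^sup>2) \<partial>lborel)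
        = ennreal (4^k) * (\<integral>\<^sup>+x. ennreal ((cmod (d k x))\<^sup>2) \<partial>lborel)"
      by (subst nn_integral_cmult[symmetric]) (auto simp: ennreal_mult)
    also have "\<dots> = ennreal (4^k * (norm (X (r (Suc k)) - X (r k)))\<^sup>2)"
      unfolding d_def nn_integral_norm_l2_diff by (simp add: ennreal_mult)
    also have "\<dots> \<le> ennreal (4^k * ((1/4)^k)\<^sup>2)"
      using r(1)[of k "r (Suc k)"] r(2)[of k]
      by (intro ennreal_leI mult_left_mono power_mono) (auto simp: dist_norm)
    also have "4^k * ((1/4)^k)\<^sup>2 = ((1/4)^k :: real)"
      by (simp only: power2_eq_square power_mult_distrib[symmetric]) simp
    finally show "(\<integral>\<^sup>+x. ennreal (4^k * (cmod (d k x))\<^sup>2) \<partial>lborel) \<le> ennreal ((1/4)^k)" .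
  qed auto
  also have "\<dots> = ennreal (\<Sum>k. (1/4)^k)"
    by (rule suminf_ennreal2) (auto intro: summable_geometric)
  also have "\<dots> < \<infinity>"
    by simp
  finally have "AE x in lborel. (\<Sum>k. ennreal (4^k * (cmod (d k x))\<^sup>2)) \<noteq> \<infinity>"
    by (intro nn_integral_noteq_infinite) auto
  then have conv: "AE x in lborel. convergent (\<lambda>k. rep_l2 (X (r k)) x)"
  proof eventually_elim
    fix x assume "(\<Sum>k. ennreal (4^k * (cmod (d k x))\<^sup>2)) \<noteq> \<infinity>"
    then have "summable (\<lambda>k. 4^k * (cmod (d k x))\<^sup>2)"
      by (intro summable_suminf_not_top) (auto simp: top_ennreal_def[symmetric])
    then have "(\<lambda>k. 4^k * (cmod (d k x))\<^sup>2) \<longlonglongrightarrow> 0"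
      by (rule summable_LIMSEQ_zero)
    then have "\<forall>\<^sub>F k in sequentially. 4^k * (cmod (d k x))\<^sup>2 < 1"
      by (rule order_tendstoD) simp
    then have "\<forall>\<^sub>F k in sequentially. norm (d k x) \<le> (1/2)^k"
    proof eventually_elim
      case (elim k)
      have "(2^k * cmod (d k x))\<^sup>2 = 4^k * (cmod (d k x))\<^sup>2"
        by (simp add: power_mult_distrib power2_eq_square flip: power_mult_distrib)
      then have "(2^k * cmod (d k x))\<^sup>2 < 1\<^sup>2"
        using elim by simp
      then have "2^k * cmod (d k x) < 1"
        by (rule power_less_imp_less_base) simp
      then show ?case
        by (simp add: field_simps)
    qed
    then have "summable (\<lambda>k. d k x)"
      by (rule summable_comparison_test_ev) (simp add: summable_geometric)
    then have "convergent (\<lambda>n. \<Sum>k<n. d k x)"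
      by (simp add: summable_iff_convergent)
    moreover have "(\<Sum>k<n. d k x) = rep_l2 (X (r n)) x - rep_l2 (X (r 0)) x" for n
      unfolding d_def by (rule sum_lessThan_telescope)
    ultimately have "convergent (\<lambda>n. (rep_l2 (X (r n)) x - rep_l2 (X (r 0)) x) + rep_l2 (X (r 0)) x)"
      by (intro convergent_add convergent_const) simp
    then show "convergent (\<lambda>k. rep_l2 (X (r k)) x)"
      by simp
  qed
  define G where "G x = lim (\<lambda>k. rep_l2 (X (r k)) x)" for x
  have [measurable]: "G \<in> borel_measurable borel"
    unfolding G_def by (rule borel_measurable_lim_metric) simp
  from conv have lim: "AE x in lborel. (\<lambda>k. rep_l2 (X (r k)) x) \<longlonglongrightarrow> G x"
    by eventually_elim (simp add: G_def convergent_LIMSEQ_iff)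
  have fatou: "(\<integral>\<^sup>+x. ennreal ((cmod (rep_l2 (X n) x - G x))\<^sup>2) \<partial>lborel) \<le> ennreal (e\<^sup>2)"
    if e: "e > 0" and n: "\<And>m. m \<ge> n \<Longrightarrow> dist (X n) (X m) < e" for n e
  proof -
    have "AE x in lborel. ennreal ((cmod (rep_l2 (X n) x - G x))\<^sup>2)
        = liminf (\<lambda>k. ennreal ((cmod (rep_l2 (X n) x - rep_l2 (X (r k)) x))\<^sup>2))"
      using lim
    proof eventually_elim
      fix x assume "(\<lambda>k. rep_l2 (X (r k)) x) \<longlonglongrightarrow> G x"
      then have "(\<lambda>k. ennreal ((cmod (rep_l2 (X n) x - rep_l2 (X (r k)) x))\<^sup>2)) \<longlonglongrightarrow>
          ennreal ((cmod (rep_l2 (X n) x - G x))\<^sup>2)"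
        by (intro tendsto_intros tendsto_ennrealI)
      then show "ennreal ((cmod (rep_l2 (X n) x - G x))\<^sup>2) =
          liminf (\<lambda>k. ennreal ((cmod (rep_l2 (X n) x - rep_l2 (X (r k)) x))\<^sup>2))"
        by (intro lim_imp_Liminf[symmetric]) auto
    qed
    then have "(\<integral>\<^sup>+x. ennreal ((cmod (rep_l2 (X n) x - G x))\<^sup>2) \<partial>lborel)
        = (\<integral>\<^sup>+x. liminf (\<lambda>k. ennreal ((cmod (rep_l2 (X n) x - rep_l2 (X (r k)) x))\<^sup>2)) \<partial>lborel)"
      by (rule nn_integral_cong_AE)
    also have "\<dots> \<le> liminf (\<lambda>k. \<integral>\<^sup>+x. ennreal ((cmod (rep_l2 (X n) x - rep_l2 (X (r k)) x))\<^sup>2) \<partial>lborel)"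
      by (rule nn_integral_liminf) measurable
    also have "\<dots> \<le> limsup (\<lambda>k. \<integral>\<^sup>+x. ennreal ((cmod (rep_l2 (X n) x - rep_l2 (X (r k)) x))\<^sup>2) \<partial>lborel)"
      by (rule Liminf_le_Limsup) simp
    also have "\<dots> \<le> ennreal (e\<^sup>2)"
    proof (rule Limsup_bounded)
      have "\<forall>\<^sub>F k in sequentially. k \<ge> n"
        by (rule eventually_ge_at_top)
      then show "\<forall>\<^sub>F k in sequentially.
          (\<integral>\<^sup>+x. ennreal ((cmod (rep_l2 (X n) x - rep_l2 (X (r k)) x))\<^sup>2) \<partial>lborel) \<le> ennreal (e\<^sup>2)"
      proof eventually_elim
        case (elim k)
        have "k \<le> r k"
          using mono by (rule strict_mono_imp_increasing)
        then have "norm (X n - X (r k)) < e"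
          using n[of "r k"] elim by (simp add: dist_norm)
        then show ?case
          unfolding nn_integral_norm_l2_diff by (intro ennreal_leI power_mono) auto
      qed
    qed
    finally show ?thesis .
  qed
  have near: "\<exists>N. \<forall>n\<ge>N. (\<integral>\<^sup>+x. ennreal ((cmod (rep_l2 (X n) x - G x))\<^sup>2) \<partial>lborel) \<le> ennreal (e\<^sup>2)"
    if "e > 0" for e
    using metric_CauchyD[OF assms that] fatou[OF that] by (meson le_trans)
  have sq: "square_integrable G"
  proof -
    obtain n where n: "(\<integral>\<^sup>+x. ennreal ((cmod (rep_l2 (X n) x - G x))\<^sup>2) \<partial>lborel) \<le> ennreal (1\<^sup>2)"
      using near[of 1] by auto
    then have "square_integrable (\<lambda>x. rep_l2 (X n) x - G x)"
      unfolding square_integrable_def integrable_iff_bounded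
      by (auto simp: order_le_less_trans)
    from square_integrable_diff[OF square_integrable_rep_l2 this, of "X n"] show ?thesis
      by simp
  qed
  let ?F = "abs_l2 G"
  have nF: "(\<integral>\<^sup>+x. ennreal ((cmod (rep_l2 (X n) x - G x))\<^sup>2) \<partial>lborel) = ennreal ((norm (X n - ?F))\<^sup>2)" for n
  proof -
    have "AE x in lborel. ennreal ((cmod (rep_l2 (X n) x - G x))\<^sup>2)
        = ennreal ((cmod (rep_l2 (X n) x - rep_l2 ?F x))\<^sup>2)"
      using rep_abs_l2[OF sq] by eventually_elim simp
    then show ?thesis
      unfolding nn_integral_norm_l2_diff[symmetric] by (rule nn_integral_cong_AE)
  qed
  have "X \<longlonglongrightarrow> ?F"
  proof (rule metric_LIMSEQ_I)
    fix e :: real assume "e > 0"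
    then obtain N where N: "\<forall>n\<ge>N. ennreal ((norm (X n - ?F))\<^sup>2) \<le> ennreal ((e/2)\<^sup>2)"
      using near[of "e/2"] nF by auto
    have "norm (X n - ?F) < e" if "n \<ge> N" for n
    proof -
      have "(norm (X n - ?F))\<^sup>2 \<le> (e/2)\<^sup>2"
        using N that by simp
      then have "norm (X n - ?F) \<le> e/2"
        using \<open>e > 0\<close> by (auto intro: power2_le_imp_le)
      then show ?thesis
        using \<open>e > 0\<close> by simp
    qed
    then show "\<exists>N. \<forall>n\<ge>N. dist (X n) ?F < e"
      by (auto simp: dist_norm)
  qed
  then show ?thesis
    by (rule convergentI)
qed

instance l2 :: (euclidean_space) complete_space
  by standard (rule Cauchy_l2_convergent)

subsection \<open>Orthogonal projection and isometries\<close>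

text \<open>A minimizing sequence for the distance to \<open>S\<close> is Cauchy by the
  parallelogram law, and the minimizer has an orthogonal residual because moving it along
  \<open>s\<close> cannot shorten the distance.\<close>

lemma complete_subspace_orthogonal:
  fixes S :: "'h::{real_inner, complete_space} set"
  assumes cl: "closed S" and sub: "subspace S"
  shows "\<exists>y\<in>S. \<forall>s\<in>S. (x - y) \<bullet> s = 0"
proof -
  let ?D = "(\<lambda>y. (norm (x - y))\<^sup>2) ` S"
  define d where "d = Inf ?D"
  have ne: "?D \<noteq> {}"
    using subspace_0[OF sub] by auto
  have bdd: "bdd_below ?D"
    by (rule bdd_belowI[of _ 0]) auto
  have d_le: "d \<le> (norm (x - y))\<^sup>2" if "y \<in> S" for y
    unfolding d_def by (rule cInf_lower[OF _ bdd]) (use that in auto)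
  have "\<exists>y\<in>S. (norm (x - y))\<^sup>2 < d + 1 / real (Suc n)" for n
    using cInf_lessD[OF ne, of "d + 1 / real (Suc n)"] by (auto simp: d_def)
  then obtain Y where Y: "\<And>n. Y n \<in> S" "\<And>n. (norm (x - Y n))\<^sup>2 < d + 1 / real (Suc n)"
    by metis
  have two: "2 / real (Suc n) = 2 * (1 / real (Suc n))" for n
    by simp
  have par: "(norm (Y n - Y m))\<^sup>2 \<le> 2 / real (Suc n) + 2 / real (Suc m)" for n m
  proof -
    let ?z = "(1/2) *\<^sub>R (Y n + Y m)"
    have "?z \<in> S"
      using Y sub by (intro subspace_scale subspace_add)
    moreover have "(norm (Y n - Y m))\<^sup>2 =
        2 * (norm (x - Y n))\<^sup>2 + 2 * (norm (x - Y m))\<^sup>2 - 4 * (norm (x - ?z))\<^sup>2"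
      by (simp add: power2_norm_eq_inner algebra_simps inner_commute)
    ultimately show ?thesis
      using d_le[of ?z] Y(2)[of n] Y(2)[of m] two[of n] two[of m] by linarith
  qed
  have "Cauchy Y"
  proof (rule metric_CauchyI)
    fix e :: real assume e: "e > 0"
    obtain N where N: "4 / e\<^sup>2 < real N"
      using reals_Archimedean2 by blast
    have "dist (Y m) (Y n) < e" if "m \<ge> N" "n \<ge> N" for m n
    proof -
      have "4 / e\<^sup>2 > 0" using e by simp
      then have "real N > 0" using N by linarith
      then have "2 / real (Suc k) < e\<^sup>2 / 2" if "k \<ge> N" for k
      proof -
        have "4 / e\<^sup>2 < real (Suc k)" using N that by linarith
        then show ?thesis using e by (simp add: field_simps)
      qed
      then have "(norm (Y m - Y n))\<^sup>2 < e\<^sup>2"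
        using par[of m n] that by (smt (verit) field_sum_of_halves)
      then show ?thesis
        using e by (simp add: dist_norm power_less_imp_less_base)
    qed
    then show "\<exists>N. \<forall>m\<ge>N. \<forall>n\<ge>N. dist (Y m) (Y n) < e" by blast
  qed
  then obtain y where y: "Y \<longlonglongrightarrow> y"
    by (auto simp: Cauchy_convergent_iff convergent_def)
  have yS: "y \<in> S"
    using closed_sequentially[OF cl] Y(1) y by blast
  have "(norm (x - y))\<^sup>2 \<le> d"
  proof (rule LIMSEQ_le)
    show "(\<lambda>n. (norm (x - Y n))\<^sup>2) \<longlonglongrightarrow> (norm (x - y))\<^sup>2"
      by (intro tendsto_intros y)
    have "(\<lambda>n. d + 1 / real (Suc n)) \<longlonglongrightarrow> d + 0"
      by (intro tendsto_intros LIMSEQ_Suc[OF lim_1_over_n])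
    then show "(\<lambda>n. d + 1 / real (Suc n)) \<longlonglongrightarrow> d" by simp
    show "\<exists>N. \<forall>n\<ge>N. (norm (x - Y n))\<^sup>2 \<le> d + 1 / real (Suc n)"
      using Y(2) less_imp_le by blast
  qed
  have "(x - y) \<bullet> s = 0" if s: "s \<in> S" for s
  proof (rule ccontr)
    assume ne0: "(x - y) \<bullet> s \<noteq> 0"
    then have ss: "s \<bullet> s > 0" by auto
    \<comment> \<open>The minimizer of the quadratic polynomial in \<open>t\<close> expanded
      below.\<close>
    define t where "t = ((x - y) \<bullet> s) / (s \<bullet> s)"
    have "y + t *\<^sub>R s \<in> S"
      using yS s sub by (intro subspace_scale subspace_add)
    then have "d \<le> (norm (x - (y + t *\<^sub>R s)))\<^sup>2"
      by (rule d_le)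
    also have "\<dots> = (norm (x - y))\<^sup>2 - 2 * t * ((x - y) \<bullet> s) + t * t * (s \<bullet> s)"
      by (simp add: power2_norm_eq_inner algebra_simps inner_commute)
    also have "\<dots> = (norm (x - y))\<^sup>2 - ((x - y) \<bullet> s)\<^sup>2 / (s \<bullet> s)"
      using ss by (simp add: t_def power2_eq_square)
    also have "\<dots> < (norm (x - y))\<^sup>2"
      using ss ne0 by simp
    finally show False
      using \<open>(norm (x - y))\<^sup>2 \<le> d\<close> by simp
  qed
  then show ?thesis
    using yS by blast
qed

lemma riesz_representation_real:
  fixes \<phi> :: "'h::{real_inner, complete_space} \<Rightarrow> real"
  assumes "bounded_linear \<phi>"
  shows "\<exists>y. \<forall>x. \<phi> x = x \<bullet> y"
proof (cases "\<forall>x. \<phi> x = 0")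
  case True
  then show ?thesis by (intro exI[of _ 0]) simp
next
  case False
  interpret bounded_linear \<phi> by (rule assms)
  let ?K = "{x. \<phi> x = 0}"
  from False obtain x0 where x0: "\<phi> x0 \<noteq> 0" by blast
  have "closed ?K"
    using linear_continuous_on[OF assms, of UNIV]
    by (intro closed_Collect_eq) auto
  moreover have "subspace ?K"
    by (auto simp: subspace_def add scaleR)
  ultimately obtain y where y: "\<phi> y = 0" "\<forall>s\<in>?K. (x0 - y) \<bullet> s = 0"
    using complete_subspace_orthogonal[of ?K x0] by auto
  let ?z = "x0 - y"
  have z: "\<phi> ?z \<noteq> 0" using x0 y by (simp add: diff)
  then have zz: "?z \<bullet> ?z \<noteq> 0" by (auto simp: zero)
  have "\<phi> x = x \<bullet> ((\<phi> ?z / (?z \<bullet> ?z)) *\<^sub>R ?z)" for x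
  proof -
    \<comment> \<open>The kernel has codimension one, so a suitable multiple of \<open>?z\<close>
      moves any \<open>x\<close> into it.\<close>
    have "x - (\<phi> x / \<phi> ?z) *\<^sub>R ?z \<in> ?K"
      using z by (simp add: diff scaleR)
    then have "?z \<bullet> (x - (\<phi> x / \<phi> ?z) *\<^sub>R ?z) = 0"
      using y(2) by blast
    then have "?z \<bullet> x = (\<phi> x / \<phi> ?z) * (?z \<bullet> ?z)"
      by (simp only: inner_diff_right inner_scaleR_right)
    then show ?thesis
      using z zz by (simp add: inner_commute[of x ?z] del: inner_diff_left inner_diff_right)
  qed
  then show ?thesis by blast
qed

text \<open>A complex-linear functional is determined by its real part, since its imaginary part at
  \<open>f\<close> is its real part at \<open>scaleC (- \<i>) f\<close>. The real theorem applied to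
  the real part therefore suffices.\<close>

lemma riesz_representation_l2:
  fixes \<phi> :: "'a::euclidean_space l2 \<Rightarrow> complex"
  assumes "bounded_linear \<phi>" and scale: "\<And>c f. \<phi> (scaleC c f) = c * \<phi> f"
  shows "\<exists>y. \<forall>f. \<phi> f = cinner f y"
proof -
  have "bounded_linear (\<lambda>f. Re (\<phi> f))"
    by (rule bounded_linear_compose[OF bounded_linear_Re assms(1)])
  then obtain y where y: "\<And>f. Re (\<phi> f) = f \<bullet> y"
    using riesz_representation_real by blast
  have "\<phi> f = cinner f y" for f
  proof (rule complex_eqI)
    show "Re (\<phi> f) = Re (cinner f y)"
      using y by (simp add: inner_l2_def)
    have "Re (\<phi> (scaleC (- \<i>) f)) = Re (cinner (scaleC (- \<i>) f) y)"
      using y by (simp add: inner_l2_def)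
    then show "Im (\<phi> f) = Im (cinner f y)"
      by (simp add: scale cinner_scaleC_left)
  qed
  then show ?thesis by blast
qed

text \<open>The projection theorem yields real orthogonality only. Testing against both
  \<open>s\<close> and \<open>scaleC \<i> s\<close> upgrades it to complex orthogonality, which is
  why closure under \<open>scaleC\<close> is assumed.\<close>

lemma complex_subspace_eq_UNIV:
  fixes S :: "'a::euclidean_space l2 set"
  assumes "closed S" "subspace S" and scale: "\<And>c s. s \<in> S \<Longrightarrow> scaleC c s \<in> S"
    and total: "\<And>f. (\<And>s. s \<in> S \<Longrightarrow> cinner f s = 0) \<Longrightarrow> f = 0"
  shows "S = UNIV"
proof -
  have "x \<in> S" for x
  proof -
    obtain y where y: "y \<in> S" "\<And>s. s \<in> S \<Longrightarrow> (x - y) \<bullet> s = 0"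
      using complete_subspace_orthogonal[OF assms(1,2)] by blast
    have "cinner (x - y) s = 0" if "s \<in> S" for s
    proof (rule complex_eqI)
      show "Re (cinner (x - y) s) = Re 0"
        using y(2)[OF that] by (simp add: inner_l2_def)
      show "Im (cinner (x - y) s) = Im 0"
        using y(2)[OF scale[OF that, of \<i>]] by (simp add: inner_l2_def cinner_scaleC_right)
    qed
    then have "x - y = 0" by (rule total)
    then show ?thesis using y(1) by simp
  qed
  then show ?thesis by blast
qed

section \<open>Isometries from families with equal Gram matrices\<close>

lemma subspace_closure:
  fixes P :: "'h::real_normed_vector set"
  assumes "subspace P"
  shows "subspace (closure P)"
proof (rule subspaceI)
  show "0 \<in> closure P"
    using subspace_0[OF assms] closure_subset by blast
next
  fix x y assume "x \<in> closure P" "y \<in> closure P"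
  then obtain X Y where "\<And>n. X n \<in> P" "X \<longlonglongrightarrow> x" "\<And>n. Y n \<in> P" "Y \<longlonglongrightarrow> y"
    unfolding closure_sequential by blast
  then have "\<And>n. X n + Y n \<in> P" "(\<lambda>n. X n + Y n) \<longlonglongrightarrow> x + y"
    by (auto intro: subspace_add[OF assms] tendsto_add)
  then show "x + y \<in> closure P"
    unfolding closure_sequential by (intro exI[of _ "\<lambda>n. X n + Y n"]) blast
next
  fix x r assume "x \<in> closure P"
  then obtain X where "\<And>n. X n \<in> P" "X \<longlonglongrightarrow> x"
    unfolding closure_sequential by blast
  then have "\<And>n. r *\<^sub>R X n \<in> P" "(\<lambda>n. r *\<^sub>R X n) \<longlonglongrightarrow> r *\<^sub>R x"
    by (auto intro: subspace_scale[OF assms] tendsto_intros)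
  then show "r *\<^sub>R x \<in> closure P"
    unfolding closure_sequential by (intro exI[of _ "\<lambda>n. r *\<^sub>R X n"]) blast
qed

text \<open>The closed complex span of the pairs \<open>(b i, c i)\<close> is the graph of the isometry.\<close>

lemma gram_isometry_aux:
  fixes b :: "'i \<Rightarrow> 'a::euclidean_space l2" and c :: "'i \<Rightarrow> 'b::euclidean_space l2"
  assumes gram: "\<And>i j. cinner (b i) (b j) = cinner (c i) (c j)"
    and total_b: "\<And>f. (\<And>i. cinner f (b i) = 0) \<Longrightarrow> f = 0"
  obtains U where "\<And>f g. cinner (U f) (U g) = cinner f g" "\<And>i. U (b i) = c i"
proof -
  \<comment> \<open>\<open>span\<close> is taken over the reals, so every complex multiple of a pair
    is put among the generators.\<close>
  define P where "P = span {(scaleC \<alpha> (b i), scaleC \<alpha> (c i)) | \<alpha> i. True}"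
  define G where "G = closure P"
  have gen: "(scaleC \<alpha> (b i), scaleC \<alpha> (c i)) \<in> P" for \<alpha> i
    unfolding P_def by (rule span_base) blast
  have subP: "subspace P" unfolding P_def by simp
  have subG: "subspace G" unfolding G_def by (rule subspace_closure[OF subP])
  have PG: "P \<subseteq> G" unfolding G_def by (rule closure_subset)
  \<comment> \<open>The Gram identity is extended one slot at a time; here the second argument is
    still a generator.\<close>
  have inner1: "cinner (fst p) (b j) = cinner (snd p) (c j)" if "p \<in> P" for p j
    using that unfolding P_def
  proof (induction rule: span_induct)
    case base
    show ?case
      by (auto simp: subspace_def cinner_add_left cinner_scaleR)
  qed (auto simp: cinner_scaleC_left gram)
  have inner2: "cinner (fst p) (fst q) = cinner (snd p) (snd q)" if p: "p \<in> P" and "q \<in> P" for p q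
    using that(2) unfolding P_def
  proof (induction rule: span_induct)
    case base
    show ?case
      by (auto simp: subspace_def cinner_add_right cinner_scaleR)
  qed (auto simp: cinner_scaleC_right inner1[OF p])
  have inner: "cinner (fst p) (fst q) = cinner (snd p) (snd q)" if pq: "p \<in> G" "q \<in> G" for p q
  proof -
    obtain X Y where X: "\<And>n. X n \<in> P" "X \<longlonglongrightarrow> p" and Y: "\<And>n. Y n \<in> P" "Y \<longlonglongrightarrow> q"
      using pq unfolding G_def closure_sequential by blast
    have "(\<lambda>n. cinner (fst (X n)) (fst (Y n))) \<longlonglongrightarrow> cinner (fst p) (fst q)"
      by (intro tendsto_cinner tendsto_fst X Y)
    moreover have "(\<lambda>n. cinner (fst (X n)) (fst (Y n))) \<longlonglongrightarrow> cinner (snd p) (snd q)"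
      unfolding inner2[OF X(1) Y(1)] by (intro tendsto_cinner tendsto_snd X Y)
    ultimately show ?thesis by (rule LIMSEQ_unique)
  qed
  \<comment> \<open>This makes the graph single-valued, and it lets a Cauchy sequence of first
    components force a Cauchy sequence of second components.\<close>
  have norm_eq: "norm (fst p) = norm (snd p)" if "p \<in> G" for p
    using inner[OF that that] by (simp add: norm_l2_def)
  have scaleP: "(scaleC \<alpha> (fst p), scaleC \<alpha> (snd p)) \<in> P" if "p \<in> P" for p \<alpha>
    using that unfolding P_def
  proof (induction rule: span_induct)
    case base
    have "(\<lambda>p. (scaleC \<alpha> (fst p), scaleC \<alpha> (snd p))) -` P = {p. (scaleC \<alpha> (fst p), scaleC \<alpha> (snd p)) \<in> P}"
      by auto
    moreover have "subspace {p. (scaleC \<alpha> (fst p), scaleC \<alpha> (snd p)) \<in> P}"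
    proof (rule subspaceI)
      fix p q assume "p \<in> {p. (scaleC \<alpha> (fst p), scaleC \<alpha> (snd p)) \<in> P}"
        "q \<in> {p. (scaleC \<alpha> (fst p), scaleC \<alpha> (snd p)) \<in> P}"
      then show "p + q \<in> {p. (scaleC \<alpha> (fst p), scaleC \<alpha> (snd p)) \<in> P}"
        using subspace_add[OF subP, of "(scaleC \<alpha> (fst p), scaleC \<alpha> (snd p))" "(scaleC \<alpha> (fst q), scaleC \<alpha> (snd q))"]
        by (simp add: scaleC_add_right)
    next
      fix p r assume "p \<in> {p. (scaleC \<alpha> (fst p), scaleC \<alpha> (snd p)) \<in> P}"
      then show "r *\<^sub>R p \<in> {p. (scaleC \<alpha> (fst p), scaleC \<alpha> (snd p)) \<in> P}"
        using subspace_scale[OF subP, of "(scaleC \<alpha> (fst p), scaleC \<alpha> (snd p))" r]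
        by (simp add: scaleC_scaleR)
    qed (use subspace_0[OF subP] in \<open>simp add: zero_prod_def\<close>)
    ultimately show ?case by (simp add: P_def)
  next
    case (step x)
    then show ?case
      using gen unfolding P_def by (auto simp: scaleC_scaleC)
  qed
  have scaleG: "(scaleC \<alpha> (fst p), scaleC \<alpha> (snd p)) \<in> G" if p: "p \<in> G" for p \<alpha>
  proof -
    obtain X where X: "\<And>n. X n \<in> P" "X \<longlonglongrightarrow> p"
      using p unfolding G_def closure_sequential by blast
    have "(\<lambda>n. (scaleC \<alpha> (fst (X n)), scaleC \<alpha> (snd (X n)))) \<longlonglongrightarrow> (scaleC \<alpha> (fst p), scaleC \<alpha> (snd p))"
      by (intro tendsto_Pair bounded_linear.tendsto[OF bounded_linear_scaleC] tendsto_fst tendsto_snd X)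
    then show ?thesis
      unfolding G_def closure_sequential using scaleP[OF X(1)]
      by (intro exI[of _ "\<lambda>n. (scaleC \<alpha> (fst (X n)), scaleC \<alpha> (snd (X n)))"]) blast
  qed
  have clG: "closed G" unfolding G_def by simp
  have lim_in: "\<exists>p\<in>G. X \<longlonglongrightarrow> p"
    if "\<And>n. X n \<in> G" and C: "Cauchy (\<lambda>n. fst (X n))" for X
  proof -
    have d: "norm (fst (X m) - fst (X n)) = norm (snd (X m) - snd (X n))" for m n
      using norm_eq[OF subspace_diff[OF subG that(1) that(1)], of m n] by simp
    have "Cauchy (\<lambda>n. snd (X n))"
      using C unfolding Cauchy_def dist_norm d .
    with C obtain x y where "(\<lambda>n. fst (X n)) \<longlonglongrightarrow> x" "(\<lambda>n. snd (X n)) \<longlonglongrightarrow> y"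
      unfolding Cauchy_convergent_iff convergent_def by blast
    then have "(\<lambda>n. (fst (X n), snd (X n))) \<longlonglongrightarrow> (x, y)"
      by (rule tendsto_Pair)
    then have lim: "X \<longlonglongrightarrow> (x, y)" by simp
    then show ?thesis
      using closed_sequentially[OF clG] that(1) by blast
  qed
  \<comment> \<open>The domain of the graph is a closed complex subspace containing every
    \<open>b i\<close>, so totality of \<open>b\<close> makes it everything.\<close>
  have img: "fst ` G = UNIV"
  proof (rule complex_subspace_eq_UNIV)
    show "closed (fst ` G)"
      unfolding closed_sequential_limits
    proof (intro allI impI, elim conjE)
      fix x :: "nat \<Rightarrow> 'a l2" and l assume x: "\<forall>n. x n \<in> fst ` G" and lim: "x \<longlonglongrightarrow> l"
      have "\<exists>p. p \<in> G \<and> fst p = x n" for n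
        using x[rule_format, of n] by (elim imageE) (intro exI conjI, assumption, rule sym)
      then have "\<forall>n. \<exists>p. p \<in> G \<and> fst p = x n" by (rule allI)
      from choice[OF this] obtain X where "\<forall>n. X n \<in> G \<and> fst (X n) = x n" ..
      then have X: "X n \<in> G" "fst (X n) = x n" for n
        by simp_all
      obtain p where p: "p \<in> G" "X \<longlonglongrightarrow> p"
        using lim_in[of X, OF X(1)] LIMSEQ_imp_Cauchy[OF lim] unfolding X(2) by blast
      then have "x \<longlonglongrightarrow> fst p"
        using tendsto_fst[of X p] X(2) by simp
      then show "l \<in> fst ` G"
        using LIMSEQ_unique[OF lim] p(1) by blast
    qed
    show "subspace (fst ` G)"
      by (rule linear_subspace_image[OF linear_fst subG])
    show "scaleC \<alpha> s \<in> fst ` G" if "s \<in> fst ` G" for \<alpha> s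
      using that scaleG by force
    show "f = 0" if "\<And>s. s \<in> fst ` G \<Longrightarrow> cinner f s = 0" for f
    proof (rule total_b)
      fix i
      have "b i \<in> fst ` G" using subsetD[OF PG gen[of 1 i]] by force
      then show "cinner f (b i) = 0" by (rule that)
    qed
  qed
  define U where "U f = (SOME y. (f, y) \<in> G)" for f
  have U: "(f, U f) \<in> G" for f
  proof -
    have "f \<in> fst ` G" using img by simp
    then have "\<exists>y. (f, y) \<in> G" by force
    then show ?thesis unfolding U_def by (rule someI_ex)
  qed
  have U_unique: "y = U f" if "(f, y) \<in> G" for f y
    using norm_eq[OF subspace_diff[OF subG that U[of f]]] by simp
  show thesis
  proof (rule that)
    show "cinner (U f) (U g) = cinner f g" for f g
      using inner[OF U[of f] U[of g]] by simp
    show "U (b i) = c i" for i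
      using U_unique[of "b i" "c i"] subsetD[OF PG gen[of 1 i]] by simp
  qed
qed

text \<open>Exchanging the two families gives an isometry \<open>W\<close> in the other direction.
  Since \<open>U (W f) - f\<close> is orthogonal to every \<open>c i\<close>, \<open>W\<close> is a
  right inverse of \<open>U\<close>, whence surjectivity.\<close>

lemma gram_isometry:
  fixes b :: "'i \<Rightarrow> 'a::euclidean_space l2" and c :: "'i \<Rightarrow> 'b::euclidean_space l2"
  assumes gram: "\<And>i j. cinner (b i) (b j) = cinner (c i) (c j)"
    and total_b: "\<And>f. (\<And>i. cinner f (b i) = 0) \<Longrightarrow> f = 0"
    and total_c: "\<And>f. (\<And>i. cinner f (c i) = 0) \<Longrightarrow> f = 0"
  obtains U where "\<And>f g. cinner (U f) (U g) = cinner f g" "surj U" "\<And>i. U (b i) = c i"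
proof -
  obtain U where U: "\<And>f g. cinner (U f) (U g) = cinner f g" "\<And>i. U (b i) = c i"
    using gram_isometry_aux[of b c, OF gram total_b] by blast
  obtain W where W: "\<And>f g. cinner (W f) (W g) = cinner f g" "\<And>i. W (c i) = b i"
    using gram_isometry_aux[of c b, OF gram[symmetric] total_c] by blast
  have "U (W f) = f" for f
  proof -
    have "cinner (U (W f) - f) (c i) = 0" for i
      using U(1)[of "W f" "b i"] W(1)[of f "c i"] by (simp add: cinner_diff_left U(2) W(2))
    then have "U (W f) - f = 0" by (rule total_c)
    then show ?thesis by simp
  qed
  then have "surj U" by (metis surjI)
  with U show thesis using that by blast
qed

text \<open>Preservation of inner products already forces additivity: the squared norm of the defect
  expands into inner products that cancel.\<close>

lemma inner_preserving_diff:
  assumes "\<And>f g. cinner (U f) (U g) = cinner f g"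
  shows "U (f - g) = U f - U g"
proof -
  have "cinner (U (f - g) - (U f - U g)) (U (f - g) - (U f - U g)) = 0"
    by (simp add: cinner_diff_left cinner_diff_right assms)
  then show ?thesis by (simp add: cinner_self_eq_0)
qed

lemma inner_preserving_norm:
  assumes "\<And>f g. cinner (U f) (U g) = cinner f g"
  shows "norm (U f) = norm f"
  by (simp add: norm_l2_def assms)

subsection \<open>Lebesgue integration on Euclidean spaces\<close>

lemma borel_measurable_cnj [measurable]: "cnj \<in> borel_measurable borel"
  by (intro borel_measurable_continuous_onI continuous_intros)

lemma borel_measurable_cis [measurable]: "cis \<in> borel_measurable borel"
  by (intro borel_measurable_continuous_onI continuous_intros)

lemma lborel_integral_affine:
  fixes f :: "'a::euclidean_space \<Rightarrow> 'b::{banach, second_countable_topology}"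
  assumes c: "c \<noteq> 0" and [measurable]: "f \<in> borel_measurable borel"
  shows "(LINT x|lborel. f x) = \<bar>c\<bar> ^ DIM('a) *\<^sub>R (LINT x|lborel. f (t + c *\<^sub>R x))"
  by (subst lborel_affine[OF c, of t]) (simp add: integral_density integral_distr)

lemma lborel_integrable_affine:
  fixes f :: "'a::euclidean_space \<Rightarrow> 'b::{banach, second_countable_topology}"
  assumes c: "c \<noteq> 0" and [measurable]: "f \<in> borel_measurable borel"
  shows "integrable lborel (\<lambda>x. f (t + c *\<^sub>R x)) \<longleftrightarrow> integrable lborel f"
proof -
  have "integrable lborel f \<longleftrightarrow>
      integrable (density (distr lborel borel (\<lambda>x. t + c *\<^sub>R x)) (\<lambda>_. ennreal (\<bar>c\<bar> ^ DIM('a)))) f"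
    using lborel_affine[OF c, of t] by simp
  also have "\<dots> \<longleftrightarrow> integrable lborel (\<lambda>x. \<bar>c\<bar> ^ DIM('a) *\<^sub>R f (t + c *\<^sub>R x))"
    by (simp add: integrable_density integrable_distr_eq)
  also have "\<dots> \<longleftrightarrow> integrable lborel (\<lambda>x. f (t + c *\<^sub>R x))"
    using c integrable_scaleR_right[of "1 / \<bar>c\<bar> ^ DIM('a)" lborel "\<lambda>x. \<bar>c\<bar> ^ DIM('a) *\<^sub>R f (t + c *\<^sub>R x)"]
    by auto
  finally show ?thesis ..
qed

lemma lborel_integral_shift:
  fixes f :: "'a::euclidean_space \<Rightarrow> 'b::{banach, second_countable_topology}"
  assumes "f \<in> borel_measurable borel"
  shows "(LINT t|lborel. f (t + x)) = (LINT t|lborel. f t)"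
    and "(LINT t|lborel. f (t - x)) = (LINT t|lborel. f t)"
    and "(LINT t|lborel. f (x - t)) = (LINT t|lborel. f t)"
  using lborel_integral_affine[OF _ assms, of 1 x] lborel_integral_affine[OF _ assms, of 1 "- x"]
    lborel_integral_affine[OF _ assms, of "-1" x]
  by (simp_all add: add.commute)

lemma lborel_integrable_shift:
  fixes f :: "'a::euclidean_space \<Rightarrow> 'b::{banach, second_countable_topology}"
  assumes "integrable lborel f"
  shows "integrable lborel (\<lambda>t. f (t + x))" "integrable lborel (\<lambda>t. f (t - x))"
    "integrable lborel (\<lambda>t. f (x - t))"
  using lborel_integrable_affine[of 1 f x] lborel_integrable_affine[of 1 f "-x"] 
    lborel_integrable_affine[of "-1" f x] assms borel_measurable_integrable[OF assms]
  by (simp_all add: add.commute)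

lemma integrable_tensor:
  fixes f :: "'a::euclidean_space \<Rightarrow> 'c::{real_normed_algebra, banach, second_countable_topology}"
    and g :: "'b::euclidean_space \<Rightarrow> 'c"
  assumes f: "integrable lborel f" and g: "integrable lborel g"
  shows "integrable (lborel \<Otimes>\<^sub>M lborel) (\<lambda>(x, y). f x * g y)"
proof (rule integrableI_bounded)
  have [measurable]: "f \<in> borel_measurable borel" "g \<in> borel_measurable borel"
    using f g by auto
  show "(\<lambda>(x, y). f x * g y) \<in> borel_measurable (lborel \<Otimes>\<^sub>M lborel)"
    by measurable
  have "(\<integral>\<^sup>+z. ennreal (norm (case z of (x, y) \<Rightarrow> f x * g y)) \<partial>(lborel \<Otimes>\<^sub>M lborel))
      \<le> (\<integral>\<^sup>+z. ennreal (norm (f (fst z))) * ennreal (norm (g (snd z))) \<partial>(lborel \<Otimes>\<^sub>M lborel))"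
    by (intro nn_integral_mono)
      (auto simp: split_beta norm_mult_ineq ennreal_mult[symmetric] intro!: ennreal_leI)
  also have "\<dots> = (\<integral>\<^sup>+x. \<integral>\<^sup>+y. ennreal (norm (f x)) * ennreal (norm (g y)) \<partial>lborel \<partial>lborel)"
    by (subst lborel.nn_integral_fst[symmetric]) auto
  also have "\<dots> = (\<integral>\<^sup>+x. ennreal (norm (f x)) \<partial>lborel) * (\<integral>\<^sup>+y. ennreal (norm (g y)) \<partial>lborel)"
    by (simp add: nn_integral_cmult nn_integral_multc)
  also have "\<dots> < \<infinity>"
    using f g by (auto simp: integrable_iff_bounded ennreal_mult_less_top)
  finally show "(\<integral>\<^sup>+z. ennreal (norm (case z of (x, y) \<Rightarrow> f x * g y)) \<partial>(lborel \<Otimes>\<^sub>M lborel)) < \<infinity>" .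
qed

text \<open>Boxes form an intersection-stable generator of the Borel sets, so a Dynkin argument
  spreads the vanishing integrals to all Borel sets, and the density of the zero measure is unique
  almost everywhere.\<close>

lemma AE_zero_of_box_integrals_real:
  fixes f :: "'a::euclidean_space \<Rightarrow> real"
  assumes f: "integrable lborel f"
    and box: "\<And>a b. (LINT x|lborel. indicator (box a b) x *\<^sub>R f x) = 0"
  shows "AE x in lborel. f x = 0"
proof (rule density_unique_real[where f' = "\<lambda>_. 0", OF f])
  have [measurable]: "f \<in> borel_measurable borel" using f by auto
  have int: "integrable lborel (\<lambda>x. indicator A x *\<^sub>R f x)" if "A \<in> sets borel" for A
    by (rule integrable_mult_indicator) (use that f in auto)
  have UN: "(LINT x|lborel. indicator (\<Union>i. A i) x *\<^sub>R f x) = 0"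
    if d: "disjoint_family A" and A: "\<And>i. A i \<in> sets borel"
      and 0: "\<And>i. (LINT x|lborel. indicator (A i) x *\<^sub>R f x) = 0" for A :: "nat \<Rightarrow> 'a set"
    using lebesgue_integral_countable_add[of A lborel f] d A 0 int[of "\<Union>i. A i"]
    by (auto simp: set_lebesgue_integral_def set_integrable_def disjoint_family_on_def)
  \<comment> \<open>The complement step needs the integral over the whole space, which is not a box;
    it is the limit over growing cubes.\<close>
  have UNIV0: "(LINT x|lborel. f x) = 0"
  proof -
    have "(\<lambda>n. LINT x|lborel. indicator (box (- real n *\<^sub>R One) (real n *\<^sub>R One)) x *\<^sub>R f x)
        \<longlonglongrightarrow> (LINT x|lborel. f x)"
    proof (rule integral_dominated_convergence[where w = "\<lambda>x. norm (f x)"])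
      show "AE x in lborel. (\<lambda>n. indicator (box (- real n *\<^sub>R One) (real n *\<^sub>R One)) x *\<^sub>R f x) \<longlonglongrightarrow> f x"
      proof (rule AE_I2)
        fix x :: 'a
        obtain N where N: "norm x < real N"
          using reals_Archimedean2 by blast
        have "x \<in> box (- real n *\<^sub>R One) (real n *\<^sub>R One)" if "n \<ge> N" for n
        proof -
          have "\<bar>x \<bullet> b\<bar> < real n" if "b \<in> Basis" for b
            using Basis_le_norm[OF that, of x] N \<open>n \<ge> N\<close> by linarith
          then show ?thesis by (auto simp: mem_box abs_less_iff minus_less_iff)
        qed
        then have "\<forall>\<^sub>F n in sequentially. indicator (box (- real n *\<^sub>R One) (real n *\<^sub>R One)) x *\<^sub>R f x = f x"
          unfolding eventually_sequentially by (intro exI[of _ N]) auto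
        then show "(\<lambda>n. indicator (box (- real n *\<^sub>R One) (real n *\<^sub>R One)) x *\<^sub>R f x) \<longlonglongrightarrow> f x"
          by (rule tendsto_eventually)
      qed
    qed (use f in \<open>auto simp: indicator_def\<close>)
    then show ?thesis
      by (simp only: box LIMSEQ_const_iff)
  qed
  fix A :: "'a set" assume "A \<in> sets lborel"
  then have A: "A \<in> sigma_sets UNIV (range (\<lambda>(a, b). box a b))"
    by (simp add: borel_eq_box)
  have sub: "sigma_sets UNIV (range (\<lambda>(a, b). box a b :: 'a set)) = sets borel"
    by (simp add: borel_eq_box)
  have "Int_stable (range (\<lambda>(a, b). box a b :: 'a set))"
    by (auto simp: Int_stable_def box_Int_box)
  moreover have "range (\<lambda>(a, b). box a b :: 'a set) \<subseteq> Pow UNIV"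
    by simp
  ultimately have "(LINT x|lborel. indicator A x *\<^sub>R f x) = 0"
    using A
  proof (induction rule: sigma_sets_induct_disjoint)
    case (compl A)
    have "(LINT x|lborel. indicator (UNIV - A) x *\<^sub>R f x) =
        (LINT x|lborel. f x - indicator A x *\<^sub>R f x)"
      by (intro Bochner_Integration.integral_cong) (auto simp: indicator_def)
    then show ?case
      using compl f int[of A] by (simp add: UNIV0 sub)
  next
    case (union A)
    then show ?case by (intro UN) (auto simp: sub)
  qed (auto simp: box simp del: real_scaleR_def)
  then show "(LINT x:A|lborel. f x) = (LINT x:A|lborel. 0)"
    by (simp add: set_lebesgue_integral_def)
qed simp

lemma AE_zero_of_box_integrals:
  fixes h :: "'a::euclidean_space \<Rightarrow> complex"
  assumes h: "integrable lborel h"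
    and box: "\<And>a b. (LINT x|lborel. indicator (box a b) x * h x) = 0"
  shows "AE x in lborel. h x = 0"
proof -
  have "indicator A x * h x = indicator A x *\<^sub>R h x" for A x
    by (auto simp: indicator_def)
  then have int: "integrable lborel (\<lambda>x. indicator (box a b) x * h x)" for a b
    using integrable_mult_indicator[of "box a b" lborel h] h by simp
  have re: "Re (indicator A x * h x) = indicator A x *\<^sub>R Re (h x)"
    and im: "Im (indicator A x * h x) = indicator A x *\<^sub>R Im (h x)" for A x
    by (auto simp: indicator_def)
  have "AE x in lborel. Re (h x) = 0"
  proof (intro AE_zero_of_box_integrals_real integrable_Re h)
    show "(LINT x|lborel. indicator (box a b) x *\<^sub>R Re (h x)) = 0" for a b
      using integral_Re[OF int[of a b]] unfolding re box by simp
  qed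
  moreover have "AE x in lborel. Im (h x) = 0"
  proof (intro AE_zero_of_box_integrals_real integrable_Im h)
    show "(LINT x|lborel. indicator (box a b) x *\<^sub>R Im (h x)) = 0" for a b
      using integral_Im[OF int[of a b]] unfolding im box by simp
  qed
  ultimately show ?thesis
    by eventually_elim (simp add: complex_eq_iff)
qed

subsection \<open>Gaussians\<close>

text \<open>The factor \<open>pi\<close> matches the Fourier kernel with \<open>2 * pi\<close>, so
  that \<open>gaussian 1\<close> is its own Fourier transform.\<close>

definition gaussian :: "real \<Rightarrow> 'a::euclidean_space \<Rightarrow> real" where
  "gaussian c t = exp (- (pi * c * (norm t)\<^sup>2))"

lemma gaussian_measurable [measurable]: "gaussian c \<in> borel_measurable borel"
  unfolding gaussian_def by measurable

lemma gaussian_pos: "0 < gaussian c t"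
  by (simp add: gaussian_def)

lemma gaussian_minus [simp]: "gaussian c (- t) = gaussian c t"
  by (simp add: gaussian_def)

lemma gaussian_diff_commute: "gaussian c (s - t) = gaussian c (t - s)"
  by (simp add: gaussian_def norm_minus_commute)

lemma gaussian_le_one: "0 \<le> c \<Longrightarrow> gaussian c t \<le> 1"
  by (simp add: gaussian_def)

lemma integral_lborel_prod:
  fixes f :: "'a::euclidean_space \<Rightarrow> real \<Rightarrow> complex"
  assumes f: "\<And>b. b \<in> Basis \<Longrightarrow> integrable lborel (f b)"
  shows "integrable lborel (\<lambda>x. \<Prod>b\<in>Basis. f b (x \<bullet> b))"
    and "(LINT x|lborel. (\<Prod>b\<in>Basis. f b (x \<bullet> b))) = (\<Prod>b\<in>Basis. (LINT x|lborel. f b x))"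
proof -
  interpret product_sigma_finite "\<lambda>_::'a. lborel :: real measure" ..
  have [measurable]: "f b \<in> borel_measurable borel" if "b \<in> Basis" for b
    using borel_measurable_integrable[OF f[OF that]] by simp
  let ?T = "\<lambda>y. \<Sum>b\<in>Basis. y b *\<^sub>R b :: 'a"
  let ?P = "\<Pi>\<^sub>M b\<in>Basis. lborel"
  have T [measurable]: "?T \<in> ?P \<rightarrow>\<^sub>M borel"
    by measurable
  have M: "(\<lambda>x. \<Prod>b\<in>Basis. f b (x \<bullet> b)) \<in> borel_measurable borel"
    by measurable
  have eq: "(\<Prod>b\<in>Basis. f b (?T y \<bullet> b)) = (\<Prod>b\<in>Basis. f b (y b))" for y
    by (intro prod.cong refl) simp
  show "integrable lborel (\<lambda>x. \<Prod>b\<in>Basis. f b (x \<bullet> b))"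
    unfolding lborel_eq[where 'a = 'a]
    by (subst integrable_distr_eq[OF T M]) (unfold eq, intro product_integrable_prod f finite_Basis)
  show "(LINT x|lborel. (\<Prod>b\<in>Basis. f b (x \<bullet> b))) = (\<Prod>b\<in>Basis. (LINT x|lborel. f b x))"
    unfolding lborel_eq[where 'a = 'a]
    by (subst integral_distr[OF T M]) (unfold eq, intro product_integral_prod f finite_Basis)
qed

text \<open>A rescaling of the characteristic function of the standard normal distribution.\<close>

lemma gaussian_fourier_real:
  assumes c: "c > 0"
  shows "integrable lborel (\<lambda>x::real. complex_of_real (exp (- (pi * c * x\<^sup>2))) * cis (- (2 * pi * (s * x))))"
    and "(LINT x|lborel. complex_of_real (exp (- (pi * c * x\<^sup>2))) * cis (- (2 * pi * (s * x)))) =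
      complex_of_real (exp (- (pi * s\<^sup>2 / c)) / sqrt c)"
proof -
  \<comment> \<open>Chosen so that \<open>(a * x)\<^sup>2 / 2\<close> equals
    \<open>pi * c * x\<^sup>2\<close>, turning the normal density at \<open>a * x\<close> into the
    Gaussian.\<close>
  define a where "a = sqrt (2 * pi * c)"
  have a: "a > 0" and a2: "a\<^sup>2 = 2 * pi * c"
    using c by (auto simp: a_def)
  have a': "a = sqrt (2 * pi) * sqrt c"
    by (simp add: a_def real_sqrt_mult)
  \<comment> \<open>The frequency for which \<open>t * (a * x)\<close> is the phase
    \<open>- (2 * pi * (s * x))\<close>.\<close>
  define t where "t = - (2 * pi * s) / a"
  define g where "g x = complex_of_real (std_normal_density x) * cis (t * x)" for x
  have std: "std_normal_density (a * x) = exp (- (pi * c * x\<^sup>2)) / sqrt (2 * pi)" for x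
    by (simp add: std_normal_density_def power_mult_distrib a2)
  have g_eq: "g (a * x) = complex_of_real (exp (- (pi * c * x\<^sup>2)) * (1 / sqrt (2 * pi))) * cis (- (2 * pi * (s * x)))" for x
  proof -
    have "t * (a * x) = - (2 * pi * (s * x))"
      using a by (simp add: t_def)
    then show ?thesis by (simp only: g_def std) simp
  qed
  have int_g: "integrable lborel g"
  proof (rule Bochner_Integration.integrable_bound[of _ std_normal_density])
    show "g \<in> borel_measurable lborel"
      unfolding g_def by measurable
    show "AE x in lborel. norm (g x) \<le> norm (std_normal_density x)"
      by (rule AE_I2) (simp add: g_def norm_mult)
  qed simp
  have "integrable lborel (\<lambda>x. sqrt (2 * pi) *\<^sub>R g (0 + a * x))"
    using a by (intro integrable_scaleR_right lborel_integrable_real_affine int_g) auto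
  then show "integrable lborel (\<lambda>x::real. complex_of_real (exp (- (pi * c * x\<^sup>2))) * cis (- (2 * pi * (s * x))))"
    by (simp add: g_eq scaleR_conv_of_real)
  have "char std_normal_distribution t = (LINT x|lborel. g x)"
    unfolding char_def by (subst integral_density) (auto simp: g_def[abs_def] cis_conv_exp scaleR_conv_of_real)
  then have "(LINT x|lborel. g x) = complex_of_real (exp (- (t\<^sup>2) / 2))"
    by (simp add: char_std_normal_distribution)
  also have "t\<^sup>2 / 2 = pi * s\<^sup>2 / c"
  proof -
    have "t\<^sup>2 = (2 * pi * s)\<^sup>2 / (2 * pi * c)"
      by (simp only: t_def power_divide power2_minus a2)
    then show ?thesis
      using c by (simp add: power2_eq_square)
  qed
  then have "- (t\<^sup>2) / 2 = - (pi * s\<^sup>2 / c)" by simp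
  finally have "(LINT x|lborel. g x) = complex_of_real (exp (- (pi * s\<^sup>2 / c)))" .
  moreover have "(LINT x|lborel. g x) = \<bar>a\<bar> *\<^sub>R (LINT x|lborel. g (0 + a * x))"
    using a by (intro lborel_integral_real_affine) auto
  ultimately have "complex_of_real (exp (- (pi * s\<^sup>2 / c))) = complex_of_real a * (LINT x|lborel. g (a * x))"
    using a by (simp add: scaleR_conv_of_real)
  also have "(LINT x|lborel. g (a * x)) = (LINT x|lborel. complex_of_real (exp (- (pi * c * x\<^sup>2))) * cis (- (2 * pi * (s * x)))) * complex_of_real (1 / sqrt (2 * pi))"
    unfolding g_eq by (subst integral_mult_left_zero[symmetric]) (simp add: mult_ac)
  finally show "(LINT x|lborel. complex_of_real (exp (- (pi * c * x\<^sup>2))) * cis (- (2 * pi * (s * x)))) =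
      complex_of_real (exp (- (pi * s\<^sup>2 / c)) / sqrt c)"
    using c by (simp add: a' field_simps)
qed

text \<open>The literal integral, meaningful for integrable \<open>f\<close> only; its extension to
  the Hilbert space is the map obtained in \<open>plancherel\<close>.\<close>

definition fourier :: "('a::euclidean_space \<Rightarrow> complex) \<Rightarrow> 'a \<Rightarrow> complex" where
  "fourier f \<xi> = (LINT t|lborel. f t * cis (- (2 * pi * (\<xi> \<bullet> t))))"

text \<open>Both the Gaussian and the character factor over the coordinates, which reduces
  everything to dimension one. Integrability is the case of frequency 0.\<close>

lemma gaussian_fourier:
  fixes \<xi> :: "'a::euclidean_space"
  assumes c: "c > 0"
  shows "integrable lborel (gaussian c :: 'a \<Rightarrow> real)"
    and "fourier (\<lambda>t. complex_of_real (gaussian c t)) \<xi> =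
      complex_of_real ((1 / sqrt c) ^ DIM('a) * gaussian (1 / c) \<xi>)"
proof -
  define f where "f \<xi> b x = complex_of_real (exp (- (pi * c * x\<^sup>2))) * cis (- (2 * pi * ((\<xi> \<bullet> b) * x)))"
    for \<xi> b :: 'a and x
  have norm2: "(norm t)\<^sup>2 = (\<Sum>b\<in>Basis. (t \<bullet> b)\<^sup>2)" for t :: 'a
    unfolding power2_norm_eq_inner by (subst euclidean_inner) (simp add: power2_eq_square)
  have cis_sum: "cis (sum g A) = (\<Prod>x\<in>A. cis (g x))" for g :: "'a \<Rightarrow> real" and A
    by (induction A rule: infinite_finite_induct) (auto simp: cis_mult[symmetric])
  have eq: "complex_of_real (gaussian c t) * cis (- (2 * pi * (\<xi> \<bullet> t))) = (\<Prod>b\<in>Basis. f \<xi> b (t \<bullet> b))" for \<xi> t :: 'a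
  proof -
    have "complex_of_real (gaussian c t) = (\<Prod>b\<in>Basis. complex_of_real (exp (- (pi * c * (t \<bullet> b)\<^sup>2))))"
      unfolding gaussian_def norm2 sum_distrib_left sum_negf[symmetric]
      by (simp add: exp_sum)
    moreover have "cis (- (2 * pi * (\<xi> \<bullet> t))) = (\<Prod>b\<in>Basis. cis (- (2 * pi * ((\<xi> \<bullet> b) * (t \<bullet> b)))))"
      by (subst euclidean_inner) (simp add: sum_distrib_left sum_negf[symmetric] cis_sum del: sum_negf)
    ultimately show ?thesis
      by (simp add: f_def prod.distrib)
  qed
  have int: "integrable lborel (f \<xi> b)" for \<xi> b
    unfolding f_def by (rule gaussian_fourier_real[OF c])
  have "integrable lborel (\<lambda>t::'a. complex_of_real (gaussian c t) * cis (- (2 * pi * (0 \<bullet> t))))"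
    unfolding eq by (rule integral_lborel_prod) (rule int)
  then show "integrable lborel (gaussian c :: 'a \<Rightarrow> real)"
    using integrable_Re by fastforce
  have "fourier (\<lambda>t. complex_of_real (gaussian c t)) \<xi> = (\<Prod>b\<in>Basis. (LINT x|lborel. f \<xi> b x))"
    unfolding fourier_def eq by (rule integral_lborel_prod) (rule int)
  also have "\<dots> = (\<Prod>b\<in>Basis. complex_of_real (exp (- (pi * (\<xi> \<bullet> b)\<^sup>2 / c)) * (1 / sqrt c)))"
    unfolding f_def gaussian_fourier_real(2)[OF c] by simp
  also have "\<dots> = complex_of_real ((\<Prod>b\<in>Basis. exp (- (pi * (\<xi> \<bullet> b)\<^sup>2 / c))) * (1 / sqrt c) ^ DIM('a))"
    by (simp only: of_real_prod[symmetric] prod.distrib prod_constant)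
  also have "(\<Prod>b\<in>Basis. exp (- (pi * (\<xi> \<bullet> b)\<^sup>2 / c))) = gaussian (1 / c) \<xi>"
    unfolding gaussian_def norm2 by (simp add: exp_sum[symmetric] sum_distrib_left sum_negf[symmetric] sum_divide_distrib del: sum_negf)
  finally show "fourier (\<lambda>t. complex_of_real (gaussian c t)) \<xi> =
      complex_of_real ((1 / sqrt c) ^ DIM('a) * gaussian (1 / c) \<xi>)"
    by (simp only: mult.commute)
qed

subsection \<open>The Fourier transform\<close>

lemma fourier_measurable [measurable]:
  assumes [measurable]: "f \<in> borel_measurable borel"
  shows "fourier f \<in> borel_measurable borel"
proof -
  have "(\<lambda>(\<xi>, t). f t * cis (- (2 * pi * (\<xi> \<bullet> t)))) \<in> borel_measurable (borel \<Otimes>\<^sub>M lborel)"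
    by measurable
  from lborel.borel_measurable_lebesgue_integral[OF this] show ?thesis
    unfolding fourier_def[abs_def] .
qed

lemma norm_fourier_le: "cmod (fourier f \<xi>) \<le> (LINT t|lborel. cmod (f t))"
  unfolding fourier_def by (rule order_trans[OF integral_norm_bound]) (simp add: norm_mult)

lemma integrable_mult_bounded:
  fixes f g :: "'a::euclidean_space \<Rightarrow> complex"
  assumes f: "integrable lborel f" and [measurable]: "g \<in> borel_measurable borel"
    and B: "\<And>x. cmod (g x) \<le> B"
  shows "integrable lborel (\<lambda>x. f x * g x)"
proof (rule Bochner_Integration.integrable_bound)
  have [measurable]: "f \<in> borel_measurable borel" using f by auto
  show "integrable lborel (\<lambda>x. B * cmod (f x))"
    using f by (intro integrable_mult_right integrable_norm)
  show "(\<lambda>x. f x * g x) \<in> borel_measurable lborel" by measurable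
  have "cmod (f x * g x) \<le> norm (B * cmod (f x))" for x
  proof -
    have "cmod (f x) * cmod (g x) \<le> cmod (f x) * B"
      by (intro mult_left_mono B) simp
    also have "\<dots> \<le> norm (B * cmod (f x))"
      by (simp add: mult.commute)
    finally show ?thesis by (simp add: norm_mult)
  qed
  then show "AE x in lborel. norm (f x * g x) \<le> norm (B * cmod (f x))"
    by (rule AE_I2)
qed

lemma square_integrable_bounded:
  assumes f: "integrable lborel f" and B: "\<And>x. cmod (f x) \<le> B"
  shows "square_integrable f"
  unfolding square_integrable_def
proof
  show M [measurable]: "f \<in> borel_measurable lborel" using f by auto
  have "integrable lborel (\<lambda>x. f x * cnj (f x))"
    by (rule integrable_mult_bounded[OF f, of _ B]) (use B in auto)
  from integrable_norm[OF this] show "integrable lborel (\<lambda>x. (cmod (f x))\<^sup>2)"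
    by (simp add: norm_mult power2_eq_square)
qed

text \<open>Fubini exchanges the integrals; conjugating \<open>fourier g\<close> reverses the sign
  in its kernel, which the argument \<open>- t\<close> compensates.\<close>

lemma fourier_adjoint:
  assumes f: "integrable lborel f" and g: "integrable lborel g"
  shows "(LINT \<xi>|lborel. fourier f \<xi> * cnj (g \<xi>)) = (LINT t|lborel. f t * cnj (fourier g (- t)))"
proof -
  have [measurable]: "f \<in> borel_measurable borel" "g \<in> borel_measurable borel"
    using f g by auto
  let ?H = "\<lambda>t \<xi>. f t * cis (- (2 * pi * (\<xi> \<bullet> t))) * cnj (g \<xi>)"
  have "integrable (lborel \<Otimes>\<^sub>M lborel) (case_prod ?H)"
  proof (rule Bochner_Integration.integrable_bound[OF integrable_tensor[OF f g]])
    show "case_prod ?H \<in> borel_measurable (lborel \<Otimes>\<^sub>M lborel)"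
      by measurable
  qed (auto intro!: AE_I2 simp: norm_mult)
  from lborel_pair.Fubini_integral[OF this]
  have "(LINT \<xi>|lborel. LINT t|lborel. ?H t \<xi>) = (LINT t|lborel. LINT \<xi>|lborel. ?H t \<xi>)" .
  moreover have "(LINT t|lborel. ?H t \<xi>) = fourier f \<xi> * cnj (g \<xi>)" for \<xi>
    unfolding fourier_def by (rule integral_mult_left_zero)
  moreover have "(LINT \<xi>|lborel. ?H t \<xi>) = f t * cnj (fourier g (- t))" for t
  proof -
    have "cnj (fourier g (- t)) = (LINT \<xi>|lborel. cnj (g \<xi> * cis (- (2 * pi * ((- t) \<bullet> \<xi>)))))"
      unfolding fourier_def by (rule Bochner_Integration.integral_cnj[symmetric])
    then show ?thesis
      by (simp add: cis_cnj inner_commute[of t] mult_ac flip: integral_mult_right_zero)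
  qed
  ultimately show ?thesis by (simp only:)
qed

lemma fourier_modulation: "fourier (\<lambda>t. f t * cis (2 * pi * (a \<bullet> t))) \<xi> = fourier f (\<xi> - a)"
  unfolding fourier_def
  by (intro Bochner_Integration.integral_cong refl)
    (simp add: mult.assoc cis_mult inner_diff_left right_diff_distrib)

lemma fourier_translation:
  assumes [measurable]: "f \<in> borel_measurable borel"
  shows "fourier (\<lambda>t. f (t - x)) \<xi> = cis (- (2 * pi * (\<xi> \<bullet> x))) * fourier f \<xi>"
proof -
  have "fourier (\<lambda>t. f (t - x)) \<xi> = (LINT t|lborel. f (t + x - x) * cis (- (2 * pi * (\<xi> \<bullet> (t + x)))))"
    unfolding fourier_def by (rule lborel_integral_shift(1)[symmetric]) measurable
  also have "\<dots> = (LINT t|lborel. cis (- (2 * pi * (\<xi> \<bullet> x))) * (f t * cis (- (2 * pi * (\<xi> \<bullet> t)))))"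
    by (intro Bochner_Integration.integral_cong refl)
      (simp add: cis_mult inner_add_right distrib_left add.commute mult.left_commute)
  also have "\<dots> = cis (- (2 * pi * (\<xi> \<bullet> x))) * fourier f \<xi>"
    unfolding fourier_def by (rule integral_mult_right_zero)
  finally show ?thesis .
qed

text \<open>The integral is a convolution of \<open>h\<close> with a Gaussian. By
  \<open>fourier_adjoint\<close> it is a multiple of a pairing of \<open>fourier h\<close> with a
  modulated Gaussian, hence zero.\<close>

lemma gaussian_smoothing_zero:
  fixes h :: "'a::euclidean_space \<Rightarrow> complex"
  assumes h: "integrable lborel h" and zero: "\<And>\<xi>. fourier h \<xi> = 0" and c: "c > 0"
  shows "(LINT t|lborel. h t * complex_of_real (gaussian c (t - y))) = 0"
proof -
  \<comment> \<open>The width is inverted because transforming \<open>gaussian (1 / c)\<close> gives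
    a multiple of \<open>gaussian c\<close>; the modulation becomes the translation by
    \<open>y\<close>.\<close>
  let ?g = "\<lambda>\<xi>. complex_of_real (gaussian (1 / c) \<xi>) * cis (2 * pi * ((- y) \<bullet> \<xi>))"
  let ?K = "(1 / sqrt (1 / c)) ^ DIM('a)"
  have "integrable lborel ?g"
    using c by (intro integrable_mult_bounded[of _ _ 1] integrable_of_real gaussian_fourier(1)) auto
  from fourier_adjoint[OF h this]
  have "0 = (LINT t|lborel. h t * cnj (fourier ?g (- t)))"
    by (simp add: zero)
  also have "\<dots> = (LINT t|lborel. h t * complex_of_real (gaussian c (t - y)) * complex_of_real ?K)"
  proof (intro Bochner_Integration.integral_cong refl)
    fix t
    have "fourier ?g (- t) = complex_of_real (?K * gaussian c (t - y))"
      unfolding fourier_modulation using c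
      by (subst gaussian_fourier(2)) (auto simp: gaussian_diff_commute[of c t y])
    then show "h t * cnj (fourier ?g (- t)) = h t * complex_of_real (gaussian c (t - y)) * complex_of_real ?K"
      by simp
  qed
  also have "\<dots> = (LINT t|lborel. h t * complex_of_real (gaussian c (t - y))) * complex_of_real ?K"
    by (rule integral_mult_left_zero)
  finally show ?thesis
    using c by simp
qed

text \<open>Convolving \<open>h\<close> with narrowing Gaussians and integrating over a box gives zero, which in the limit
  yields a vanishing integral of \<open>h\<close> over the box.\<close>

theorem fourier_unique:
  fixes h :: "'a::euclidean_space \<Rightarrow> complex"
  assumes h: "integrable lborel h" and zero: "\<And>\<xi>. fourier h \<xi> = 0"
  shows "AE t in lborel. h t = 0"
proof (rule AE_zero_of_box_integrals[OF h])
  fix a b :: 'a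
  have [measurable]: "h \<in> borel_measurable borel" using h by auto
  let ?B = "box a b"
  let ?I = "LINT u|lborel. gaussian 1 (u :: 'a)"
  define \<epsilon> where "\<epsilon> n = 1 / real (Suc n)" for n
  have eps: "\<epsilon> n > 0" for n by (simp add: \<epsilon>_def)
  have eps0: "\<epsilon> \<longlonglongrightarrow> 0"
    unfolding \<epsilon>_def[abs_def] by (rule LIMSEQ_Suc[OF lim_1_over_n])
  \<comment> \<open>The convolution of the box indicator with a narrow Gaussian, after substituting
    \<open>y = t - \<epsilon> n *\<^sub>R u\<close>. The Gaussian is now fixed and only the
    indicator depends on \<open>n\<close>, so dominated convergence applies.\<close>
  define k where "k n t = (LINT u|lborel. gaussian 1 u * indicator ?B (t - \<epsilon> n *\<^sub>R u))" for n and t :: 'a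
  have gi: "integrable lborel (gaussian 1 :: 'a \<Rightarrow> real)"
    by (rule gaussian_fourier(1)) simp
  have k_meas [measurable]: "k n \<in> borel_measurable borel" for n
    unfolding k_def[abs_def] by measurable
  have k_eq: "(LINT y|lborel. indicator ?B y * gaussian (1 / (\<epsilon> n)\<^sup>2) (t - y)) = \<epsilon> n ^ DIM('a) * k n t" for n t
  proof -
    have "gaussian (1 / (\<epsilon> n)\<^sup>2) (t - (t + (- \<epsilon> n) *\<^sub>R u)) = gaussian 1 u" for u
      using eps[of n] by (simp add: gaussian_def power_mult_distrib)
    then show ?thesis
      using eps[of n] unfolding k_def
      by (subst lborel_integral_affine[of "- \<epsilon> n" _ t]) (auto simp: mult.commute)
  qed
  have zero_k: "(LINT t|lborel. h t * complex_of_real (k n t)) = 0" for n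
  proof -
    let ?c = "1 / (\<epsilon> n)\<^sup>2"
    have c: "?c > 0" using eps[of n] by simp
    let ?H = "\<lambda>t y. h t * complex_of_real (indicator ?B y * gaussian ?c (t - y))"
    have "integrable (lborel \<Otimes>\<^sub>M lborel) (\<lambda>(t, y). h t * complex_of_real (indicator ?B y))"
      by (intro integrable_tensor h integrable_of_real integrable_real_indicator) (auto simp: emeasure_lborel_box_eq)
    then have "integrable (lborel \<Otimes>\<^sub>M lborel) (case_prod ?H)"
    proof (rule Bochner_Integration.integrable_bound)
      show "case_prod ?H \<in> borel_measurable (lborel \<Otimes>\<^sub>M lborel)"
        by measurable
      show "AE z in lborel \<Otimes>\<^sub>M lborel. norm (case_prod ?H z) \<le>
          norm (case z of (t, y) \<Rightarrow> h t * complex_of_real (indicator ?B y))"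
        using gaussian_le_one[of ?c] c
        by (intro AE_I2) (auto simp: norm_mult indicator_def gaussian_def intro!: mult_left_le)
    qed
    from lborel_pair.Fubini_integral[OF this]
    have "(LINT t|lborel. LINT y|lborel. ?H t y) = (LINT y|lborel. LINT t|lborel. ?H t y)" ..
    also have "\<dots> = (LINT y|lborel. complex_of_real (indicator ?B y) * (LINT t|lborel. h t * complex_of_real (gaussian ?c (t - y))))"
      by (intro Bochner_Integration.integral_cong refl)
        (simp add: mult.left_commute flip: integral_mult_right_zero)
    also have "\<dots> = 0"
      using gaussian_smoothing_zero[OF h zero c] by simp
    also have "(LINT t|lborel. LINT y|lborel. ?H t y) = (LINT t|lborel. h t * complex_of_real (\<epsilon> n ^ DIM('a) * k n t))"
    proof (intro Bochner_Integration.integral_cong refl)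
      fix t
      have "(LINT y|lborel. ?H t y) = h t * complex_of_real (LINT y|lborel. indicator ?B y * gaussian ?c (t - y))"
        by (simp only: integral_mult_right_zero integral_complex_of_real)
      then show "(LINT y|lborel. ?H t y) = h t * complex_of_real (\<epsilon> n ^ DIM('a) * k n t)"
        by (simp only: k_eq)
    qed
    also have "\<dots> = (LINT t|lborel. (h t * complex_of_real (k n t)) * complex_of_real (\<epsilon> n ^ DIM('a)))"
      by (simp add: mult_ac)
    also have "\<dots> = (LINT t|lborel. h t * complex_of_real (k n t)) * complex_of_real (\<epsilon> n ^ DIM('a))"
      by (rule integral_mult_left_zero)
    finally show ?thesis
      using eps[of n] by simp
  qed
  have k_bound: "\<bar>k n t\<bar> \<le> ?I" for n t
  proof -
    have "\<bar>k n t\<bar> \<le> (LINT u|lborel. norm (gaussian 1 u * indicator ?B (t - \<epsilon> n *\<^sub>R u)))"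
      unfolding k_def real_norm_def[symmetric] by (rule integral_norm_bound)
    also have "\<dots> \<le> ?I"
      by (rule integral_mono') (use gi in \<open>auto simp: indicator_def abs_mult less_imp_le[OF gaussian_pos]\<close>)
    finally show ?thesis .
  qed
  \<comment> \<open>At boundary points of the box the indicator may oscillate along the approach.
    They form a null set and are left out.\<close>
  have k_lim: "(\<lambda>n. k n t) \<longlonglongrightarrow> ?I * indicator ?B t" if t: "t \<notin> cbox a b - ?B" for t
  proof -
    have "(\<lambda>n. k n t) \<longlonglongrightarrow> (LINT u|lborel. gaussian 1 (u :: 'a) * indicator ?B t)"
      unfolding k_def
    proof (rule integral_dominated_convergence[where w = "gaussian 1 :: 'a \<Rightarrow> real"])
      show "AE u in lborel. (\<lambda>n. gaussian 1 u * indicator ?B (t - \<epsilon> n *\<^sub>R u)) \<longlonglongrightarrow> gaussian 1 u * indicator ?B t"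
      proof (intro AE_I2 tendsto_mult tendsto_const)
        fix u :: 'a
        have lim: "(\<lambda>n. t - \<epsilon> n *\<^sub>R u) \<longlonglongrightarrow> t"
          using tendsto_diff[OF tendsto_const tendsto_scaleR[OF eps0 tendsto_const], of t u] by simp
        have "\<forall>\<^sub>F n in sequentially. indicator ?B (t - \<epsilon> n *\<^sub>R u) = (indicator ?B t :: real)"
        proof (cases "t \<in> ?B")
          case True
          then have "\<forall>\<^sub>F n in sequentially. t - \<epsilon> n *\<^sub>R u \<in> ?B"
            using topological_tendstoD[OF lim open_box] by blast
          then show ?thesis by eventually_elim (simp add: True)
        next
          case False
          then have "t \<in> - cbox a b" using t by blast
          then have "\<forall>\<^sub>F n in sequentially. t - \<epsilon> n *\<^sub>R u \<in> - cbox a b"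
            using topological_tendstoD[OF lim, of "- cbox a b"] open_Compl[OF closed_cbox[of a b]] by blast
          then show ?thesis
          proof eventually_elim
            case (elim n)
            then have "t - \<epsilon> n *\<^sub>R u \<notin> ?B" using box_subset_cbox by blast
            then show ?case using False by simp
          qed
        qed
        then show "(\<lambda>n. indicator ?B (t - \<epsilon> n *\<^sub>R u) :: real) \<longlonglongrightarrow> indicator ?B t"
          by (rule tendsto_eventually)
      qed
    qed (use gi in \<open>auto simp: indicator_def less_imp_le[OF gaussian_pos]\<close>)
    then show ?thesis by simp
  qed
  have "(\<lambda>n. LINT t|lborel. h t * complex_of_real (k n t)) \<longlonglongrightarrow>
      (LINT t|lborel. h t * complex_of_real (?I * indicator ?B t))"
  proof (rule integral_dominated_convergence[where w = "\<lambda>t. cmod (h t) * ?I"])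
    have "AE t in lborel. t \<notin> cbox a b - ?B"
      by (rule AE_not_in[OF null_sets_cbox_Diff_box])
    then show "AE t in lborel. (\<lambda>n. h t * complex_of_real (k n t)) \<longlonglongrightarrow> h t * complex_of_real (?I * indicator ?B t)"
    proof eventually_elim
      case (elim t)
      show ?case by (intro tendsto_intros k_lim elim)
    qed
    show "integrable lborel (\<lambda>t. cmod (h t) * ?I)"
      using h by auto
    show "AE t in lborel. norm (h t * complex_of_real (k n t)) \<le> cmod (h t) * ?I" for n
      by (intro AE_I2) (simp add: norm_mult k_bound mult_left_mono)
  qed auto
  then have "(LINT t|lborel. h t * complex_of_real (?I * indicator ?B t)) = 0"
    unfolding zero_k by (simp only: LIMSEQ_const_iff)
  moreover have "h t * complex_of_real (?I * indicator ?B t) = complex_of_real ?I * (indicator ?B t * h t)" for t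
    by (auto simp: indicator_def)
  \<comment> \<open>The total mass is the value at 0 of the known Fourier transform.\<close>
  moreover have "?I \<noteq> 0"
  proof -
    have "fourier (\<lambda>t. complex_of_real (gaussian 1 t)) (0 :: 'a) = complex_of_real ?I"
      by (simp add: fourier_def)
    then show ?thesis
      by (subst (asm) gaussian_fourier(2)) (auto simp: gaussian_def[of _ "0 :: 'a"])
  qed
  ultimately show "(LINT t|lborel. indicator ?B t * h t) = 0"
    by (simp only: integral_mult_right_zero mult_eq_0_iff of_real_eq_0_iff) simp
qed

section \<open>Gaussian wave packets and Plancherel's theorem\<close>

definition wave_packet :: "'a::euclidean_space \<Rightarrow> 'a \<Rightarrow> 'a \<Rightarrow> complex" where
  "wave_packet x \<xi> t = complex_of_real (gaussian 1 (t - x)) * cis (2 * pi * (\<xi> \<bullet> t))"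

lemma norm_wave_packet_le: "cmod (wave_packet x \<xi> t) \<le> 1"
  using gaussian_le_one[of 1 "t - x"] gaussian_pos[of 1 "t - x"]
  by (simp add: wave_packet_def norm_mult)

lemma integrable_wave_packet: "integrable lborel (wave_packet x \<xi>)"
  unfolding wave_packet_def[abs_def]
  by (intro integrable_mult_bounded[of _ _ 1] integrable_of_real lborel_integrable_shift gaussian_fourier(1)) auto

lemma square_integrable_wave_packet: "square_integrable (wave_packet x \<xi>)"
  by (rule square_integrable_bounded[OF integrable_wave_packet norm_wave_packet_le])

text \<open>The Fourier transform exchanges translation and modulation and fixes
  \<open>gaussian 1\<close>, so it acts on phase space as the rotation taking
  \<open>(x, \<xi>)\<close> to \<open>(\<xi>, - x)\<close>, up to a phase.\<close>

lemma fourier_wave_packet: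
  "fourier (wave_packet x \<xi>) = (\<lambda>\<eta>. cis (2 * pi * (\<xi> \<bullet> x)) * wave_packet \<xi> (- x) \<eta>)"
proof
  fix \<eta>
  have "fourier (wave_packet x \<xi>) \<eta> = cis (- (2 * pi * ((\<eta> - \<xi>) \<bullet> x))) * complex_of_real (gaussian 1 (\<eta> - \<xi>))"
    unfolding wave_packet_def fourier_modulation
    by (subst fourier_translation) (auto simp: gaussian_fourier(2))
  also have "cis (- (2 * pi * ((\<eta> - \<xi>) \<bullet> x))) = cis (2 * pi * (\<xi> \<bullet> x)) * cis (2 * pi * ((- x) \<bullet> \<eta>))"
    by (simp add: cis_mult inner_diff_left inner_commute[of \<eta>] algebra_simps)
  finally show "fourier (wave_packet x \<xi>) \<eta> = cis (2 * pi * (\<xi> \<bullet> x)) * wave_packet \<xi> (- x) \<eta>"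
    by (simp add: wave_packet_def[of \<xi> "- x" \<eta>] mult_ac)
qed

text \<open>Inversion is needed for wave packets only, where it is explicit: two rotations give the
  point reflection and the two phases cancel.\<close>

lemma fourier_inversion_wave_packet: "fourier (fourier (wave_packet x \<xi>)) (- t) = wave_packet x \<xi> t"
proof -
  have "fourier (fourier (wave_packet x \<xi>)) (- t) = cis (2 * pi * (\<xi> \<bullet> x)) * fourier (wave_packet \<xi> (- x)) (- t)"
    unfolding fourier_wave_packet[of x \<xi>]
    by (simp add: fourier_def mult.assoc)
  also have "\<dots> = wave_packet x \<xi> t"
    unfolding fourier_wave_packet
    by (simp add: wave_packet_def cis_mult inner_commute[of x] gaussian_diff_commute[of _ x] mult.left_commute[of "cis _"] flip: mult.assoc)
  finally show ?thesis .
qed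

text \<open>Pairing with packets at position 0 computes the Fourier transform of \<open>r\<close>
  times a positive Gaussian. Only the weighted function is assumed integrable, so that
  \<open>r\<close> may be the difference of a square-integrable and a bounded function, as in
  \<open>plancherel\<close>.\<close>

lemma zero_of_gaussian_weight:
  fixes r :: "'a::euclidean_space \<Rightarrow> complex"
  assumes int: "integrable lborel (\<lambda>t. r t * complex_of_real (gaussian 1 t))"
    and zero: "\<And>\<xi>. (LINT t|lborel. r t * cnj (wave_packet 0 \<xi> t)) = 0"
  shows "AE t in lborel. r t = 0"
proof -
  have "fourier (\<lambda>t. r t * complex_of_real (gaussian 1 t)) \<xi> = 0" for \<xi>
    using zero[of \<xi>] by (simp add: fourier_def wave_packet_def cis_cnj mult.assoc)
  from fourier_unique[OF int this] show ?thesis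
    by eventually_elim (use gaussian_pos[of 1] in \<open>auto simp: less_le\<close>)
qed

lemma wave_packet_total:
  assumes "\<And>\<xi>. cinner f (abs_l2 (wave_packet 0 \<xi>)) = 0"
  shows "f = 0"
proof -
  have "AE t in lborel. rep_l2 f t = 0"
  proof (rule zero_of_gaussian_weight)
    show "integrable lborel (\<lambda>t. rep_l2 f t * complex_of_real (gaussian 1 t))"
      using square_integrable_mult_cnj[OF square_integrable_rep_l2 square_integrable_wave_packet, of f 0 0]
      by (simp add: wave_packet_def)
    show "(LINT t|lborel. rep_l2 f t * cnj (wave_packet 0 \<xi> t)) = 0" for \<xi>
      using assms[of \<xi>] by (simp add: cinner_abs_l2_right square_integrable_wave_packet)
  qed
  then show ?thesis
    by (rule l2_eq_zeroI)
qed

text \<open>Wave packets and their transforms have equal Gram matrices by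
  \<open>fourier_adjoint\<close> and explicit inversion, which yields \<open>F\<close>. That
  \<open>F\<close> extends \<open>fourier\<close> is checked by pairing with wave packets; square
  integrability of \<open>fourier f\<close> comes out of this comparison.\<close>

theorem plancherel:
  obtains F :: "'a::euclidean_space l2 \<Rightarrow> 'a l2" where
    "\<And>f g. cinner (F f) (F g) = cinner f g" "surj F"
    "\<And>f :: 'a \<Rightarrow> complex. integrable lborel f \<Longrightarrow> square_integrable f \<Longrightarrow> square_integrable (fourier f)"
    "\<And>f. integrable lborel f \<Longrightarrow> square_integrable f \<Longrightarrow> F (abs_l2 f) = abs_l2 (fourier f)"
proof -
  define b where "b = (\<lambda>(x, \<xi>). abs_l2 (wave_packet x \<xi> :: 'a \<Rightarrow> complex))"
  define c where "c = (\<lambda>(x, \<xi>). abs_l2 (fourier (wave_packet x \<xi>) :: 'a \<Rightarrow> complex))"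
  have sq_c: "square_integrable (fourier (wave_packet x \<xi>))" for x \<xi> :: 'a
    unfolding fourier_wave_packet by (intro square_integrable_cmult square_integrable_wave_packet)
  have int_c: "integrable lborel (fourier (wave_packet x \<xi>))" for x \<xi> :: 'a
    unfolding fourier_wave_packet by (intro integrable_mult_right integrable_wave_packet)
  have gram: "cinner (b i) (b j) = cinner (c i) (c j)" for i j
    proof -
      obtain x \<xi> y \<eta> where ij: "i = (x, \<xi>)" "j = (y, \<eta>)" by fastforce
      have "cinner (c i) (c j) = (LINT \<zeta>|lborel. fourier (wave_packet x \<xi>) \<zeta> * cnj (fourier (wave_packet y \<eta>) \<zeta>))"
        unfolding ij c_def by (simp add: cinner_abs_l2 sq_c)
      also have "\<dots> = (LINT t|lborel. wave_packet x \<xi> t * cnj (wave_packet y \<eta> t))"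
        by (subst fourier_adjoint[OF integrable_wave_packet int_c]) (simp only: fourier_inversion_wave_packet)
      also have "\<dots> = cinner (b i) (b j)"
        unfolding ij b_def by (simp add: cinner_abs_l2 square_integrable_wave_packet)
      finally show ?thesis ..
    qed
  have total_b: "f = 0" if "\<And>i. cinner f (b i) = 0" for f
    by (rule wave_packet_total) (use that[of "(0, _)"] in \<open>simp add: b_def\<close>)
  have total_c: "f = 0" if "\<And>i. cinner f (c i) = 0" for f
  proof (rule wave_packet_total)
      \<comment> \<open>The packet at \<open>(0, \<xi>)\<close> is exactly the transform of the
        packet at \<open>(- \<xi>, 0)\<close>, where the phase is 1.\<close>
      show "cinner f (abs_l2 (wave_packet 0 \<xi>)) = 0" for \<xi>
        using that[of "(- \<xi>, 0)"] by (simp add: c_def fourier_wave_packet)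
    qed
  obtain F where F: "\<And>f g. cinner (F f) (F g) = cinner f g" "surj F" "\<And>i. F (b i) = c i"
    using gram_isometry[of b c, OF gram total_b total_c] by blast
  have key: "AE t in lborel. rep_l2 (F (abs_l2 f)) t = fourier f t"
    if f: "integrable lborel f" and sq: "square_integrable f" for f
  proof -
    let ?r = "rep_l2 (F (abs_l2 f))"
    have [measurable]: "f \<in> borel_measurable borel" using f by auto
    have int_w: "integrable lborel (\<lambda>t. ?r t * cnj (wave_packet 0 \<xi> t))"
      "integrable lborel (\<lambda>t. fourier f t * cnj (wave_packet 0 \<xi> t))" for \<xi>
    proof -
      show "integrable lborel (\<lambda>t. ?r t * cnj (wave_packet 0 \<xi> t))"
        by (rule square_integrable_mult_cnj[OF square_integrable_rep_l2 square_integrable_wave_packet])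
      \<comment> \<open>Square integrability of \<open>fourier f\<close> is not yet known here; its
        boundedness suffices against an integrable packet.\<close>
      have "integrable lborel (\<lambda>t. cnj (wave_packet 0 \<xi> t) * fourier f t)"
        by (intro integrable_mult_bounded[OF _ _ norm_fourier_le] integrable_cnj integrable_wave_packet) simp
      then show "integrable lborel (\<lambda>t. fourier f t * cnj (wave_packet 0 \<xi> t))"
        by (simp add: mult.commute)
    qed
    have "AE t in lborel. ?r t - fourier f t = 0"
    proof (rule zero_of_gaussian_weight)
      show "integrable lborel (\<lambda>t. (?r t - fourier f t) * complex_of_real (gaussian 1 t))"
        using Bochner_Integration.integrable_diff[OF int_w[of 0]]
        by (simp add: wave_packet_def left_diff_distrib)
      show "(LINT t|lborel. (?r t - fourier f t) * cnj (wave_packet 0 \<xi> t)) = 0" for \<xi>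
      proof -
        have w: "wave_packet (- \<xi>) 0 t = fourier (wave_packet 0 \<xi>) (- t)" for t
          unfolding fourier_wave_packet
          using gaussian_minus[of 1 "- t - \<xi>"] by (simp add: wave_packet_def add.commute)
        have "(LINT t|lborel. ?r t * cnj (wave_packet 0 \<xi> t)) = cinner (F (abs_l2 f)) (abs_l2 (wave_packet 0 \<xi>))"
          by (simp add: cinner_abs_l2_right square_integrable_wave_packet)
        also have "abs_l2 (wave_packet 0 \<xi>) = F (abs_l2 (wave_packet (- \<xi>) 0))"
          using F(3)[of "(- \<xi>, 0)"] by (simp add: b_def c_def fourier_wave_packet)
        also have "cinner (F (abs_l2 f)) (F (abs_l2 (wave_packet (- \<xi>) 0))) = (LINT t|lborel. f t * cnj (wave_packet (- \<xi>) 0 t))"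
          by (simp add: F(1) cinner_abs_l2 sq square_integrable_wave_packet)
        also have "\<dots> = (LINT t|lborel. f t * cnj (fourier (wave_packet 0 \<xi>) (- t)))"
          by (simp only: w)
        also have "\<dots> = (LINT t|lborel. fourier f t * cnj (wave_packet 0 \<xi> t))"
          by (rule fourier_adjoint[symmetric, OF f integrable_wave_packet])
        finally show ?thesis
          using int_w[of \<xi>] by (simp add: left_diff_distrib)
      qed
    qed
    then show ?thesis by eventually_elim simp
  qed
  have sqF: "square_integrable (fourier f)"
    if "integrable lborel f" "square_integrable f" for f :: "'a \<Rightarrow> complex"
    using that borel_measurable_integrable[OF that(1)]
    by (intro square_integrable_cong_AE[OF square_integrable_rep_l2 _ key[OF that]]) simp
  have absF: "F (abs_l2 f) = abs_l2 (fourier f)"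
    if "integrable lborel f" "square_integrable f" for f
    using abs_l2_eq_iff[OF square_integrable_rep_l2 sqF[OF that]] key[OF that] by simp
  show thesis
    by (rule that[of F]) (simp_all add: F(1,2) sqF absF)
qed

lemma measurable_fst_borel [measurable]:
  "fst \<in> borel \<rightarrow>\<^sub>M (borel :: 'a::topological_space measure)"
  by (intro borel_measurable_continuous_onI continuous_on_fst continuous_on_id)

lemma measurable_snd_borel [measurable]:
  "snd \<in> borel \<rightarrow>\<^sub>M (borel :: 'a::topological_space measure)"
  by (intro borel_measurable_continuous_onI continuous_on_snd continuous_on_id)

lemma square_integrable_translate:
  assumes "square_integrable f"
  shows "square_integrable (\<lambda>t. f (t - x))"
  using square_integrable_shift[OF assms, of 0 x]
  by (simp only: inner_zero_left mult_zero_right cis_zero mult_1_left)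

subsection \<open>The short-time Fourier transform\<close>

lemma tf_shift_rep:
  "tf_shift (x, \<xi>) g = abs_l2 (\<lambda>t. cis (2 * pi * (\<xi> \<bullet> t)) * rep_l2 g (t - x))"
proof -
  have "tf_shift (x, \<xi>) (abs_l2 (rep_l2 g)) = abs_l2 (\<lambda>t. cis (2 * pi * (\<xi> \<bullet> t)) * rep_l2 g (t - x))"
    by (subst tf_shift.abs_eq) (auto simp: l2_eq_refl_iff square_integrable_rep_l2)
  then show ?thesis by simp
qed

lemma tf_shift_abs:
  assumes "square_integrable g"
  shows "tf_shift (x, \<xi>) (abs_l2 g) = abs_l2 (\<lambda>t. cis (2 * pi * (\<xi> \<bullet> t)) * g (t - x))"
  by (subst tf_shift.abs_eq) (auto simp: l2_eq_refl_iff assms)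

lemma cinner_tf_shift [simp]: "cinner (tf_shift z f) (tf_shift z g) = cinner f g"
proof (cases z)
  case (Pair x \<xi>)
  have c: "(cis \<theta> * a) * cnj (cis \<theta> * b) = a * cnj b" for \<theta> a b
  proof -
    have "(cis \<theta> * a) * cnj (cis \<theta> * b) = (cis \<theta> * cnj (cis \<theta>)) * (a * cnj b)"
      by simp
    then show ?thesis
      by (simp add: cis_cnj cis_mult)
  qed
  have "cinner (tf_shift z f) (tf_shift z g) = (LINT t|lborel. rep_l2 f (t - x) * cnj (rep_l2 g (t - x)))"
    unfolding Pair tf_shift_rep
    by (simp only: cinner_abs_l2 square_integrable_shift square_integrable_rep_l2 c)
  also have "\<dots> = cinner f g"
    unfolding cinner_rep_l2 by (rule lborel_integral_shift(2)) measurable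
  finally show ?thesis .
qed

lemma norm_tf_shift [simp]: "norm (tf_shift z f) = norm f"
  by (simp add: norm_l2_def)

text \<open>The Weyl form of the canonical commutation relations; the phase is the symplectic form
  of the two points.\<close>

lemma tf_shift_commute:
  "tf_shift (x, \<xi>) (tf_shift (u, \<eta>) f) =
    scaleC (cis (2 * pi * (\<xi> \<bullet> u - \<eta> \<bullet> x))) (tf_shift (u, \<eta>) (tf_shift (x, \<xi>) f))"
proof -
  have 1: "tf_shift (x, \<xi>) (tf_shift (u, \<eta>) f) =
      abs_l2 (\<lambda>t. cis (2 * pi * (\<xi> \<bullet> t)) * (cis (2 * pi * (\<eta> \<bullet> (t - x))) * rep_l2 f (t - x - u)))"
    unfolding tf_shift_rep[of u]
    by (rule tf_shift_abs) (intro square_integrable_shift square_integrable_rep_l2)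
  have 2: "tf_shift (u, \<eta>) (tf_shift (x, \<xi>) f) =
      abs_l2 (\<lambda>t. cis (2 * pi * (\<eta> \<bullet> t)) * (cis (2 * pi * (\<xi> \<bullet> (t - u))) * rep_l2 f (t - u - x)))"
    unfolding tf_shift_rep[of x]
    by (rule tf_shift_abs) (intro square_integrable_shift square_integrable_rep_l2)
  have 3: "(\<lambda>t. cis (2 * pi * (\<xi> \<bullet> t)) * (cis (2 * pi * (\<eta> \<bullet> (t - x))) * rep_l2 f (t - x - u))) =
      (\<lambda>t. cis (2 * pi * (\<xi> \<bullet> u - \<eta> \<bullet> x)) *
        (cis (2 * pi * (\<eta> \<bullet> t)) * (cis (2 * pi * (\<xi> \<bullet> (t - u))) * rep_l2 f (t - u - x))))"
  proof
    fix t
    have "2 * pi * (\<xi> \<bullet> t) + 2 * pi * (\<eta> \<bullet> (t - x)) =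
        2 * pi * (\<xi> \<bullet> u - \<eta> \<bullet> x) + (2 * pi * (\<eta> \<bullet> t) + 2 * pi * (\<xi> \<bullet> (t - u)))"
      by (simp add: inner_diff_right algebra_simps)
    moreover have "t - x - u = t - u - x"
      by simp
    ultimately show "cis (2 * pi * (\<xi> \<bullet> t)) * (cis (2 * pi * (\<eta> \<bullet> (t - x))) * rep_l2 f (t - x - u)) =
      cis (2 * pi * (\<xi> \<bullet> u - \<eta> \<bullet> x)) *
        (cis (2 * pi * (\<eta> \<bullet> t)) * (cis (2 * pi * (\<xi> \<bullet> (t - u))) * rep_l2 f (t - u - x)))"
      by (simp only: mult.assoc[symmetric] cis_mult)
  qed
  show ?thesis
    unfolding 1 2 3
    by (rule abs_l2_scaleC[symmetric]) (intro square_integrable_shift square_integrable_rep_l2)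
qed

text \<open>Commuting the shifts costs a symplectic phase, and unitarity removes the common shift.
  Multiplication by a character of phase space thus becomes a simultaneous shift of window and
  signal.\<close>

lemma stft_covariance:
  "stft (tf_shift (u, \<eta>) g) (tf_shift (u, \<eta>) f) (x, \<xi>) =
    cis (2 * pi * (\<eta> \<bullet> x - \<xi> \<bullet> u)) * stft g f (x, \<xi>)"
  unfolding stft_def tf_shift_commute[of x \<xi> u \<eta>]
  by (simp only: cinner_scaleC_right cis_cnj minus_mult_right minus_diff_eq cinner_tf_shift)

section \<open>Orthogonality relations for the short-time Fourier transform\<close>

lemma stft_fourier:
  "stft g f (x, \<xi>) = fourier (\<lambda>t. rep_l2 f t * cnj (rep_l2 g (t - x))) \<xi>"
  unfolding stft_def tf_shift_rep fourier_def
  by (subst cinner_abs_l2_right)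
    (intro square_integrable_shift square_integrable_rep_l2, simp add: cis_cnj mult_ac)

lemma stft_measurable [measurable]: "stft g f \<in> borel_measurable borel"
proof -
  have "(\<lambda>(z, t). rep_l2 f t * cnj (rep_l2 g (t - fst z)) * cis (- (2 * pi * (snd z \<bullet> t)))) \<in>
      borel_measurable (borel \<Otimes>\<^sub>M lborel)"
    by measurable
  from lborel.borel_measurable_lebesgue_integral[OF this]
  have "(\<lambda>z. LINT t|lborel. rep_l2 f t * cnj (rep_l2 g (t - fst z)) * cis (- (2 * pi * (snd z \<bullet> t)))) \<in>
      borel_measurable borel" .
  also have "(\<lambda>z. LINT t|lborel. rep_l2 f t * cnj (rep_l2 g (t - fst z)) * cis (- (2 * pi * (snd z \<bullet> t)))) =
      stft g f"
    by (auto simp: stft_fourier fourier_def fun_eq_iff)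
  finally show ?thesis .
qed

lemma norm_stft_le: "cmod (stft g f z) \<le> norm f * norm g"
  unfolding stft_def using cmod_cinner_le[of f "tf_shift z g"] by simp

text \<open>At fixed \<open>t\<close> the substitution of \<open>t - x\<close> for \<open>x\<close>
  decouples the two factors; Tonelli and Fubini do the rest.\<close>

lemma integrable_correlation:
  fixes F G :: "'a::euclidean_space \<Rightarrow> complex"
  assumes F: "integrable lborel F" and G: "integrable lborel G"
  shows "integrable (lborel \<Otimes>\<^sub>M lborel) (\<lambda>(x, t). F t * G (t - x))"
    and "(LINT x|lborel. LINT t|lborel. F t * G (t - x)) = (LINT t|lborel. F t) * (LINT t|lborel. G t)"
proof -
  have [measurable]: "F \<in> borel_measurable borel" "G \<in> borel_measurable borel"
    using F G by auto
  have nnG: "(\<integral>\<^sup>+x. ennreal (cmod (G (t - x))) \<partial>lborel) = ennreal (LINT x|lborel. cmod (G x))" for t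
    using lborel_integrable_shift(3)[OF integrable_norm[OF G], of t]
      lborel_integral_shift(3)[of "\<lambda>x. cmod (G x)" t]
    by (subst nn_integral_eq_integral) auto
  show int: "integrable (lborel \<Otimes>\<^sub>M lborel) (\<lambda>(x, t). F t * G (t - x))"
  proof (rule integrableI_bounded)
    show M: "(\<lambda>(x, t). F t * G (t - x)) \<in> borel_measurable (lborel \<Otimes>\<^sub>M lborel)"
      by measurable
    have "(\<integral>\<^sup>+z. ennreal (norm (case z of (x, t) \<Rightarrow> F t * G (t - x))) \<partial>(lborel \<Otimes>\<^sub>M lborel)) =
        (\<integral>\<^sup>+t. \<integral>\<^sup>+x. ennreal (norm (case (x, t) of (x, t) \<Rightarrow> F t * G (t - x))) \<partial>lborel \<partial>lborel)"
      by (subst lborel_pair.nn_integral_snd) auto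
    also have "\<dots> = (\<integral>\<^sup>+t. ennreal (cmod (F t)) * ennreal (LINT x|lborel. cmod (G x)) \<partial>lborel)"
      by (simp add: norm_mult ennreal_mult nn_integral_cmult nnG)
    also have "\<dots> < \<infinity>"
      using F by (auto simp: nn_integral_multc ennreal_mult_less_top integrable_iff_bounded)
    finally show "(\<integral>\<^sup>+z. ennreal (norm (case z of (x, t) \<Rightarrow> F t * G (t - x))) \<partial>(lborel \<Otimes>\<^sub>M lborel)) < \<infinity>" .
  qed
  have "(LINT x|lborel. LINT t|lborel. F t * G (t - x)) = (LINT t|lborel. LINT x|lborel. F t * G (t - x))"
    by (rule lborel_pair.Fubini_integral[OF int, symmetric])
  also have "\<dots> = (LINT t|lborel. F t * (LINT x|lborel. G x))"
    by (simp add: lborel_integral_shift(3))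
  also have "\<dots> = (LINT t|lborel. F t) * (LINT t|lborel. G t)"
    by (rule integral_mult_left_zero)
  finally show "(LINT x|lborel. LINT t|lborel. F t * G (t - x)) = (LINT t|lborel. F t) * (LINT t|lborel. G t)" .
qed

lemma plancherel_inner:
  fixes f g :: "'a::euclidean_space \<Rightarrow> complex"
  assumes f: "integrable lborel f" "square_integrable f" and g: "integrable lborel g" "square_integrable g"
  shows "square_integrable (fourier f)"
    and "(LINT \<xi>|lborel. fourier f \<xi> * cnj (fourier g \<xi>)) = (LINT t|lborel. f t * cnj (g t))"
proof -
  obtain F :: "'a l2 \<Rightarrow> 'a l2" where F: "\<And>f g. cinner (F f) (F g) = cinner f g" 
    "\<And>f :: 'a \<Rightarrow> complex. integrable lborel f \<Longrightarrow> square_integrable f \<Longrightarrow> square_integrable (fourier f)"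
    "\<And>f. integrable lborel f \<Longrightarrow> square_integrable f \<Longrightarrow> F (abs_l2 f) = abs_l2 (fourier f)"
    using plancherel by metis
  show "square_integrable (fourier f)" using f by (rule F(2))
  show "(LINT \<xi>|lborel. fourier f \<xi> * cnj (fourier g \<xi>)) = (LINT t|lborel. f t * cnj (g t))"
    using F(1)[of "abs_l2 f" "abs_l2 g"] by (simp add: F(2,3) f g cinner_abs_l2)
qed

text \<open>For every \<open>x\<close> the product is integrable, but Plancherel also asks for
  square integrability. This holds for almost every \<open>x\<close>, since the squared moduli are
  integrable jointly in \<open>x\<close> and \<open>t\<close>.\<close>

lemma square_integrable_tf_product:
  fixes f g :: "'a::euclidean_space l2"
  shows "AE x in lborel. square_integrable (\<lambda>t. rep_l2 f t * cnj (rep_l2 g (t - x)))"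
proof -
  have "integrable lborel (\<lambda>t. rep_l2 h t * cnj (rep_l2 h t))" for h :: "'a l2"
    by (intro square_integrable_mult_cnj square_integrable_rep_l2)
  from lborel_pair.AE_integrable_fst[OF integrable_correlation(1)[OF this this, of f g]]
  show ?thesis
  proof eventually_elim
    case (elim x)
    from integrable_norm[OF elim] show ?case
      by (simp add: square_integrable_def norm_mult power_mult_distrib power2_eq_square mult_ac)
  qed
qed

lemma integrable_tf_product:
  "integrable lborel (\<lambda>t. rep_l2 f t * cnj (rep_l2 g (t - x)))"
  by (intro square_integrable_mult_cnj square_integrable_translate square_integrable_rep_l2)

text \<open>At fixed \<open>x\<close> both transforms are Fourier transforms in
  \<open>\<xi>\<close>, so this is Plancherel at the almost all \<open>x\<close> where it
  applies.\<close>

lemma stft_slice: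
  fixes f\<^sub>1 f\<^sub>2 g\<^sub>1 g\<^sub>2 :: "'a::euclidean_space l2"
  shows "AE x in lborel. integrable lborel (\<lambda>\<xi>. stft g\<^sub>1 f\<^sub>1 (x, \<xi>) * cnj (stft g\<^sub>2 f\<^sub>2 (x, \<xi>))) \<and>
    (LINT \<xi>|lborel. stft g\<^sub>1 f\<^sub>1 (x, \<xi>) * cnj (stft g\<^sub>2 f\<^sub>2 (x, \<xi>))) =
    (LINT t|lborel. (rep_l2 f\<^sub>1 t * cnj (rep_l2 f\<^sub>2 t)) * (rep_l2 g\<^sub>2 (t - x) * cnj (rep_l2 g\<^sub>1 (t - x))))"
  using square_integrable_tf_product[of f\<^sub>1 g\<^sub>1] square_integrable_tf_product[of f\<^sub>2 g\<^sub>2]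
proof eventually_elim
  case (elim x)
  note P = plancherel_inner[OF integrable_tf_product elim(1) integrable_tf_product elim(2)]
  have "integrable lborel (\<lambda>\<xi>. stft g\<^sub>1 f\<^sub>1 (x, \<xi>) * cnj (stft g\<^sub>2 f\<^sub>2 (x, \<xi>)))"
    unfolding stft_fourier
    by (intro square_integrable_mult_cnj plancherel_inner(1)[OF integrable_tf_product elim(1) integrable_tf_product elim(1)]
        plancherel_inner(1)[OF integrable_tf_product elim(2) integrable_tf_product elim(2)])
  moreover have "(LINT \<xi>|lborel. stft g\<^sub>1 f\<^sub>1 (x, \<xi>) * cnj (stft g\<^sub>2 f\<^sub>2 (x, \<xi>))) =
      (LINT t|lborel. (rep_l2 f\<^sub>1 t * cnj (rep_l2 f\<^sub>2 t)) * (rep_l2 g\<^sub>2 (t - x) * cnj (rep_l2 g\<^sub>1 (t - x))))"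
    unfolding stft_fourier P(2) by (simp add: mult_ac)
  ultimately show ?case ..
qed

lemma square_integrable_stft:
  fixes f g :: "'a::euclidean_space l2"
  shows "square_integrable (stft g f)"
proof -
  let ?V = "stft g f"
  have int: "integrable lborel (\<lambda>t. rep_l2 h t * cnj (rep_l2 h t))" for h :: "'a l2"
    by (intro square_integrable_mult_cnj square_integrable_rep_l2)
  have "integrable (lborel \<Otimes>\<^sub>M lborel) (\<lambda>z. ?V z * cnj (?V z))"
  proof (rule lborel_pair.Fubini_integrable)
    show "(\<lambda>z. ?V z * cnj (?V z)) \<in> borel_measurable (lborel \<Otimes>\<^sub>M lborel)"
      unfolding lborel_prod by measurable
    show "AE x in lborel. integrable lborel (\<lambda>\<xi>. ?V (x, \<xi>) * cnj (?V (x, \<xi>)))"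
      using stft_slice[of g f g f] by eventually_elim simp
    have "integrable lborel (\<lambda>x. Re (LINT t|lborel. (rep_l2 f t * cnj (rep_l2 f t)) * (rep_l2 g (t - x) * cnj (rep_l2 g (t - x)))))"
      by (intro integrable_Re lborel_pair.integrable_fst integrable_correlation(1)[OF int int])
    moreover have "AE x in lborel. (LINT \<xi>|lborel. norm (?V (x, \<xi>) * cnj (?V (x, \<xi>)))) =
        Re (LINT t|lborel. (rep_l2 f t * cnj (rep_l2 f t)) * (rep_l2 g (t - x) * cnj (rep_l2 g (t - x))))"
      using stft_slice[of g f g f]
    proof eventually_elim
      case (elim x)
      \<comment> \<open>Lets the slice identity, stated for complex integrals, evaluate the integral
        of norms that Tonelli requires.\<close>
      have "norm (v * cnj v) = Re (v * cnj v)" for v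
        using cmod_power2[of v] by (simp add: norm_mult power2_eq_square)
      then have "(LINT \<xi>|lborel. norm (?V (x, \<xi>) * cnj (?V (x, \<xi>)))) = Re (LINT \<xi>|lborel. ?V (x, \<xi>) * cnj (?V (x, \<xi>)))"
        using elim by (simp only: integral_Re)
      then show ?case using elim by simp
    qed
    moreover have "(\<lambda>x. LINT \<xi>|lborel. norm (?V (x, \<xi>) * cnj (?V (x, \<xi>)))) \<in> borel_measurable lborel"
    proof -
      have "(\<lambda>(x, \<xi>). norm (?V (x, \<xi>) * cnj (?V (x, \<xi>)))) \<in> borel_measurable (lborel \<Otimes>\<^sub>M lborel)"
        unfolding lborel_prod by measurable
      from lborel.borel_measurable_lebesgue_integral[OF this] show ?thesis by simp
    qed
    ultimately show "integrable lborel (\<lambda>x. LINT \<xi>|lborel. norm (?V (x, \<xi>) * cnj (?V (x, \<xi>))))"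
      by (subst integrable_cong_AE[where g = "\<lambda>x. Re (LINT t|lborel. (rep_l2 f t * cnj (rep_l2 f t)) * (rep_l2 g (t - x) * cnj (rep_l2 g (t - x))))"]) auto
  qed
  then have "integrable lborel (\<lambda>z. norm (?V z * cnj (?V z)))"
    unfolding lborel_prod by (rule integrable_norm)
  then show ?thesis
    by (simp add: square_integrable_def norm_mult power2_eq_square)
qed

text \<open>Plancherel in frequency on almost every slice leaves an integral of correlation type
  over position and time, which factors.\<close>

theorem moyal:
  fixes f\<^sub>1 f\<^sub>2 g\<^sub>1 g\<^sub>2 :: "'a::euclidean_space l2"
  shows "(LINT z|lborel. stft g\<^sub>1 f\<^sub>1 z * cnj (stft g\<^sub>2 f\<^sub>2 z)) = cinner f\<^sub>1 f\<^sub>2 * cnj (cinner g\<^sub>1 g\<^sub>2)"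
proof -
  let ?F = "\<lambda>t. rep_l2 f\<^sub>1 t * cnj (rep_l2 f\<^sub>2 t)" and ?G = "\<lambda>t. rep_l2 g\<^sub>2 t * cnj (rep_l2 g\<^sub>1 t)"
  have F: "integrable lborel ?F" and G: "integrable lborel ?G"
    by (intro square_integrable_mult_cnj square_integrable_rep_l2)+
  have int: "integrable (lborel \<Otimes>\<^sub>M lborel) (\<lambda>z. stft g\<^sub>1 f\<^sub>1 z * cnj (stft g\<^sub>2 f\<^sub>2 z))"
    unfolding lborel_prod by (intro square_integrable_mult_cnj square_integrable_stft)
  have "(LINT z|lborel. stft g\<^sub>1 f\<^sub>1 z * cnj (stft g\<^sub>2 f\<^sub>2 z)) =
      (LINT x|lborel. LINT \<xi>|lborel. stft g\<^sub>1 f\<^sub>1 (x, \<xi>) * cnj (stft g\<^sub>2 f\<^sub>2 (x, \<xi>)))"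
    using lborel_pair.integral_fst'[OF int] by (simp add: lborel_prod)
  also have "\<dots> = (LINT x|lborel. LINT t|lborel. ?F t * ?G (t - x))"
  proof (rule integral_cong_AE)
    show "(\<lambda>x. LINT \<xi>|lborel. stft g\<^sub>1 f\<^sub>1 (x, \<xi>) * cnj (stft g\<^sub>2 f\<^sub>2 (x, \<xi>))) \<in> borel_measurable lborel"
      by (rule borel_measurable_integrable[OF lborel_pair.integrable_fst'[OF int]])
    show "(\<lambda>x. LINT t|lborel. ?F t * ?G (t - x)) \<in> borel_measurable lborel"
      by (rule borel_measurable_integrable[OF lborel_pair.integrable_fst[OF integrable_correlation(1)[OF F G]]])
    show "AE x in lborel. (LINT \<xi>|lborel. stft g\<^sub>1 f\<^sub>1 (x, \<xi>) * cnj (stft g\<^sub>2 f\<^sub>2 (x, \<xi>))) =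
        (LINT t|lborel. ?F t * ?G (t - x))"
      using stft_slice[of g\<^sub>1 f\<^sub>1 g\<^sub>2 f\<^sub>2] by eventually_elim simp
  qed
  also have "\<dots> = (LINT t|lborel. ?F t) * (LINT t|lborel. ?G t)"
    by (rule integrable_correlation(2)[OF F G])
  also have "(LINT t|lborel. ?G t) = cnj (cinner g\<^sub>1 g\<^sub>2)"
    unfolding cinner_commute[of g\<^sub>2 g\<^sub>1, symmetric] by (simp add: cinner_rep_l2)
  finally show ?thesis
    by (simp add: cinner_rep_l2)
qed

text \<open>A Gaussian times its translate by \<open>x\<close> is, by completing the square, a
  positive multiple of a Gaussian centred at the midpoint. Its Fourier transform is again a Gaussian
  up to nonzero factors.\<close>

lemma stft_gaussian_nonzero:
  fixes z :: "'a::euclidean_space \<times> 'a"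
  defines "\<gamma> \<equiv> abs_l2 (wave_packet 0 0 :: 'a \<Rightarrow> complex)"
  shows "stft \<gamma> \<gamma> z \<noteq> 0"
proof (cases z)
  case (Pair x \<xi>)
  let ?g = "\<lambda>t :: 'a. complex_of_real (gaussian 2 t)"
  let ?m = "(1/2) *\<^sub>R x"
  have "(norm t)\<^sup>2 + (norm (t - x))\<^sup>2 = 2 * (norm (t - ?m))\<^sup>2 + (norm x)\<^sup>2 / 2" for t :: 'a
    by (simp add: power2_norm_eq_inner algebra_simps inner_commute)
  then have prod: "gaussian 1 t * gaussian 1 (t - x) = gaussian (1/2) x * gaussian 2 (t - ?m)" for t
    unfolding gaussian_def exp_add[symmetric] by (simp add: algebra_simps flip: distrib_left)
  have "stft \<gamma> \<gamma> z = (LINT t|lborel. wave_packet 0 0 t * cnj (cis (2 * pi * (\<xi> \<bullet> t)) * wave_packet 0 0 (t - x)))"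
    unfolding stft_def Pair \<gamma>_def
    by (simp add: tf_shift_abs square_integrable_wave_packet cinner_abs_l2 square_integrable_shift)
  also have "\<dots> = (LINT t|lborel. complex_of_real (gaussian (1/2) x) * (?g (t - ?m) * cis (- (2 * pi * (\<xi> \<bullet> t)))))"
  proof (intro Bochner_Integration.integral_cong refl)
    fix t
    have "wave_packet 0 0 t * cnj (cis (2 * pi * (\<xi> \<bullet> t)) * wave_packet 0 0 (t - x)) =
        complex_of_real (gaussian 1 t * gaussian 1 (t - x)) * cis (- (2 * pi * (\<xi> \<bullet> t)))"
      by (simp add: wave_packet_def cis_cnj)
    then show "wave_packet 0 0 t * cnj (cis (2 * pi * (\<xi> \<bullet> t)) * wave_packet 0 0 (t - x)) =
        complex_of_real (gaussian (1/2) x) * (?g (t - ?m) * cis (- (2 * pi * (\<xi> \<bullet> t))))"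
      unfolding prod by simp
  qed
  also have "\<dots> = complex_of_real (gaussian (1/2) x) * fourier (\<lambda>t. ?g (t - ?m)) \<xi>"
    unfolding fourier_def by (rule integral_mult_right_zero)
  also have "\<dots> = complex_of_real (gaussian (1/2) x) * (cis (- (2 * pi * (\<xi> \<bullet> ?m))) * fourier ?g \<xi>)"
    by (subst fourier_translation) auto
  also have "\<dots> \<noteq> 0"
    using gaussian_pos[of "1/2" x] gaussian_pos[of "1/2" \<xi>] by (simp add: gaussian_fourier(2) less_le)
  finally show ?thesis .
qed

subsection \<open>The Fourier--Wigner transform\<close>

text \<open>The rotation relates the symplectic Fourier transform to the ordinary one.\<close>

definition rot :: "'a::euclidean_space \<times> 'a \<Rightarrow> 'a \<times> 'a" where
  "rot z = (- snd z, fst z)"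

lemma rot_measurable [measurable]: "rot \<in> borel \<rightarrow>\<^sub>M (borel :: ('a::euclidean_space \<times> 'a) measure)"
  unfolding rot_def[abs_def] by (intro borel_measurable_continuous_onI continuous_intros)

lemma rot_4 [simp]: "rot (rot (rot (rot z))) = z"
  by (simp add: rot_def)

text \<open>By Tonelli \<open>rot\<close> splits into an exchange of the two factors and a
  reflection of one of them, each preserving the measure.\<close>

lemma distr_rot: "distr lborel borel rot = (lborel :: ('a::euclidean_space \<times> 'a) measure)"
proof (rule measure_eqI)
  fix A :: "('a \<times> 'a) set" assume "A \<in> sets (distr lborel borel rot)"
  then have A [measurable]: "A \<in> sets borel" by simp
  have reflect: "(\<integral>\<^sup>+b. h (- b) \<partial>lborel) = (\<integral>\<^sup>+b. h b \<partial>lborel)"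
    if [measurable]: "h \<in> borel_measurable borel" for h :: "'a \<Rightarrow> ennreal"
    by (subst (2) lborel_affine[of "-1" 0]) (auto simp: nn_integral_density nn_integral_distr)
  have M: "(indicator A :: _ \<Rightarrow> ennreal) \<in> borel_measurable (lborel \<Otimes>\<^sub>M lborel)"
    "(\<lambda>z. indicator A (rot z) :: ennreal) \<in> borel_measurable (lborel \<Otimes>\<^sub>M lborel)"
    unfolding lborel_prod by measurable
  have slice: "(\<lambda>b. indicator A (b, a) :: ennreal) \<in> borel_measurable borel" for a
  proof -
    have "(\<lambda>b. (b, a)) \<in> borel \<rightarrow>\<^sub>M (borel :: ('a \<times> 'a) measure)"
      by (intro borel_measurable_continuous_onI continuous_intros)
    then show ?thesis by measurable
  qed
  have "emeasure (distr lborel borel rot) A = (\<integral>\<^sup>+z. indicator A (rot z) \<partial>lborel)"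
    by (simp add: nn_integral_distr flip: nn_integral_indicator)
  also have "\<dots> = (\<integral>\<^sup>+a. \<integral>\<^sup>+b. indicator A (- b, a) \<partial>lborel \<partial>lborel)"
    unfolding lborel_prod[symmetric] by (subst lborel.nn_integral_fst[OF M(2), symmetric]) (simp add: rot_def)
  also have "\<dots> = (\<integral>\<^sup>+a. \<integral>\<^sup>+b. indicator A (b, a) \<partial>lborel \<partial>lborel)"
    by (subst reflect[OF slice]) (rule refl)
  also have "\<dots> = emeasure lborel A"
    by (subst lborel_pair.nn_integral_snd[OF M(1)]) (simp add: lborel_prod)
  finally show "emeasure (distr lborel borel rot) A = emeasure lborel A" .
qed simp

lemma integral_rot:
  fixes h :: "'a::euclidean_space \<times> 'a \<Rightarrow> 'b::{banach, second_countable_topology}"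
  assumes "h \<in> borel_measurable borel"
  shows "(LINT z|lborel. h (rot z)) = (LINT z|lborel. h z)"
  using integral_distr[of rot lborel borel h] assms by (simp add: distr_rot)

lemma square_integrable_rot:
  assumes "square_integrable f"
  shows "square_integrable (\<lambda>z. f (rot z))"
proof -
  have [measurable]: "f \<in> borel_measurable borel"
    by (rule square_integrable_measurable[OF assms])
  have "integrable (distr lborel borel rot) (\<lambda>z. (cmod (f z))\<^sup>2)"
    using assms by (simp add: distr_rot square_integrable_def)
  then show ?thesis
    by (simp add: square_integrable_def integrable_distr_eq)
qed

text \<open>As \<open>rot\<close> has order four, its inverse is its third power, so the converse
  follows from three further applications of one direction.\<close>

lemma AE_rot: "(AE z in lborel. P (rot z)) \<longleftrightarrow> (AE z in lborel. P z)"
proof -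
  have *: "AE z in lborel. Q (rot z)" if "AE z in lborel. Q z" for Q :: "'a \<times> 'a \<Rightarrow> bool"
    by (rule AE_distrD[of rot lborel borel]) (simp, unfold distr_rot, rule that)
  show ?thesis
  proof
    assume "AE z in lborel. P (rot z)"
    from *[OF *[OF *[OF this]]] show "AE z in lborel. P z"
      by (simp only: rot_4)
  qed (rule *)
qed

text \<open>The integral kernel of the rank-one operator sending \<open>h\<close> to
  \<open>scaleC (cinner h f) g\<close>, as \<open>kernel_op_tensor\<close> confirms; hence the
  conjugate on \<open>f\<close>.\<close>

definition tensor :: "'a::euclidean_space l2 \<Rightarrow> 'a l2 \<Rightarrow> ('a \<times> 'a) l2" where
  "tensor g f = abs_l2 (\<lambda>(s, t). rep_l2 g s * cnj (rep_l2 f t))"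

lemma integral_tensor:
  fixes F G :: "'a::euclidean_space \<Rightarrow> complex"
  assumes F: "integrable lborel F" and G: "integrable lborel G"
  shows "(LINT z|lborel. F (fst z) * G (snd z)) = (LINT t|lborel. F t) * (LINT t|lborel. G t)"
proof -
  have "(LINT z|lborel. F (fst z) * G (snd z)) = (LINT s|lborel. LINT t|lborel. F s * G t)"
    using lborel_pair.integral_fst[OF integrable_tensor[OF F G]] by (simp add: lborel_prod case_prod_beta')
  also have "\<dots> = (LINT s|lborel. F s * (LINT t|lborel. G t))"
    by simp
  also have "\<dots> = (LINT t|lborel. F t) * (LINT t|lborel. G t)"
    by (rule integral_mult_left_zero)
  finally show ?thesis .
qed

lemma square_integrable_tensor:
  fixes f g :: "'a::euclidean_space \<Rightarrow> complex"
  assumes g: "square_integrable g" and f: "square_integrable f"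
  shows "square_integrable (\<lambda>(s, t). g s * cnj (f t))"
proof -
  have [measurable]: "f \<in> borel_measurable borel" "g \<in> borel_measurable borel"
    using f g by (auto intro: square_integrable_measurable)
  have "(\<lambda>z. g (fst z) * cnj (f (snd z))) \<in> borel_measurable borel"
    by measurable
  moreover have "integrable (lborel \<Otimes>\<^sub>M lborel) (\<lambda>(s, t). (cmod (g s))\<^sup>2 * (cmod (f t))\<^sup>2)"
    by (rule integrable_tensor) (use f g in \<open>auto simp: square_integrable_def\<close>)
  ultimately show ?thesis
    by (simp add: square_integrable_def lborel_prod case_prod_beta' norm_mult power_mult_distrib)
qed

lemma cinner_tensor: "cinner (tensor g f) (tensor g' f') = cinner g g' * cnj (cinner f f')"
proof -
  have "cinner (tensor g f) (tensor g' f') =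
      (LINT z|lborel. (rep_l2 g (fst z) * cnj (rep_l2 g' (fst z))) * (rep_l2 f' (snd z) * cnj (rep_l2 f (snd z))))"
    unfolding tensor_def
    by (subst cinner_abs_l2[OF square_integrable_tensor square_integrable_tensor])
      (auto intro: square_integrable_rep_l2 simp: case_prod_beta' mult_ac)
  also have "\<dots> = cinner g g' * cinner f' f"
    unfolding cinner_rep_l2
    by (rule integral_tensor) (intro square_integrable_mult_cnj square_integrable_rep_l2)+
  finally show ?thesis
    by (simp only: cinner_commute[of f' f])
qed

lemma tensor_abs:
  fixes f g :: "'a::euclidean_space \<Rightarrow> complex"
  assumes g: "square_integrable g" and f: "square_integrable f"
  shows "tensor (abs_l2 g) (abs_l2 f) = abs_l2 (\<lambda>(s, t). g s * cnj (f t))"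
proof -
  let ?g = "rep_l2 (abs_l2 g)" and ?f = "rep_l2 (abs_l2 f)"
  have [measurable]: "f \<in> borel_measurable borel" "g \<in> borel_measurable borel"
    using f g by (auto intro: square_integrable_measurable)
  let ?P = "\<lambda>z. ?g (fst z) * cnj (?f (snd z)) = g (fst z) * cnj (f (snd z))"
  have "AE s in lborel. AE t in lborel. ?P (s, t)"
    using rep_abs_l2[OF g]
  proof eventually_elim
    case (elim s)
    show ?case using rep_abs_l2[OF f] by eventually_elim (simp add: elim)
  qed
  moreover have "{z \<in> space (lborel \<Otimes>\<^sub>M lborel). ?P z} \<in> sets (lborel \<Otimes>\<^sub>M lborel)"
    unfolding lborel_prod by measurable
  ultimately have "AE z in lborel \<Otimes>\<^sub>M lborel. ?P z"
    by (intro lborel_pair.AE_pair_measure)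
  then have "AE z in lborel. ?P z"
    by (simp only: lborel_prod)
  then show ?thesis
    unfolding tensor_def
      abs_l2_eq_iff[OF square_integrable_tensor[OF square_integrable_rep_l2 square_integrable_rep_l2]
        square_integrable_tensor[OF g f]]
    by (simp add: case_prod_beta')
qed

section \<open>Total families: boxes, elementary tensors, short-time Fourier transforms\<close>

lemma square_integrable_indicator_box: "square_integrable (indicator (box a b) :: 'a::euclidean_space \<Rightarrow> complex)"
proof -
  have "integrable lborel (\<lambda>x. indicator (box a b) x :: real)"
    by (intro integrable_real_indicator) (auto simp: emeasure_lborel_box_eq)
  moreover have "(cmod (indicator (box a b) x))\<^sup>2 = indicator (box a b) x" for x :: 'a
    by (simp add: indicator_def)
  ultimately show ?thesis
    by (simp add: square_integrable_def)
qed

text \<open>\<open>K\<close> itself need not be integrable, so it is first cut down to cubes.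
  Intersecting a box with a cube gives a box again, and countably many cubes exhaust the
  space.\<close>

lemma box_total:
  fixes K :: "'a::euclidean_space l2"
  assumes zero: "\<And>a b. cinner K (abs_l2 (indicator (box a b))) = 0"
  shows "K = 0"
proof -
  have zero': "(LINT x|lborel. rep_l2 K x * cnj (indicator (box a b) x)) = 0" for a b
    using zero[of a b] by (simp only: cinner_abs_l2_right square_integrable_indicator_box)
  let ?B = "\<lambda>n. box (- real n *\<^sub>R One) (real n *\<^sub>R One) :: 'a set"
  have "AE x in lborel. rep_l2 K x * cnj (indicator (?B n) x) = 0" for n
  proof (rule AE_zero_of_box_integrals)
    show "integrable lborel (\<lambda>x. rep_l2 K x * cnj (indicator (?B n) x))"
      by (intro square_integrable_mult_cnj square_integrable_rep_l2 square_integrable_indicator_box)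
    fix a b :: 'a
    obtain c d where cd: "box a b \<inter> ?B n = box c d"
      unfolding box_Int_box by blast
    have "indicator (box a b) x * (rep_l2 K x * cnj (indicator (?B n) x)) = rep_l2 K x * cnj (indicator (box c d) x)" for x
      unfolding cd[symmetric] by (simp add: indicator_def)
    then show "(LINT x|lborel. indicator (box a b) x * (rep_l2 K x * cnj (indicator (?B n) x))) = 0"
      by (simp only: zero')
  qed
  then have "AE x in lborel. \<forall>n. rep_l2 K x * cnj (indicator (?B n) x) = 0"
    unfolding AE_all_countable by (rule allI)
  then have "AE x in lborel. rep_l2 K x = 0"
  proof eventually_elim
    case (elim x)
    obtain n where n: "norm x < real n"
      using reals_Archimedean2 by blast
    have "\<bar>x \<bullet> b\<bar> < real n" if "b \<in> Basis" for b
      using Basis_le_norm[OF that, of x] n by linarith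
    then have "x \<in> ?B n" by (auto simp: mem_box abs_less_iff minus_less_iff)
    then show ?case using elim[rule_format, of n] by simp
  qed
  then show ?thesis
    by (rule l2_eq_zeroI)
qed

text \<open>A box in the product space is a product of boxes, so its indicator is an elementary
  tensor.\<close>

lemma tensor_total:
  fixes K :: "('a::euclidean_space \<times> 'a) l2"
  assumes zero: "\<And>g f. cinner K (tensor g f) = 0"
  shows "K = 0"
proof (rule box_total)
  fix p q :: "'a \<times> 'a"
  obtain a c b d where pq: "p = (a, c)" "q = (b, d)" by fastforce
  have "box p q = box a b \<times> box c d"
    unfolding pq by (auto simp: box_def Basis_prod_def ball_Un)
  then have "(indicator (box p q) :: _ \<Rightarrow> complex) = (\<lambda>(s, t). indicator (box a b) s * cnj (indicator (box c d) t))"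
    by (auto simp: fun_eq_iff indicator_def)
  then have "abs_l2 (indicator (box p q)) = tensor (abs_l2 (indicator (box a b))) (abs_l2 (indicator (box c d)))"
    by (subst tensor_abs[OF square_integrable_indicator_box square_integrable_indicator_box])
      (rule arg_cong[of _ _ abs_l2], assumption)
  then show "cinner K (abs_l2 (indicator (box p q))) = 0"
    by (simp only: zero)
qed

text \<open>Testing against a Gaussian transformed with the same Gaussian, both shifted by one
  phase-space point, gives by covariance a Fourier coefficient of \<open>H\<close> times a fixed
  function. Uniqueness kills the product, and the fixed function vanishes nowhere.\<close>

lemma fourier_wigner_total:
  fixes H :: "('a::euclidean_space \<times> 'a) l2"
  assumes zero: "\<And>g f. cinner H (abs_l2 (\<lambda>\<zeta>. stft f g (rot \<zeta>))) = 0"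
  shows "H = 0"
proof -
  define \<gamma> where "\<gamma> = abs_l2 (wave_packet 0 0 :: 'a \<Rightarrow> complex)"
  let ?V = "\<lambda>\<zeta>. stft \<gamma> \<gamma> (rot \<zeta>)"
  have sq: "square_integrable (\<lambda>\<zeta>. stft f g (rot \<zeta>))" for f g :: "'a l2"
    by (intro square_integrable_rot square_integrable_stft)
  have "AE \<zeta> in lborel. rep_l2 H \<zeta> * cnj (?V \<zeta>) = 0"
  proof (rule fourier_unique)
    show "integrable lborel (\<lambda>\<zeta>. rep_l2 H \<zeta> * cnj (?V \<zeta>))"
      by (intro square_integrable_mult_cnj square_integrable_rep_l2 sq)
    fix w :: "'a \<times> 'a"
    obtain u \<eta> where w: "w = (u, \<eta>)" by fastforce
    \<comment> \<open>The signs compensate those in \<open>rot\<close> and in the symplectic form,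
      leaving the ordinary phase \<open>w \<bullet> \<zeta>\<close>.\<close>
    let ?\<gamma> = "tf_shift (- u, - \<eta>) \<gamma>"
    have "rep_l2 H \<zeta> * cnj (stft ?\<gamma> ?\<gamma> (rot \<zeta>)) = rep_l2 H \<zeta> * cnj (?V \<zeta>) * cis (- (2 * pi * (w \<bullet> \<zeta>)))" for \<zeta>
    proof -
      have "(- \<eta>) \<bullet> (- snd \<zeta>) - fst \<zeta> \<bullet> (- u) = w \<bullet> \<zeta>"
        by (cases \<zeta>) (simp add: w inner_commute)
      then have "stft ?\<gamma> ?\<gamma> (rot \<zeta>) = cis (2 * pi * (w \<bullet> \<zeta>)) * ?V \<zeta>"
        unfolding rot_def stft_covariance by simp
      then show ?thesis
        by (simp add: cis_cnj mult_ac)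
    qed
    moreover have "(LINT \<zeta>|lborel. rep_l2 H \<zeta> * cnj (stft ?\<gamma> ?\<gamma> (rot \<zeta>))) = 0"
      using zero[of ?\<gamma> ?\<gamma>] by (simp add: cinner_abs_l2_right sq)
    ultimately show "fourier (\<lambda>\<zeta>. rep_l2 H \<zeta> * cnj (?V \<zeta>)) w = 0"
      unfolding fourier_def by (simp only:)
  qed
  then have "AE \<zeta> in lborel. rep_l2 H \<zeta> = 0"
    by eventually_elim (simp add: \<gamma>_def stft_gaussian_nonzero)
  then show ?thesis
    by (rule l2_eq_zeroI)
qed

text \<open>The Gram matrices agree by \<open>moyal\<close>, as \<open>rot\<close> preserves the
  measure. Building \<open>rot\<close> in here makes the variable match that of the ordinary Fourier
  transform in \<open>fourier_stft_product\<close>.\<close>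

theorem fourier_wigner:
  obtains \<Theta> :: "('a::euclidean_space \<times> 'a) l2 \<Rightarrow> ('a \<times> 'a) l2" where
    "\<And>K L. cinner (\<Theta> K) (\<Theta> L) = cinner K L" "surj \<Theta>"
    "\<And>g f. \<Theta> (tensor g f) = abs_l2 (\<lambda>\<zeta>. stft f g (rot \<zeta>))"
proof -
  define b where "b = (\<lambda>(g, f :: 'a l2). tensor g f)"
  define c where "c = (\<lambda>(g :: 'a l2, f). abs_l2 (\<lambda>\<zeta>. stft f g (rot \<zeta>)))"
  have sq: "square_integrable (\<lambda>\<zeta>. stft f g (rot \<zeta>))" for f g :: "'a l2"
    by (intro square_integrable_rot square_integrable_stft)
  have gram: "cinner (b i) (b j) = cinner (c i) (c j)" for i j
  proof -
    obtain g f g' f' where ij: "i = (g, f)" "j = (g', f')" by fastforce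
    have "cinner (c i) (c j) = (LINT \<zeta>|lborel. stft f g (rot \<zeta>) * cnj (stft f' g' (rot \<zeta>)))"
      by (simp add: ij c_def cinner_abs_l2 sq)
    also have "\<dots> = (LINT z|lborel. stft f g z * cnj (stft f' g' z))"
      by (rule integral_rot) measurable
    also have "\<dots> = cinner (b i) (b j)"
      by (simp add: moyal ij b_def cinner_tensor)
    finally show ?thesis ..
  qed
  have total_b: "K = 0" if "\<And>i. cinner K (b i) = 0" for K
    by (rule tensor_total) (use that[of "(_, _)"] in \<open>simp add: b_def\<close>)
  have total_c: "H = 0" if "\<And>i. cinner H (c i) = 0" for H
    by (rule fourier_wigner_total) (use that[of "(_, _)"] in \<open>simp add: c_def\<close>)
  obtain \<Theta> where \<Theta>: "\<And>K L. cinner (\<Theta> K) (\<Theta> L) = cinner K L" "surj \<Theta>" "\<And>i. \<Theta> (b i) = c i"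
    using gram_isometry[of b c, OF gram total_b total_c] by blast
  have "\<Theta> (tensor g f) = abs_l2 (\<lambda>\<zeta>. stft f g (rot \<zeta>))" for g f
    using \<Theta>(3)[of "(g, f)"] by (simp add: b_def c_def)
  then show thesis
    by (rule that[OF \<Theta>(1,2)])
qed

text \<open>Modulating \<open>stft \<phi>\<^sub>1 f\<close> amounts to a time-frequency shift of both \<open>\<phi>\<^sub>1\<close> and \<open>f\<close>, so the
  orthogonality relations evaluate the transform.\<close>

lemma fourier_stft_product:
  "fourier (\<lambda>z. stft \<phi>\<^sub>2 g z * cnj (stft \<phi>\<^sub>1 f z)) \<zeta> = stft f g (rot \<zeta>) * cnj (stft \<phi>\<^sub>1 \<phi>\<^sub>2 (rot \<zeta>))"
proof -
  let ?w = "rot \<zeta>"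
  have "stft \<phi>\<^sub>2 g z * cnj (stft \<phi>\<^sub>1 f z) * cis (- (2 * pi * (\<zeta> \<bullet> z))) =
      stft \<phi>\<^sub>2 g z * cnj (stft (tf_shift ?w \<phi>\<^sub>1) (tf_shift ?w f) z)" for z
  proof -
    obtain x \<xi> where z: "z = (x, \<xi>)" by fastforce
    have "fst \<zeta> \<bullet> x - \<xi> \<bullet> (- snd \<zeta>) = \<zeta> \<bullet> z"
      by (cases \<zeta>) (simp add: z inner_commute)
    then have "stft (tf_shift ?w \<phi>\<^sub>1) (tf_shift ?w f) z = cis (2 * pi * (\<zeta> \<bullet> z)) * stft \<phi>\<^sub>1 f z"
      unfolding rot_def z stft_covariance by simp
    then show ?thesis
      by (simp add: cis_cnj mult_ac)
  qed
  then have "fourier (\<lambda>z. stft \<phi>\<^sub>2 g z * cnj (stft \<phi>\<^sub>1 f z)) \<zeta> =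
      cinner g (tf_shift ?w f) * cnj (cinner \<phi>\<^sub>2 (tf_shift ?w \<phi>\<^sub>1))"
    unfolding fourier_def by (simp only: moyal)
  then show ?thesis
    by (simp only: stft_def)
qed

lemma stft_product_integrable:
  shows "integrable lborel (\<lambda>z. stft \<phi>\<^sub>2 g z * cnj (stft \<phi>\<^sub>1 f z))"
    and "square_integrable (\<lambda>z. stft \<phi>\<^sub>2 g z * cnj (stft \<phi>\<^sub>1 f z))"
proof -
  show int: "integrable lborel (\<lambda>z. stft \<phi>\<^sub>2 g z * cnj (stft \<phi>\<^sub>1 f z))"
    by (intro square_integrable_mult_cnj square_integrable_stft)
  show "square_integrable (\<lambda>z. stft \<phi>\<^sub>2 g z * cnj (stft \<phi>\<^sub>1 f z))"
  proof (rule square_integrable_bounded[OF int])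
    fix z
    show "cmod (stft \<phi>\<^sub>2 g z * cnj (stft \<phi>\<^sub>1 f z)) \<le> (norm g * norm \<phi>\<^sub>2) * (norm f * norm \<phi>\<^sub>1)"
      unfolding norm_mult complex_mod_cnj by (intro mult_mono norm_stft_le) auto
  qed
qed

subsection \<open>Orthonormal bases\<close>

lemma orthonormal_basisD:
  assumes "orthonormal_basis E"
  shows "e \<in> E \<Longrightarrow> e' \<in> E \<Longrightarrow> cinner e e' = (if e = e' then 1 else 0)"
    and "(\<And>e. e \<in> E \<Longrightarrow> cinner f e = 0) \<Longrightarrow> f = 0"
  using assms unfolding orthonormal_basis_def by blast+

text \<open>Bessel's inequality: \<open>cinner f (P f)\<close> equals the squared norm of
  \<open>P f\<close>, so Cauchy-Schwarz bounds the projection.\<close>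

lemma orthonormal_partial_sum:
  assumes E: "orthonormal_basis E" and F: "finite F" "F \<subseteq> E"
  defines "P \<equiv> \<lambda>f. \<Sum>e\<in>F. scaleC (cinner f e) e"
  shows "(norm (P f))\<^sup>2 = (\<Sum>e\<in>F. (cmod (cinner f e))\<^sup>2)" and "norm (P f) \<le> norm f"
proof -
  have c: "cinner (P f) e = cinner f e" if "e \<in> F" for e
  proof -
    have "cinner (P f) e = (\<Sum>e'\<in>F. cinner f e' * (if e' = e then 1 else 0))"
      unfolding P_def cinner_sum_left cinner_scaleC_left
      by (intro sum.cong refl arg_cong2[of _ _ _ _ "(*)"] orthonormal_basisD(1)[OF E])
        (use F that in auto)
    also have "\<dots> = (\<Sum>e'\<in>F. if e' = e then cinner f e' else 0)"
      by (intro sum.cong) auto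
    finally show ?thesis using F(1) that by simp
  qed
  have sq: "cinner g (P f) = (\<Sum>e\<in>F. cnj (cinner f e) * cinner g e)" for g
    unfolding P_def cinner_sum_right cinner_scaleC_right ..
  have "complex_of_real ((norm (P f))\<^sup>2) = (\<Sum>e\<in>F. cnj (cinner f e) * cinner f e)"
    unfolding cinner_self_norm[symmetric] sq by (simp add: c)
  also have "\<dots> = complex_of_real (\<Sum>e\<in>F. (cmod (cinner f e))\<^sup>2)"
    unfolding of_real_sum by (intro sum.cong refl) (simp add: complex_norm_square mult.commute del: of_real_power)
  finally show n: "(norm (P f))\<^sup>2 = (\<Sum>e\<in>F. (cmod (cinner f e))\<^sup>2)"
    by (simp only: of_real_eq_iff)
  have "cinner f (P f) = cinner (P f) (P f)"
    unfolding sq by (simp add: c)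
  then have "(norm (P f))\<^sup>2 = cmod (cinner f (P f))"
    by (simp add: cinner_self_norm norm_power)
  also have "\<dots> \<le> norm f * norm (P f)"
    by (rule cmod_cinner_le)
  finally have "norm (P f) * norm (P f) \<le> norm f * norm (P f)"
    by (simp add: power2_eq_square)
  then show "norm (P f) \<le> norm f"
    by (cases "norm (P f) = 0") auto
qed

text \<open>The vectors with a convergent expansion form a complex subspace containing
  \<open>E\<close>. It is closed because partial sums are contractions, uniformly over finite
  subsets, so totality of \<open>E\<close> finishes the proof. Summing over finite subsets avoids
  any countability assumption.\<close>

lemma orthonormal_expansion:
  assumes E: "orthonormal_basis E"
  shows "((\<lambda>e. scaleC (cinner f e) e) has_sum f) E"
proof -
  define S where "S = {f. ((\<lambda>e. scaleC (cinner f e) e) has_sum f) E}"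
  have "S = UNIV"
  proof (rule complex_subspace_eq_UNIV)
    show "subspace S"
    proof (rule subspaceI)
      show "0 \<in> S" unfolding S_def by (auto intro: has_sum_0)
      show "x + y \<in> S" if "x \<in> S" "y \<in> S" for x y
      proof -
        have "scaleC (cinner (x + y) e) e = scaleC (cinner x e) e + scaleC (cinner y e) e" for e
          by (rule cinner_eqI) (simp add: cinner_scaleC_left cinner_add_left distrib_right)
        then show ?thesis
          using has_sum_add[of "\<lambda>e. scaleC (cinner x e) e" E x] that by (simp add: S_def)
      qed
      show "c *\<^sub>R x \<in> S" if "x \<in> S" for c x
        using has_sum_scaleR[of "\<lambda>e. scaleC (cinner x e) e" E x c] that
        by (simp add: S_def cinner_scaleC_left scaleR_l2_def scaleC_scaleC)
    qed
    show "scaleC c x \<in> S" if "x \<in> S" for c x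
      using has_sum_bounded_linear[OF bounded_linear_scaleC[of c], of "\<lambda>e. scaleC (cinner x e) e" E x] that
      by (simp add: S_def cinner_scaleC_left scaleC_scaleC)
    show "f = 0" if f: "\<And>s. s \<in> S \<Longrightarrow> cinner f s = 0" for f
    proof (rule orthonormal_basisD(2)[OF E])
      fix e assume e: "e \<in> E"
      have "e \<in> S"
        unfolding S_def mem_Collect_eq
        by (rule has_sum_finite_neutralI[of "{e}"]) (use orthonormal_basisD(1)[OF E] e in auto)
      then show "cinner f e = 0" by (rule f)
    qed
    show "closed S"
      unfolding closed_sequential_limits
    proof (intro allI impI, elim conjE)
      fix X f assume X: "\<forall>n. X n \<in> S" and lim: "X \<longlonglongrightarrow> f"
      let ?P = "\<lambda>f F. \<Sum>e\<in>F. scaleC (cinner f e) e"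
      have "(?P f \<longlongrightarrow> f) (finite_subsets_at_top E)"
      proof (rule tendstoI)
        fix \<epsilon> :: real assume \<epsilon>: "\<epsilon> > 0"
        from lim have "\<forall>\<^sub>F n in sequentially. dist (X n) f < \<epsilon> / 3"
          by (rule tendstoD) (use \<epsilon> in simp)
        then obtain n where n: "norm (f - X n) < \<epsilon> / 3"
          by (auto simp: eventually_sequentially dist_norm norm_minus_commute)
        have "(?P (X n) \<longlongrightarrow> X n) (finite_subsets_at_top E)"
          using X unfolding S_def has_sum_def by blast
        then have "\<forall>\<^sub>F F in finite_subsets_at_top E. dist (?P (X n) F) (X n) < \<epsilon> / 3"
          by (rule tendstoD) (use \<epsilon> in simp)
        moreover have "\<forall>\<^sub>F F in finite_subsets_at_top E. finite F \<and> F \<subseteq> E"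
          by (rule eventually_finite_subsets_at_top_weakI) simp
        ultimately show "\<forall>\<^sub>F F in finite_subsets_at_top E. dist (?P f F) f < \<epsilon>"
        proof eventually_elim
          case (elim F)
          have "?P f F = ?P (f - X n) F + ?P (X n) F"
            unfolding sum.distrib[symmetric]
            by (intro sum.cong refl cinner_eqI)
              (simp add: cinner_scaleC_left cinner_add_left cinner_diff_left left_diff_distrib)
          then have "?P f F - f = ?P (f - X n) F + (?P (X n) F - X n) - (f - X n)"
            by simp
          then have "norm (?P f F - f) \<le> norm (?P (f - X n) F) + norm (?P (X n) F - X n) + norm (f - X n)"
            using norm_triangle_ineq4[of "?P (f - X n) F + (?P (X n) F - X n)" "f - X n"]
              norm_triangle_ineq[of "?P (f - X n) F" "?P (X n) F - X n"] by simp
          also have "\<dots> < \<epsilon>"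
            using orthonormal_partial_sum(2)[OF E, of F "f - X n"] elim n by (simp add: dist_norm)
          finally show ?case by (simp add: dist_norm)
        qed
      qed
      then show "f \<in> S"
        unfolding S_def has_sum_def by simp
    qed
  qed
  then show ?thesis unfolding S_def by blast
qed

lemma parseval:
  assumes E: "orthonormal_basis E"
  shows "((\<lambda>e. (cmod (cinner f e))\<^sup>2) has_sum (norm f)\<^sup>2) E"
proof -
  have "((\<lambda>F. (norm (\<Sum>e\<in>F. scaleC (cinner f e) e))\<^sup>2) \<longlongrightarrow> (norm f)\<^sup>2) (finite_subsets_at_top E)"
    using orthonormal_expansion[OF E, of f] unfolding has_sum_def by (intro tendsto_intros)
  moreover have "\<forall>\<^sub>F F in finite_subsets_at_top E.
      (norm (\<Sum>e\<in>F. scaleC (cinner f e) e))\<^sup>2 = (\<Sum>e\<in>F. (cmod (cinner f e))\<^sup>2)"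
    by (rule eventually_finite_subsets_at_top_weakI) (rule orthonormal_partial_sum(1)[OF E])
  ultimately show ?thesis
    unfolding has_sum_def by (simp cong: tendsto_cong)
qed

text \<open>Zorn's lemma gives a maximal orthonormal set; a nonzero vector orthogonal to it could be
  normalized and added. This justifies the \<open>SOME\<close> in \<open>hs_norm\<close>.\<close>

lemma orthonormal_basis_exists: "\<exists>E :: 'a::euclidean_space l2 set. orthonormal_basis E"
proof -
  define A where "A = {E :: 'a l2 set. \<forall>e\<in>E. \<forall>e'\<in>E. cinner e e' = (if e = e' then 1 else 0)}"
  have "\<Union>C \<in> A" if "C \<in> chains A" for C
    unfolding A_def
  proof (intro CollectI ballI)
    fix e e' assume "e \<in> \<Union>C" "e' \<in> \<Union>C"
    then obtain X Y where "X \<in> C" "e \<in> X" "Y \<in> C" "e' \<in> Y" by blast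
    moreover from this have "X \<subseteq> Y \<or> Y \<subseteq> X"
      using chainsD[OF that] by blast
    ultimately obtain Z where "Z \<in> C" "e \<in> Z" "e' \<in> Z" by blast
    moreover from \<open>Z \<in> C\<close> have "Z \<in> A"
      using chainsD2[OF that] by blast
    ultimately show "cinner e e' = (if e = e' then 1 else 0)"
      by (simp add: A_def)
  qed
  from Zorn_Lemma[of A] this obtain M where M: "M \<in> A" "\<And>X. X \<in> A \<Longrightarrow> M \<subseteq> X \<Longrightarrow> X = M"
    by blast
  have "f = 0" if f: "\<forall>e\<in>M. cinner f e = 0" for f
  proof (rule ccontr)
    assume "f \<noteq> 0"
    define u where "u = scaleC (1 / of_real (norm f)) f"
    have uu: "cinner u u = 1"
      using \<open>f \<noteq> 0\<close> unfolding u_def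
      by (simp add: cinner_self_norm norm_scaleC norm_divide)
    have uM: "cinner u e = 0" "cinner e u = 0" if "e \<in> M" for e
      using f that cinner_commute[of e u] by (simp_all add: u_def cinner_scaleC_left)
    have "insert u M \<in> A"
      using M(1) uu uM unfolding A_def by auto
    then have "u \<in> M"
      using M(2)[of "insert u M"] by blast
    then show False
      using uM[of u] uu by simp
  qed
  then show ?thesis
    using M(1) unfolding A_def orthonormal_basis_def by blast
qed

subsection \<open>Hilbert--Schmidt operators and their kernels\<close>

lemma norm_tensor: "norm (tensor g f) = norm g * norm f"
proof -
  have "complex_of_real ((norm (tensor g f))\<^sup>2) = complex_of_real ((norm g * norm f)\<^sup>2)"
    unfolding cinner_self_norm[symmetric] cinner_tensor
    by (simp add: cinner_self_norm power_mult_distrib)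
  then have "(norm (tensor g f))\<^sup>2 = (norm g * norm f)\<^sup>2"
    by (simp only: of_real_eq_iff)
  then show ?thesis
    by (simp add: power2_eq_iff_nonneg)
qed

lemma tensor_total_eqI:
  assumes "\<And>g f. cinner K (tensor g f) = cinner L (tensor g f)"
  shows "K = L"
  using tensor_total[of "K - L"] assms by (simp add: cinner_diff_left)

lemma tensor_add_left: "tensor (g + g') f = tensor g f + tensor g' f"
  by (rule tensor_total_eqI) (simp add: cinner_add_left cinner_tensor distrib_right)

lemma tensor_add_right: "tensor g (f + f') = tensor g f + tensor g f'"
  by (rule tensor_total_eqI) (simp add: cinner_add_left cinner_tensor distrib_left)

lemma tensor_scaleC_left: "tensor (scaleC c g) f = scaleC c (tensor g f)"
  by (rule tensor_total_eqI) (simp add: cinner_scaleC_left cinner_tensor)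

lemma tensor_scaleC_right: "tensor g (scaleC c f) = scaleC (cnj c) (tensor g f)"
  by (rule tensor_total_eqI) (simp add: cinner_scaleC_left cinner_tensor)

text \<open>The weak form of the integral operator sending \<open>f\<close> to the function of
  \<open>s\<close> given by integrating \<open>K (s, t) * f t\<close> over \<open>t\<close>; the
  Riesz theorem provides the witness.\<close>

definition kernel_op :: "('a::euclidean_space \<times> 'a) l2 \<Rightarrow> 'a l2 \<Rightarrow> 'a l2" where
  "kernel_op K f = (SOME y. \<forall>g. cinner y g = cinner K (tensor g f))"

lemma cinner_kernel_op: "cinner (kernel_op K f) g = cinner K (tensor g f)"
proof -
  have "bounded_linear (\<lambda>g. cinner (tensor g f) K)"
  proof (rule bounded_linear_intro[of _ "norm f * norm K"])
    show "norm (cinner (tensor g f) K) \<le> norm g * (norm f * norm K)" for g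
      using cmod_cinner_le[of "tensor g f" K] by (simp add: norm_tensor mult.assoc)
  qed (simp_all add: tensor_add_left cinner_add_left scaleR_l2_def tensor_scaleC_left cinner_scaleC_left scaleR_conv_of_real)
  then obtain y where y: "\<And>g. cinner (tensor g f) K = cinner g y"
    using riesz_representation_l2[of "\<lambda>g. cinner (tensor g f) K"] 
    by (auto simp: tensor_scaleC_left cinner_scaleC_left)
  have "\<forall>g. cinner y g = cinner K (tensor g f)"
    using y by (metis cinner_commute)
  then have "\<forall>g. cinner (kernel_op K f) g = cinner K (tensor g f)"
    unfolding kernel_op_def by (rule someI)
  then show ?thesis by blast
qed

lemma kernel_op_unique: "(\<And>f g. cinner (T f) g = cinner K (tensor g f)) \<Longrightarrow> T = kernel_op K"
  by (intro ext cinner_eqI) (simp add: cinner_kernel_op)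

lemma kernel_op_kernel_add: "kernel_op (K + L) f = kernel_op K f + kernel_op L f"
  by (rule cinner_eqI) (simp add: cinner_kernel_op cinner_add_left)

lemma kernel_op_kernel_diff: "kernel_op (K - L) f = kernel_op K f - kernel_op L f"
  by (rule cinner_eqI) (simp add: cinner_kernel_op cinner_diff_left)

lemma kernel_op_kernel_scaleC: "kernel_op (scaleC c K) f = scaleC c (kernel_op K f)"
  by (rule cinner_eqI) (simp add: cinner_kernel_op cinner_scaleC_left)

lemma kernel_op_tensor: "kernel_op (tensor g e) f = scaleC (cinner f e) g"
  by (rule cinner_eqI) (simp add: cinner_kernel_op cinner_tensor cinner_scaleC_left cinner_commute[of f e] mult.commute)

lemma bounded_clinear_kernel_op: "bounded_clinear (kernel_op K)"
proof -
  have add: "kernel_op K (f + f') = kernel_op K f + kernel_op K f'" for f f'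
    by (rule cinner_eqI) (simp add: cinner_kernel_op cinner_add_left tensor_add_right cinner_add_right)
  have scale: "kernel_op K (scaleC c f) = scaleC c (kernel_op K f)" for c f
    by (rule cinner_eqI) (simp add: cinner_kernel_op cinner_scaleC_left tensor_scaleC_right cinner_scaleC_right)
  have "norm (kernel_op K f) \<le> norm f * norm K" for f
  proof -
    have "(norm (kernel_op K f))\<^sup>2 = cmod (cinner K (tensor (kernel_op K f) f))"
      unfolding cinner_kernel_op[symmetric] cinner_self_norm by (simp add: norm_power)
    also have "\<dots> \<le> norm K * (norm (kernel_op K f) * norm f)"
      using cmod_cinner_le[of K "tensor (kernel_op K f) f"] by (simp add: norm_tensor)
    finally have "norm (kernel_op K f) * norm (kernel_op K f) \<le> (norm f * norm K) * norm (kernel_op K f)"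
      by (simp add: power2_eq_square mult_ac)
    then show ?thesis
      by (cases "norm (kernel_op K f) = 0") auto
  qed
  then have "bounded_linear (kernel_op K)"
    by (intro bounded_linear_intro[of _ "norm K"]) (simp_all add: add scale scaleR_l2_def)
  then show ?thesis
    by (simp add: bounded_clinear_def scale)
qed

lemma bounded_clinear_eq_on_basis:
  assumes E: "orthonormal_basis E" and T: "bounded_clinear T" "bounded_clinear T'"
    and eq: "\<And>e. e \<in> E \<Longrightarrow> T e = T' e"
  shows "T = T'"
proof
  fix f
  have lin: "bounded_linear T" "bounded_linear T'"
    and sc: "\<And>c f. T (scaleC c f) = scaleC c (T f)" "\<And>c f. T' (scaleC c f) = scaleC c (T' f)"
    using T by (auto simp: bounded_clinear_def)
  note X = orthonormal_expansion[OF E, of f]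
  have "((\<lambda>e. T (scaleC (cinner f e) e)) has_sum T f) E"
    by (rule has_sum_bounded_linear[OF lin(1) X])
  moreover have "((\<lambda>e. T' (scaleC (cinner f e) e)) has_sum T' f) E"
    by (rule has_sum_bounded_linear[OF lin(2) X])
  moreover have "((\<lambda>e. T (scaleC (cinner f e) e)) has_sum T' f) E \<longleftrightarrow>
      ((\<lambda>e. T' (scaleC (cinner f e) e)) has_sum T' f) E"
    by (rule has_sum_cong) (simp add: sc eq)
  ultimately show "T f = T' f"
    using has_sum_unique by blast
qed

lemma orthonormal_basis_tensor:
  assumes E: "orthonormal_basis E"
  shows "orthonormal_basis ((\<lambda>(e, e'). tensor e' e) ` (E \<times> E))"
    and "inj_on (\<lambda>(e, e'). tensor e' e) (E \<times> E)"
proof -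
  note on = orthonormal_basisD(1)[OF E]
  have on2: "cinner (tensor e' e) (tensor d' d) = (if e = d \<and> e' = d' then 1 else 0)"
    if "e \<in> E" "e' \<in> E" "d \<in> E" "d' \<in> E" for e e' d d'
    using that by (simp add: cinner_tensor on)
  have inj: "e = d \<and> e' = d'" if "e \<in> E" "e' \<in> E" "d \<in> E" "d' \<in> E" "tensor e' e = tensor d' d" for e e' d d'
    using on2[OF that(1-4)] on2[OF that(1,2,1,2)] that(5) by (auto split: if_splits)
  then show "inj_on (\<lambda>(e, e'). tensor e' e) (E \<times> E)"
    by (auto simp: inj_on_def)
  have total: "K = 0" if K: "\<And>e e'. e \<in> E \<Longrightarrow> e' \<in> E \<Longrightarrow> cinner K (tensor e' e) = 0" for K
  proof (rule tensor_total)
    \<comment> \<open>Orthogonality to all tensors of basis vectors says that the operator kills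
      every basis vector, hence vanishes.\<close>
    have "kernel_op K = kernel_op 0"
    proof (rule bounded_clinear_eq_on_basis[OF E bounded_clinear_kernel_op bounded_clinear_kernel_op])
      fix e assume "e \<in> E"
      have "kernel_op K e = 0"
        by (rule orthonormal_basisD(2)[OF E]) (simp add: cinner_kernel_op K \<open>e \<in> E\<close>)
      moreover have "kernel_op 0 e = 0"
        by (rule orthonormal_basisD(2)[OF E]) (simp add: cinner_kernel_op)
      ultimately show "kernel_op K e = kernel_op 0 e" by simp
    qed
    then show "cinner K (tensor g f) = 0" for g f
      unfolding cinner_kernel_op[symmetric] by (simp add: cinner_kernel_op)
  qed
  show "orthonormal_basis ((\<lambda>(e, e'). tensor e' e) ` (E \<times> E))"
    unfolding orthonormal_basis_def
  proof (intro conjI ballI allI impI)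
    fix x y assume "x \<in> (\<lambda>(e, e'). tensor e' e) ` (E \<times> E)" "y \<in> (\<lambda>(e, e'). tensor e' e) ` (E \<times> E)"
    then obtain e e' d d' where xy: "e \<in> E" "e' \<in> E" "d \<in> E" "d' \<in> E" "x = tensor e' e" "y = tensor d' d"
      by auto
    then show "cinner x y = (if x = y then 1 else 0)"
      using on2[OF xy(1-4)] inj[OF xy(1-4)] by auto
  next
    fix K assume "\<forall>x\<in>(\<lambda>(e, e'). tensor e' e) ` (E \<times> E). cinner K x = 0"
    then show "K = 0" by (intro total) auto
  qed
qed

text \<open>One double series read in two ways: Parseval in the tensor basis gives its total,
  Parseval in \<open>E\<close> its inner sums. The total does not involve \<open>E\<close>, which is
  the basis independence behind \<open>hs_norm\<close>.\<close>

lemma kernel_op_has_sum: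
  assumes E: "orthonormal_basis E"
  shows "((\<lambda>e. (norm (kernel_op K e))\<^sup>2) has_sum (norm K)\<^sup>2) E"
proof (rule has_sum_SigmaD)
  show "((\<lambda>(e, e'). (cmod (cinner K (tensor e' e)))\<^sup>2) has_sum (norm K)\<^sup>2) (E \<times> E)"
    using parseval[OF orthonormal_basis_tensor(1)[OF E], of K]
    unfolding has_sum_reindex[OF orthonormal_basis_tensor(2)[OF E]]
    by (simp add: o_def case_prod_unfold)
  show "((\<lambda>e'. case (e, e') of (e, e') \<Rightarrow> (cmod (cinner K (tensor e' e)))\<^sup>2) has_sum (norm (kernel_op K e))\<^sup>2) E" for e
    using parseval[OF E, of "kernel_op K e"] by (simp add: cinner_kernel_op)
qed

lemma hs_norm_kernel_op: "hs_norm (kernel_op K) = norm K"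
proof -
  have "orthonormal_basis (SOME E :: 'a l2 set. orthonormal_basis E)"
    by (rule someI_ex[OF orthonormal_basis_exists])
  from infsumI[OF kernel_op_has_sum[OF this, of K]] show ?thesis
    by (simp add: hs_norm_def)
qed

text \<open>The kernel of \<open>T\<close> represents the functional \<open>\<lambda>L. \<Sum>\<^sub>\<infinity>e\<in>E. cinner (kernel_op L e) (T e)\<close>.\<close>

lemma hilbert_schmidt_kernel: "T \<in> hilbert_schmidt \<longleftrightarrow> (\<exists>K. T = kernel_op K)"
proof
  assume "\<exists>K. T = kernel_op K"
  then show "T \<in> hilbert_schmidt"
    using orthonormal_basis_exists kernel_op_has_sum bounded_clinear_kernel_op
    unfolding hilbert_schmidt_def summable_on_def by blast
next
  assume "T \<in> hilbert_schmidt"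
  then obtain E where T: "bounded_clinear T" and E: "orthonormal_basis E"
    and sum: "(\<lambda>e. (norm (T e))\<^sup>2) summable_on E"
    unfolding hilbert_schmidt_def by blast
  define S where "S = (\<Sum>\<^sub>\<infinity>e\<in>E. (norm (T e))\<^sup>2)"
  define \<psi> where "\<psi> L = (\<Sum>\<^sub>\<infinity>e\<in>E. cinner (kernel_op L e) (T e))" for L
  have S: "((\<lambda>e. (norm (T e))\<^sup>2) has_sum S) E"
    unfolding S_def using sum by simp
  then have S0: "S \<ge> 0"
    by (rule has_sum_nonneg) simp
  have dom: "((\<lambda>e. (norm (kernel_op L e))\<^sup>2 + (norm (T e))\<^sup>2) has_sum ((norm L)\<^sup>2 + S)) E" for L
    by (rule has_sum_add[OF kernel_op_has_sum[OF E] S])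
  \<comment> \<open>Domination by two convergent series makes the functional absolutely
    convergent.\<close>
  have le: "cmod (cinner (kernel_op L e) (T e)) \<le> (norm (kernel_op L e))\<^sup>2 + (norm (T e))\<^sup>2" for L e
    using cmod_cinner_le[of "kernel_op L e" "T e"] sum_squares_bound[of "norm (kernel_op L e)" "norm (T e)"]
      mult_nonneg_nonneg[OF norm_ge_zero[of "kernel_op L e"] norm_ge_zero[of "T e"]]
    by (simp only: mult.assoc)
  have has: "((\<lambda>e. cinner (kernel_op L e) (T e)) has_sum \<psi> L) E" for L
  proof -
    have "(\<lambda>e. norm (cinner (kernel_op L e) (T e))) summable_on E"
      by (rule Infinite_Sum.abs_summable_on_comparison_test'[OF _ le]) (use dom in \<open>auto simp: summable_on_def\<close>)
    then show ?thesis
      unfolding \<psi>_def by (rule has_sum_infsum[OF abs_summable_summable])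
  qed
  have bound: "cmod (\<psi> L) \<le> (norm L)\<^sup>2 + S" for L
    by (rule norm_infsum_le[OF has dom le])
  have add: "\<psi> (L + L') = \<psi> L + \<psi> L'" for L L'
    using has_sum_unique[OF has[of "L + L'"]] has_sum_add[OF has[of L] has[of L']]
    by (simp add: kernel_op_kernel_add cinner_add_left)
  have scale: "\<psi> (scaleC c L) = c * \<psi> L" for c L
    using has_sum_unique[OF has[of "scaleC c L"]] has_sum_cmult_right[OF has[of L], of c]
    by (simp add: kernel_op_kernel_scaleC cinner_scaleC_left)
  have "bounded_linear \<psi>"
  proof (rule bounded_linear_intro[of _ "1 + S"])
    show "norm (\<psi> L) \<le> norm L * (1 + S)" for L
    proof (cases "L = 0")
      case True
      then show ?thesis using scale[of 0 0] by simp
    next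
      case False
      \<comment> \<open>The bound on \<open>\<psi>\<close> is not homogeneous; applied to a vector
        of norm 1 it reads \<open>1 + S\<close>, and scaling turns this into a linear bound.\<close>
      define u where "u = scaleC (1 / of_real (norm L)) L"
      have "norm u = 1" using False by (simp add: u_def norm_scaleC norm_divide)
      moreover have "L = scaleC (of_real (norm L)) u" using False by (simp add: u_def scaleC_scaleC)
      ultimately show ?thesis
        using bound[of u] scale[of "of_real (norm L)" u] by (simp add: norm_mult mult_left_mono)
    qed
  qed (simp_all add: add scale scaleR_l2_def scaleR_conv_of_real)
  then obtain K where K: "\<And>L. \<psi> L = cinner L K"
    using riesz_representation_l2[of \<psi>, OF _ scale] by blast
  have "T = kernel_op K"
  proof (rule bounded_clinear_eq_on_basis[OF E T bounded_clinear_kernel_op])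
    fix e assume e: "e \<in> E"
    show "T e = kernel_op K e"
    proof (rule cinner_eqI)
      fix g
      \<comment> \<open>\<open>kernel_op (tensor g e)\<close> sends \<open>e\<close> to
        \<open>g\<close> and kills the other basis vectors, so a single term survives.\<close>
      have "((\<lambda>e'. cinner (kernel_op (tensor g e) e') (T e')) has_sum cinner g (T e)) E"
        by (rule has_sum_finite_neutralI[of "{e}"])
          (use e orthonormal_basisD(1)[OF E] in \<open>auto simp: kernel_op_tensor\<close>)
      then have "cinner (tensor g e) K = cinner g (T e)"
        using has_sum_unique[OF has[of "tensor g e"]] K by metis
      then show "cinner (T e) g = cinner (kernel_op K e) g"
        unfolding cinner_kernel_op by (metis cinner_commute)
    qed
  qed
  then show "\<exists>K. T = kernel_op K" by blast
qed

subsection \<open>Localization operators\<close>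

lemma square_integrable_mult_bounded:
  assumes f: "square_integrable f" and [measurable]: "V \<in> borel_measurable borel"
    and B: "\<And>x. cmod (V x) \<le> B"
  shows "square_integrable (\<lambda>x. f x * V x)"
proof -
  have [measurable]: "f \<in> borel_measurable borel"
    by (rule square_integrable_measurable[OF f])
  have B0: "0 \<le> B" using B[of undefined] norm_ge_zero order_trans by blast
  have "integrable lborel (\<lambda>x. B\<^sup>2 * (cmod (f x))\<^sup>2)"
    using f by (simp add: square_integrable_def)
  then have "integrable lborel (\<lambda>x. (cmod (f x * V x))\<^sup>2)"
  proof (rule Bochner_Integration.integrable_bound)
    have "(cmod (f x * V x))\<^sup>2 \<le> B\<^sup>2 * (cmod (f x))\<^sup>2" for x
      using B[of x] B0 by (simp add: norm_mult power_mult_distrib mult.commute[of _ "(cmod (f x))\<^sup>2"] mult_left_mono power_mono)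
    then show "AE x in lborel. norm ((cmod (f x * V x))\<^sup>2) \<le> norm (B\<^sup>2 * (cmod (f x))\<^sup>2)"
      by (intro AE_I2) simp
  qed measurable
  then show ?thesis by (simp add: square_integrable_def)
qed

text \<open>The indicator of any bounded part of the zero set of \<open>V\<close> is orthogonal to
  the range, so density makes that part null. Conversely \<open>h\<close> is approximated by
  dividing it by \<open>V\<close> where \<open>V\<close> is not too small.\<close>

lemma multiplication_range_dense_iff:
  fixes V :: "'a::euclidean_space \<Rightarrow> complex"
  assumes V [measurable]: "V \<in> borel_measurable borel" and B: "\<And>x. cmod (V x) \<le> B"
  shows "(\<forall>h. \<forall>\<epsilon>>0. \<exists>b. norm (h - abs_l2 (\<lambda>x. rep_l2 b x * V x)) < \<epsilon>) \<longleftrightarrow> (AE x in lborel. V x \<noteq> 0)"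
    (is "?dense \<longleftrightarrow> _")
proof
  have sq: "square_integrable (\<lambda>x. rep_l2 b x * V x)" for b
    by (rule square_integrable_mult_bounded[OF square_integrable_rep_l2 V B])
  assume dense: ?dense
  have "AE x in lborel. x \<in> {x. V x = 0} \<inter> box (- real n *\<^sub>R One) (real n *\<^sub>R One) \<longrightarrow> False" for n
  proof -
    \<comment> \<open>The zero set may have infinite measure; the cube makes its indicator
      square-integrable.\<close>
    let ?N = "{x. V x = 0} \<inter> box (- real n *\<^sub>R One) (real n *\<^sub>R One)"
    have N [measurable]: "?N \<in> sets borel" by measurable
    have ind: "square_integrable (indicator ?N :: 'a \<Rightarrow> complex)"
    proof (rule square_integrable_cong_AE)
      show "square_integrable (\<lambda>x. indicator (box (- real n *\<^sub>R One) (real n *\<^sub>R One)) x * indicator {x. V x = 0} x :: complex)"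
        by (rule square_integrable_mult_bounded[OF square_integrable_indicator_box, of _ 1]) (auto simp: indicator_def)
    qed (auto simp: indicator_def)
    let ?h = "abs_l2 (indicator ?N :: 'a \<Rightarrow> complex)"
    have "?h = 0"
    proof (rule ccontr)
      assume "?h \<noteq> 0"
      then have "norm ?h > 0" by simp
      with dense obtain b where b: "norm (?h - abs_l2 (\<lambda>x. rep_l2 b x * V x)) < norm ?h"
        by blast
      let ?m = "abs_l2 (\<lambda>x. rep_l2 b x * V x)"
      have "cinner ?m ?h = (LINT x|lborel. rep_l2 b x * V x * cnj (indicator ?N x))"
        by (rule cinner_abs_l2[OF sq ind])
      also have "\<dots> = (LINT x|(lborel :: 'a measure). 0 :: complex)"
        by (intro Bochner_Integration.integral_cong) (auto simp: indicator_def)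
      finally have "?m \<bullet> ?h = 0"
        by (simp add: inner_l2_def)
      then have "(norm (?h - ?m))\<^sup>2 = (norm ?h)\<^sup>2 + (norm ?m)\<^sup>2"
        by (simp add: power2_norm_eq_inner inner_diff_left inner_diff_right inner_commute)
      then have "norm ?h \<le> norm (?h - ?m)"
        by (auto intro: power2_le_imp_le)
      with b show False by simp
    qed
    then have "abs_l2 (indicator ?N) = abs_l2 (\<lambda>x :: 'a. 0 :: complex)"
      by (simp add: zero_l2_def)
    then have "AE x in lborel. indicator ?N x = (0 :: complex)"
      by (simp only: abs_l2_eq_iff[OF ind square_integrable_zero])
    then show ?thesis
      by eventually_elim (auto simp: indicator_def split: if_splits)
  qed
  then have "AE x in lborel. \<forall>n. x \<in> {x. V x = 0} \<inter> box (- real n *\<^sub>R One) (real n *\<^sub>R One) \<longrightarrow> False"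
    unfolding AE_all_countable by (rule allI)
  then show "AE x in lborel. V x \<noteq> 0"
  proof eventually_elim
    case (elim x)
    obtain n where n: "norm x < real n"
      using reals_Archimedean2 by blast
    have "\<bar>x \<bullet> b\<bar> < real n" if "b \<in> Basis" for b
      using Basis_le_norm[OF that, of x] n by linarith
    then have "x \<in> box (- real n *\<^sub>R One) (real n *\<^sub>R One)"
      by (auto simp: mem_box abs_less_iff minus_less_iff)
    then show ?case using elim[rule_format, of n] by blast
  qed
next
  assume nz: "AE x in lborel. V x \<noteq> 0"
  show ?dense
  proof (intro allI impI)
    fix h :: "'a l2" and \<epsilon> :: real assume \<epsilon>: "\<epsilon> > 0"
    let ?C = "\<lambda>n x. 1 / real (Suc n) \<le> cmod (V x)"
    \<comment> \<open>A truncated reciprocal, bounded by \<open>Suc n\<close>. Then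
      \<open>u n x * V x\<close> is the indicator of the set where \<open>?C n\<close> holds, and
      these sets increase to the set where \<open>V\<close> is nonzero.\<close>
    define u where "u n x = (if ?C n x then 1 / V x else 0)" for n x
    define w where "w n x = rep_l2 h x * (if ?C n x then 1 else 0)" for n x
    have u_meas [measurable]: "u n \<in> borel_measurable borel" for n
      unfolding u_def by measurable
    have u_bound: "cmod (u n x) \<le> real (Suc n)" for n x
    proof (cases "?C n x")
      case True
      then have "1 / cmod (V x) \<le> 1 / (1 / real (Suc n))"
        by (intro divide_left_mono mult_pos_pos) (auto intro: less_le_trans[of 0 "1 / real (Suc n)"])
      then show ?thesis
        using True by (simp add: u_def norm_divide)
    qed (simp add: u_def)
    define b where "b n = abs_l2 (\<lambda>x. rep_l2 h x * u n x)" for n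
    have sq_b: "square_integrable (\<lambda>x. rep_l2 h x * u n x)" for n
      by (rule square_integrable_mult_bounded[OF square_integrable_rep_l2 u_meas u_bound])
    have sq: "square_integrable (\<lambda>x. rep_l2 c x * V x)" for c
      by (rule square_integrable_mult_bounded[OF square_integrable_rep_l2 V B])
    have sq_w: "square_integrable (w n)" for n
      unfolding w_def by (rule square_integrable_mult_bounded[OF square_integrable_rep_l2, of _ 1]) auto
    have bw: "abs_l2 (\<lambda>x. rep_l2 (b n) x * V x) = abs_l2 (w n)" for n
      unfolding abs_l2_eq_iff[OF sq sq_w] b_def using rep_abs_l2[OF sq_b[of n]]
      by eventually_elim (auto simp: w_def u_def)
    have norm_eq: "(norm (h - abs_l2 (w n)))\<^sup>2 = (LINT x|lborel. (cmod (rep_l2 h x - w n x))\<^sup>2)" for n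
    proof -
      have "h - abs_l2 (w n) = abs_l2 (\<lambda>x. rep_l2 h x - w n x)"
      proof (rule l2_eqI)
        show "AE x in lborel. rep_l2 (h - abs_l2 (w n)) x = rep_l2 (abs_l2 (\<lambda>x. rep_l2 h x - w n x)) x"
          using rep_l2_diff[of h "abs_l2 (w n)"] rep_abs_l2[OF sq_w[of n]]
            rep_abs_l2[OF square_integrable_diff[OF square_integrable_rep_l2 sq_w], of h n]
          by eventually_elim simp
      qed
      then show ?thesis
        by (simp add: norm_abs_l2 square_integrable_diff square_integrable_rep_l2 sq_w)
    qed
    have "(\<lambda>n. LINT x|lborel. (cmod (rep_l2 h x - w n x))\<^sup>2) \<longlonglongrightarrow> (LINT x|(lborel :: 'a measure). 0 :: real)"
    proof (rule integral_dominated_convergence[where w = "\<lambda>x. (cmod (rep_l2 h x))\<^sup>2"])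
      show "AE x in lborel. (\<lambda>n. (cmod (rep_l2 h x - w n x))\<^sup>2) \<longlonglongrightarrow> 0"
        using nz
      proof eventually_elim
        case (elim x)
        then have "\<forall>\<^sub>F n in sequentially. 1 / real (Suc n) < cmod (V x)"
          using order_tendstoD(2)[OF LIMSEQ_Suc[OF lim_1_over_n], of "cmod (V x)"] by simp
        then have "\<forall>\<^sub>F n in sequentially. (cmod (rep_l2 h x - w n x))\<^sup>2 = 0"
          by eventually_elim (simp add: w_def)
        then show ?case by (rule tendsto_eventually)
      qed
      show "integrable lborel (\<lambda>x. (cmod (rep_l2 h x))\<^sup>2)"
        using square_integrable_rep_l2[of h] by (simp add: square_integrable_def)
      show "(\<lambda>x. (cmod (rep_l2 h x - w n x))\<^sup>2) \<in> borel_measurable lborel" for n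
        unfolding w_def by measurable
      show "AE x in lborel. norm ((cmod (rep_l2 h x - w n x))\<^sup>2) \<le> (cmod (rep_l2 h x))\<^sup>2" for n
        by (rule AE_I2) (simp add: w_def)
    qed simp
    then have "\<forall>\<^sub>F n in sequentially. (norm (h - abs_l2 (w n)))\<^sup>2 < \<epsilon>\<^sup>2"
      unfolding norm_eq[symmetric] by (rule order_tendstoD(2)) (use \<epsilon> in simp)
    then obtain n where "(norm (h - abs_l2 (w n)))\<^sup>2 < \<epsilon>\<^sup>2"
      by (auto simp: eventually_sequentially)
    then have "norm (h - abs_l2 (w n)) < \<epsilon>"
      using \<epsilon> by (auto intro: power_less_imp_less_base)
    then show "\<exists>b. norm (h - abs_l2 (\<lambda>x. rep_l2 b x * V x)) < \<epsilon>"
      by (intro exI[of _ "b n"]) (simp only: bw)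
  qed
qed

text \<open>Resolves the \<open>THE\<close>: the weak identity determines each value against all
  \<open>g\<close>, so \<open>kernel_op K\<close> is the only map, linear or not, that satisfies
  it.\<close>

lemma localization_op_kernel:
  fixes \<phi>\<^sub>1 \<phi>\<^sub>2 :: "'a::euclidean_space l2"
  assumes "\<And>f g. cinner K (tensor g f) = (LINT z|lborel. rep_l2 a z * stft \<phi>\<^sub>1 f z * cnj (stft \<phi>\<^sub>2 g z))"
  shows "localization_op \<phi>\<^sub>1 \<phi>\<^sub>2 a = kernel_op K"
  unfolding localization_op_def
proof (rule the_equality)
  show "\<forall>f g. cinner (kernel_op K f) g = (LINT z|lborel. rep_l2 a z * stft \<phi>\<^sub>1 f z * cnj (stft \<phi>\<^sub>2 g z))"
    by (simp add: cinner_kernel_op assms)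
qed (rule kernel_op_unique, simp add: assms)

lemma localization_op_range_dense_iff:
  fixes \<phi>\<^sub>1 \<phi>\<^sub>2 :: "'a::euclidean_space l2"
  shows "hs_dense (range (localization_op \<phi>\<^sub>1 \<phi>\<^sub>2)) \<longleftrightarrow> (AE z in lborel. stft \<phi>\<^sub>1 \<phi>\<^sub>2 z \<noteq> 0)"
proof -
  obtain \<Theta> :: "('a \<times> 'a) l2 \<Rightarrow> ('a \<times> 'a) l2" where
    \<Theta>: "\<And>K L. cinner (\<Theta> K) (\<Theta> L) = cinner K L" "surj \<Theta>"
      "\<And>g f. \<Theta> (tensor g f) = abs_l2 (\<lambda>\<zeta>. stft f g (rot \<zeta>))"
    using fourier_wigner by blast
  obtain F :: "('a \<times> 'a) l2 \<Rightarrow> ('a \<times> 'a) l2" where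
    F: "\<And>f g. cinner (F f) (F g) = cinner f g" "surj F"
      "\<And>f :: 'a \<times> 'a \<Rightarrow> complex. integrable lborel f \<Longrightarrow> square_integrable f \<Longrightarrow> square_integrable (fourier f)"
      "\<And>f. integrable lborel f \<Longrightarrow> square_integrable f \<Longrightarrow> F (abs_l2 f) = abs_l2 (fourier f)"
    using plancherel by blast
  define V where "V \<zeta> = stft \<phi>\<^sub>1 \<phi>\<^sub>2 (rot \<zeta>)" for \<zeta>
  define M where "M b = abs_l2 (\<lambda>\<zeta>. rep_l2 b \<zeta> * V \<zeta>)" for b
  have V [measurable]: "V \<in> borel_measurable borel"
    unfolding V_def[abs_def] by measurable
  have VB: "cmod (V \<zeta>) \<le> norm \<phi>\<^sub>2 * norm \<phi>\<^sub>1" for \<zeta>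
    unfolding V_def by (rule norm_stft_le)
  have sq: "square_integrable (\<lambda>\<zeta>. rep_l2 b \<zeta> * V \<zeta>)" for b
    by (rule square_integrable_mult_bounded[OF square_integrable_rep_l2 V VB])
  \<comment> \<open>Pulling the multiplied transform of the symbol back along the surjection
    \<open>\<Theta>\<close> gives the candidate kernel of the localization operator.\<close>
  have "\<exists>K. \<Theta> K = M (F a)" for a
    using surjD[OF \<Theta>(2), of "M (F a)"] by (elim exE) (rule exI, rule sym)
  then have "\<forall>a. \<exists>K. \<Theta> K = M (F a)" ..
  from choice[OF this] obtain \<kappa> where "\<forall>a. \<Theta> (\<kappa> a) = M (F a)" ..
  then have \<kappa>: "\<Theta> (\<kappa> a) = M (F a)" for a ..
  have loc: "localization_op \<phi>\<^sub>1 \<phi>\<^sub>2 a = kernel_op (\<kappa> a)" for a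
  proof (rule localization_op_kernel)
    fix f g :: "'a l2"
    let ?Z = "\<lambda>z. stft \<phi>\<^sub>2 g z * cnj (stft \<phi>\<^sub>1 f z)"
    have sq_st: "square_integrable (\<lambda>\<zeta>. stft f g (rot \<zeta>))"
      by (intro square_integrable_rot square_integrable_stft)
    have "cinner (\<kappa> a) (tensor g f) = cinner (M (F a)) (abs_l2 (\<lambda>\<zeta>. stft f g (rot \<zeta>)))"
      by (simp only: \<Theta>(1)[symmetric, of "\<kappa> a"] \<kappa> \<Theta>(3))
    also have "\<dots> = (LINT \<zeta>|lborel. rep_l2 (F a) \<zeta> * V \<zeta> * cnj (stft f g (rot \<zeta>)))"
      unfolding M_def by (rule cinner_abs_l2[OF sq sq_st])
    \<comment> \<open>The multiplier is absorbed into the test function: by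
      \<open>fourier_stft_product\<close>, \<open>V\<close> times the conjugated transform is the
      conjugate of \<open>fourier ?Z\<close>.\<close>
    also have "\<dots> = (LINT \<zeta>|lborel. rep_l2 (F a) \<zeta> * cnj (fourier ?Z \<zeta>))"
      unfolding fourier_stft_product V_def by (simp add: mult_ac)
    also have "\<dots> = cinner (F a) (abs_l2 (fourier ?Z))"
      by (rule cinner_abs_l2_right[symmetric, OF F(3)[OF stft_product_integrable]])
    also have "\<dots> = cinner a (abs_l2 ?Z)"
      by (simp only: F(4)[OF stft_product_integrable, symmetric] F(1))
    also have "\<dots> = (LINT z|lborel. rep_l2 a z * cnj (?Z z))"
      by (rule cinner_abs_l2_right[OF stft_product_integrable(2)])
    also have "\<dots> = (LINT z|lborel. rep_l2 a z * stft \<phi>\<^sub>1 f z * cnj (stft \<phi>\<^sub>2 g z))"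
      by (simp add: mult_ac)
    finally show "cinner (\<kappa> a) (tensor g f) = (LINT z|lborel. rep_l2 a z * stft \<phi>\<^sub>1 f z * cnj (stft \<phi>\<^sub>2 g z))" .
  qed
  \<comment> \<open>This carries Hilbert-Schmidt density over to the multiplier \<open>M\<close>. As
    \<open>K\<close> and \<open>a\<close> vary, \<open>\<Theta> K\<close> and \<open>F a\<close>
    each run through the whole space.\<close>
  have hs: "hs_norm (\<lambda>f. kernel_op K f - localization_op \<phi>\<^sub>1 \<phi>\<^sub>2 a f) = norm (\<Theta> K - M (F a))" for K a
  proof -
    have "(\<lambda>f. kernel_op K f - localization_op \<phi>\<^sub>1 \<phi>\<^sub>2 a f) = kernel_op (K - \<kappa> a)"
      by (simp add: fun_eq_iff loc kernel_op_kernel_diff)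
    then have "hs_norm (\<lambda>f. kernel_op K f - localization_op \<phi>\<^sub>1 \<phi>\<^sub>2 a f) = norm (K - \<kappa> a)"
      by (simp only: hs_norm_kernel_op)
    also have "\<dots> = norm (\<Theta> (K - \<kappa> a))"
      by (rule inner_preserving_norm[OF \<Theta>(1), symmetric])
    also have "\<dots> = norm (\<Theta> K - M (F a))"
      by (simp only: inner_preserving_diff[OF \<Theta>(1)] \<kappa>)
    finally show ?thesis .
  qed
  have "hs_dense (range (localization_op \<phi>\<^sub>1 \<phi>\<^sub>2)) \<longleftrightarrow>
      (\<forall>K. \<forall>\<epsilon>>0. \<exists>a. hs_norm (\<lambda>f. kernel_op K f - localization_op \<phi>\<^sub>1 \<phi>\<^sub>2 a f) < \<epsilon>)"
  proof -
    have HS: "hilbert_schmidt = range kernel_op"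
      by (auto simp: hilbert_schmidt_kernel)
    have "range (localization_op \<phi>\<^sub>1 \<phi>\<^sub>2) \<subseteq> range kernel_op"
      by (auto simp: loc)
    then show ?thesis
      unfolding hs_dense_def HS by (simp only: ball_simps bex_simps simp_thms)
  qed
  also have "\<dots> \<longleftrightarrow> (\<forall>K. \<forall>\<epsilon>>0. \<exists>a. norm (\<Theta> K - M (F a)) < \<epsilon>)"
    by (simp only: hs)
  also have "\<dots> \<longleftrightarrow> (\<forall>h\<in>range \<Theta>. \<forall>\<epsilon>>0. \<exists>b\<in>range F. norm (h - M b) < \<epsilon>)"
    by (simp only: ball_simps bex_simps)
  also have "\<dots> \<longleftrightarrow> (\<forall>h. \<forall>\<epsilon>>0. \<exists>b. norm (h - M b) < \<epsilon>)"
    by (simp add: \<Theta>(2) F(2))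
  also have "\<dots> \<longleftrightarrow> (AE \<zeta> in lborel. V \<zeta> \<noteq> 0)"
    unfolding M_def by (rule multiplication_range_dense_iff[OF V VB])
  also have "\<dots> \<longleftrightarrow> (AE z in lborel. stft \<phi>\<^sub>1 \<phi>\<^sub>2 z \<noteq> 0)"
    unfolding V_def by (rule AE_rot)
  finally show ?thesis .
qed

theorem corollary1p3:
  fixes \<phi>\<^sub>1 \<phi>\<^sub>2 :: "(real ^ 'd) l2"
  shows "hs_dense (range (localization_op \<phi>\<^sub>1 \<phi>\<^sub>2)) \<longleftrightarrow>
    (AE z in lborel. cinner \<phi>\<^sub>2 (tf_shift z \<phi>\<^sub>1) \<noteq> 0)"
  using localization_op_range_dense_iff[of \<phi>\<^sub>1 \<phi>\<^sub>2] by (simp only: stft_def)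

end
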